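(* For a sequence $\{Q_n\}_{n\in\mathbb{N}}$ of quadrature formulas on $\mathbb{S}^2$, $Q_n(f)=\sum_{j=1}^{N_n}w_j^{(n)}f(\mathbf{x}_j^{(n)})$, with associated degree-$n$ hyperinterpolation operators $L_n:=L_{n,Q_n}$, consider the following conditions: (HC) $\lim_{n\to\infty}\|L_nf-f\|_{L^2(\mathbb{S}^2)}=0$ for all $f\in C(\mathbb{S}^2)$; (QC) $\lim_{n\to\infty}|Q_n(f)-I(f)|=0$ for all $f\in C(\mathbb{S}^2)$; (FAP) $\lim_{n\to\infty}\|L_np-p\|_{L^2(\mathbb{S}^2)}=0$ for all $p\in\mathbb{P}(\mathbb{S}^2)$; (AP) $\lim_{n\to\infty}|Q_n(p)-I(p)|=0$ for all $p\in\mathbb{P}(\mathbb{S}^2)$; (MZ12) there is $C>0$ independent of $n$ such that for every $n$, $\sum_{j=1}^{N_n}|w_j^{(n)}||p(\mathbf{x}_j^{(n)})|\le C\|p\|_{L^2(\mathbb{S}^2)}$ for all $p\in\mathbb{P}_n(\mathbb{S}^2)$; (PS) there is $M>0$ independent of $n$ such that $\sup_{n\in\mathbb{N}}\sum_{j=1}^{N_n}|w_j^{(n)}|\le M$; (MZ1) there is $c_1>0$ independent of $n$ such that for every $n$, $\sum_{j=1}^{N_n}|w_j^{(n)}||p(\mathbf{x}_j^{(n)})|\le c_1\|p\|_{L^1(\mathbb{S}^2)}$ for all $p\in\mathbb{P}_n(\mathbb{S}^2)$; (MZ2) there is $c_2>0$ independent of $n$ such that for every $n$, $\sum_{j=1}^{N_n}|w_j^{(n)}||p(\mathbf{x}_j^{(n)})|^2\le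 c_2\|p\|_{L^2(\mathbb{S}^2)}^2$ for all $p\in\mathbb{P}_n(\mathbb{S}^2)$; (LB) there is $C>0$ such that $\sup_{n\in\mathbb{N}}\|L_n\|_{C(\mathbb{S}^2)\to L^2(\mathbb{S}^2)}\le C$; (QB) there is $M>0$ such that $\sup_{n\in\mathbb{N}}\|Q_n\|_{C(\mathbb{S}^2)\to\mathbb{R}}\le M$. Then the following relations hold. Equivalences, for every sequence $\{Q_n\}_{n\in\mathbb{N}}$: (HC) holds if and only if (FAP) and (MZ12) both hold; (QC) holds if and only if (AP) and (PS) both hold; (MZ12) is equivalent to (LB); (PS) is equivalent to (QB). Implications, for every sequence $\{Q_n\}_{n\in\mathbb{N}}$: (HC) implies (QC); (FAP) implies (AP); (MZ12) implies (PS); (MZ1) implies (MZ12); (MZ2) implies (MZ12). Non-implications (in each case there exists a sequence $\{Q_n\}_{n\in\mathbb{N}}$ satisfying the first condition but not the second): (QC) does not imply (HC); (AP) does not imply (FAP); (PS) does not imply (MZ12); (MZ12) does not imply (MZ1); (MZ12) does not imply (MZ2).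
   Context: $\mathbb{S}^2=\{\mathbf{x}\in\mathbb{R}^3:\|\mathbf{x}\|_2=1\}$ carries the surface measure $\omega$ with $\omega(\mathbb{S}^2)=4\pi$; $C(\mathbb{S}^2)$ is the space of real-valued continuous functions with the uniform norm $\|\cdot\|_\infty$; $L^1(\mathbb{S}^2)$ and $L^2(\mathbb{S}^2)$ are taken with respect to $\omega$; $I(f)=\int_{\mathbb{S}^2}f\,d\omega$. $\mathbb{N}=\{1,2,\ldots\}$. $\mathbb{H}_\ell$ is the space of spherical harmonics of degree $\ell$ (restrictions to $\mathbb{S}^2$ of real harmonic homogeneous polynomials of degree $\ell$ on $\mathbb{R}^3$), $\{Y_{\ell,k}: |k|\le \ell\}$ is an $L^2(\mathbb{S}^2)$-orthonormal basis of $\mathbb{H}_\ell$, $\mathbb{P}_n(\mathbb{S}^2)=\bigoplus_{\ell=0}^n\mathbb{H}_\ell$, and $\mathbb{P}(\mathbb{S}^2)=\bigoplus_{\ell=0}^\infty\mathbb{H}_\ell$ is the space of all spherical polynomials. A quadrature formula is a linear functional $Q(f)=\sum_{j=1}^N w_jf(\mathbf{x}_j)$ on $C(\mathbb{S}^2)$ given by $N$ pairwise distinct nodes $\mathbf{x}_1,\ldots,\mathbf{x}_N\in\mathbb{S}^2$ and arbitrary real (possibly signed) weights; $\|Q\|_{C(\mathbb{S}^2)\to\mathbb{R}}=\sup_{\|f\|_\infty\le1}|Q(f)|$. In a sequence $\{Q_n\}$, the nodes, weights and number of nodes $N_n$ may all depend on $n$. The degree-$n$ hyperinterpolation operator associated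 with $Q$ is $L_{n,Q}:C(\mathbb{S}^2)\to\mathbb{P}_n(\mathbb{S}^2)$, $L_{n,Q}f:=\sum_{\ell=0}^n\sum_{k=-\ell}^{\ell}Q(fY_{\ell,k})\,Y_{\ell,k}$, with operator norm $\|L_{n,Q}\|_{C(\mathbb{S}^2)\to L^2(\mathbb{S}^2)}=\sup_{\|f\|_\infty\le1}\|L_{n,Q}f\|_{L^2(\mathbb{S}^2)}$. *)

theory Defs
  imports "HOL-Analysis.Analysis"
begin

abbreviation unit_sphere :: "(real^3) set" where
  "unit_sphere \<equiv> sphere 0 1"

text \<open>
  A real-valued function on the sphere is represented by a total function on \<open>real^3\<close> whose
  values off the sphere are irrelevant: every notion below only looks at its values on the sphere.
\<close>

text \<open>
  Surface measure, in polar-coordinate (cone) form: \<open>\<omega>(A)\<close> is three times the volume of the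
  cone \<open>{x. 0 < norm x \<le> 1 \<and> x / norm x \<in> A}\<close>. The factor is \<open>1 / (\<integral>\<^sub>0\<^sup>1 r\<^sup>2 dr)\<close>.
\<close>

definition surface_measure :: "(real^3) measure" where
  "surface_measure =
     scale_measure 3
       (distr (restrict_space lborel (cball 0 1 - {0})) (restrict_space borel unit_sphere)
          (\<lambda>x. x /\<^sub>R norm x))"

lemma sets_surface_measure: "sets surface_measure = sets (restrict_space borel unit_sphere)"
  by (simp add: surface_measure_def)

lemma space_surface_measure: "space surface_measure = unit_sphere"
  by (simp add: surface_measure_def space_scale_measure space_restrict_space)

lemma emeasure_surface_measure:
  assumes "A \<in> sets surface_measure"
  shows "emeasure surface_measure A =
           3 * emeasure lborel {x. 0 < norm x \<and> norm x \<le> 1 \<and> x /\<^sub>R norm x \<in> A}"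
proof -
  let ?B = "cball 0 1 - {0} :: (real^3) set"
  let ?g = "\<lambda>x::real^3. x /\<^sub>R norm x"
  have meas: "?g \<in> measurable (restrict_space lborel ?B) (restrict_space borel unit_sphere)"
  proof (rule measurable_restrict_space2)
    show "?g \<in> space (restrict_space lborel ?B) \<rightarrow> unit_sphere"
      by (auto simp: space_restrict_space)
    show "?g \<in> borel_measurable (restrict_space lborel ?B)"
      by (rule measurable_restrict_space1) simp
  qed
  have eq: "?g -` A \<inter> space (restrict_space lborel ?B)
              = {x. 0 < norm x \<and> norm x \<le> 1 \<and> ?g x \<in> A}"
    by (auto simp: space_restrict_space)
  have "emeasure surface_measure A =
          3 * emeasure (restrict_space lborel ?B) (?g -` A \<inter> space (restrict_space lborel ?B))"
    using assms meas by (simp add: surface_measure_def emeasure_distr)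
  also have "\<dots> = 3 * emeasure lborel {x. 0 < norm x \<and> norm x \<le> 1 \<and> ?g x \<in> A}"
    unfolding eq by (subst emeasure_restrict_space) auto
  finally show ?thesis .
qed

lemma measure_surface_measure_sphere: "measure surface_measure unit_sphere = 4 * pi"
proof -
  have "unit_sphere \<in> sets surface_measure"
    by (metis sets.top space_surface_measure)
  then have "emeasure surface_measure unit_sphere =
           3 * emeasure lborel {x::real^3. 0 < norm x \<and> norm x \<le> 1 \<and> x /\<^sub>R norm x \<in> unit_sphere}"
    by (rule emeasure_surface_measure)
  also have "{x::real^3. 0 < norm x \<and> norm x \<le> 1 \<and> x /\<^sub>R norm x \<in> unit_sphere} = cball 0 1 - {0}"
    by auto
  also have "emeasure lborel (cball 0 1 - {0::real^3}) = emeasure lborel (cball (0::real^3) 1)"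
    by (subst emeasure_Diff) auto
  also have "\<dots> = ennreal (4 / 3 * pi)"
    by (simp add: emeasure_cball unit_ball_vol_3)
  also have "3 * ennreal (4 / 3 * pi) = ennreal (4 * pi)"
    using ennreal_mult'[of 3 "4 / 3 * pi"] by simp
  finally show ?thesis by (simp add: measure_def)
qed

definition sphere_integral :: "(real^3 \<Rightarrow> real) \<Rightarrow> real" where
  "sphere_integral f = (LINT x|surface_measure. f x)"

definition L1_norm :: "(real^3 \<Rightarrow> real) \<Rightarrow> real" where
  "L1_norm f = sphere_integral (\<lambda>x. \<bar>f x\<bar>)"

definition L2_norm :: "(real^3 \<Rightarrow> real) \<Rightarrow> real" where
  "L2_norm f = sqrt (sphere_integral (\<lambda>x. (f x)\<^sup>2))"

definition sup_norm :: "(real^3 \<Rightarrow> real) \<Rightarrow> real" where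
  "sup_norm f = (SUP x\<in>unit_sphere. \<bar>f x\<bar>)"


definition laplacian :: "(real^3 \<Rightarrow> real) \<Rightarrow> real^3 \<Rightarrow> real" where
  "laplacian f x = (\<Sum>b\<in>Basis. (deriv ^^ 2) (\<lambda>t. f (x + t *\<^sub>R b)) 0)"

definition spherical_harmonics :: "nat \<Rightarrow> (real^3 \<Rightarrow> real) set" where
  "spherical_harmonics l =
     {f. \<exists>p. real_polynomial_function p \<and> (\<forall>c x. p (c *\<^sub>R x) = c ^ l * p x) \<and>
             (\<forall>x. laplacian p x = 0) \<and> (\<forall>x\<in>unit_sphere. f x = p x)}"

definition orthonormal_basis_of_harmonics :: "nat \<Rightarrow> (int \<Rightarrow> real^3 \<Rightarrow> real) \<Rightarrow> bool" where
  "orthonormal_basis_of_harmonics l y \<longleftrightarrow>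
     (\<forall>k\<in>{- int l..int l}. y k \<in> spherical_harmonics l) \<and>
     (\<forall>j\<in>{- int l..int l}. \<forall>k\<in>{- int l..int l}.
        sphere_integral (\<lambda>x. y j x * y k x) = (if j = k then 1 else 0)) \<and>
     (\<forall>f\<in>spherical_harmonics l. \<exists>c. \<forall>x\<in>unit_sphere. f x = (\<Sum>k=- int l..int l. c k * y k x))"

definition sphere_polys_upto :: "nat \<Rightarrow> (real^3 \<Rightarrow> real) set" where
  "sphere_polys_upto n =
     {f. \<exists>h. (\<forall>l\<le>n. h l \<in> spherical_harmonics l) \<and> (\<forall>x\<in>unit_sphere. f x = (\<Sum>l\<le>n. h l x))}"

definition sphere_polys :: "(real^3 \<Rightarrow> real) set" where
  "sphere_polys = (\<Union>n. sphere_polys_upto n)"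


record quadrature =
  num_nodes :: nat
  weight :: "nat \<Rightarrow> real"
  node :: "nat \<Rightarrow> real^3"

definition is_quadrature :: "quadrature \<Rightarrow> bool" where
  "is_quadrature q \<longleftrightarrow>
     num_nodes q \<ge> 1 \<and> node q ` {1..num_nodes q} \<subseteq> unit_sphere \<and> inj_on (node q) {1..num_nodes q}"

definition quad :: "quadrature \<Rightarrow> (real^3 \<Rightarrow> real) \<Rightarrow> real" where
  "quad q f = (\<Sum>j=1..num_nodes q. weight q j * f (node q j))"

text \<open>Operator norms and suprema over \<open>n\<close> are taken in \<open>ereal\<close>, so that an infinite supremum
  is not collapsed to a finite value.\<close>

definition quad_norm :: "quadrature \<Rightarrow> ereal" where
  "quad_norm q = (SUP f\<in>{f. continuous_on unit_sphere f \<and> sup_norm f \<le> 1}. ereal \<bar>quad q f\<bar>)"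

definition hyperinterp ::
  "(nat \<Rightarrow> int \<Rightarrow> real^3 \<Rightarrow> real) \<Rightarrow> nat \<Rightarrow> quadrature \<Rightarrow> (real^3 \<Rightarrow> real) \<Rightarrow> real^3 \<Rightarrow> real" where
  "hyperinterp Y n q f =
     (\<lambda>x. \<Sum>l\<le>n. \<Sum>k=- int l..int l. quad q (\<lambda>z. f z * Y l k z) * Y l k x)"

definition hyperinterp_norm ::
  "(nat \<Rightarrow> int \<Rightarrow> real^3 \<Rightarrow> real) \<Rightarrow> nat \<Rightarrow> quadrature \<Rightarrow> ereal" where
  "hyperinterp_norm Y n q =
     (SUP f\<in>{f. continuous_on unit_sphere f \<and> sup_norm f \<le> 1}. ereal (L2_norm (hyperinterp Y n q f)))"

text \<open>Sequences are indexed by the positive integers; the value at \<open>0\<close> is irrelevant.\<close>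

definition quadrature_seq :: "(nat \<Rightarrow> quadrature) \<Rightarrow> bool" where
  "quadrature_seq Q \<longleftrightarrow> (\<forall>n\<ge>1. is_quadrature (Q n))"

definition HC :: "(nat \<Rightarrow> int \<Rightarrow> real^3 \<Rightarrow> real) \<Rightarrow> (nat \<Rightarrow> quadrature) \<Rightarrow> bool" where
  "HC Y Q \<longleftrightarrow> (\<forall>f. continuous_on unit_sphere f \<longrightarrow>
     (\<lambda>n. L2_norm (\<lambda>x. hyperinterp Y n (Q n) f x - f x)) \<longlonglongrightarrow> 0)"

definition QC :: "(nat \<Rightarrow> quadrature) \<Rightarrow> bool" where
  "QC Q \<longleftrightarrow> (\<forall>f. continuous_on unit_sphere f \<longrightarrow>
     (\<lambda>n. \<bar>quad (Q n) f - sphere_integral f\<bar>) \<longlonglongrightarrow> 0)"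

definition FAP :: "(nat \<Rightarrow> int \<Rightarrow> real^3 \<Rightarrow> real) \<Rightarrow> (nat \<Rightarrow> quadrature) \<Rightarrow> bool" where
  "FAP Y Q \<longleftrightarrow> (\<forall>p\<in>sphere_polys.
     (\<lambda>n. L2_norm (\<lambda>x. hyperinterp Y n (Q n) p x - p x)) \<longlonglongrightarrow> 0)"

definition AP :: "(nat \<Rightarrow> quadrature) \<Rightarrow> bool" where
  "AP Q \<longleftrightarrow> (\<forall>p\<in>sphere_polys. (\<lambda>n. \<bar>quad (Q n) p - sphere_integral p\<bar>) \<longlonglongrightarrow> 0)"

definition MZ12 :: "(nat \<Rightarrow> quadrature) \<Rightarrow> bool" where
  "MZ12 Q \<longleftrightarrow> (\<exists>C>0. \<forall>n\<ge>1. \<forall>p\<in>sphere_polys_upto n.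
     (\<Sum>j=1..num_nodes (Q n). \<bar>weight (Q n) j\<bar> * \<bar>p (node (Q n) j)\<bar>) \<le> C * L2_norm p)"

definition PS :: "(nat \<Rightarrow> quadrature) \<Rightarrow> bool" where
  "PS Q \<longleftrightarrow> (\<exists>M::real. M > 0 \<and>
     (SUP n\<in>{1..}. ereal (\<Sum>j=1..num_nodes (Q n). \<bar>weight (Q n) j\<bar>)) \<le> ereal M)"

definition MZ1 :: "(nat \<Rightarrow> quadrature) \<Rightarrow> bool" where
  "MZ1 Q \<longleftrightarrow> (\<exists>c>0. \<forall>n\<ge>1. \<forall>p\<in>sphere_polys_upto n.
     (\<Sum>j=1..num_nodes (Q n). \<bar>weight (Q n) j\<bar> * \<bar>p (node (Q n) j)\<bar>) \<le> c * L1_norm p)"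

definition MZ2 :: "(nat \<Rightarrow> quadrature) \<Rightarrow> bool" where
  "MZ2 Q \<longleftrightarrow> (\<exists>c>0. \<forall>n\<ge>1. \<forall>p\<in>sphere_polys_upto n.
     (\<Sum>j=1..num_nodes (Q n). \<bar>weight (Q n) j\<bar> * \<bar>p (node (Q n) j)\<bar>\<^sup>2) \<le> c * (L2_norm p)\<^sup>2)"

definition LB :: "(nat \<Rightarrow> int \<Rightarrow> real^3 \<Rightarrow> real) \<Rightarrow> (nat \<Rightarrow> quadrature) \<Rightarrow> bool" where
  "LB Y Q \<longleftrightarrow> (\<exists>C::real. C > 0 \<and> (SUP n\<in>{1..}. hyperinterp_norm Y n (Q n)) \<le> ereal C)"

definition QB :: "(nat \<Rightarrow> quadrature) \<Rightarrow> bool" where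
  "QB Q \<longleftrightarrow> (\<exists>M::real. M > 0 \<and> (SUP n\<in>{1..}. quad_norm (Q n)) \<le> ereal M)"

end

(* Orthonormality turns the squared norm of L_n f into Q_n (f * L_n f), and a continuous f that
   interpolates the signs of the summands at the nodes shows that (MZ12) is exactly the
   boundedness of the operators L_n; likewise (PS) is the boundedness of the functionals Q_n. The
   equivalences then follow from the uniform boundedness principle on C(S^2) in one direction and
   from the density of the spherical polynomials in the other. (HC) gives (QC) because
   Q_n f - I f is the inner product of L_n f - f with 1.

   Spherical harmonics of different degrees l and m are orthogonal because the field
   p grad q - q grad p is divergence free with radial component (m - l) p q. Hence the (n + 1)^2
   given basis functions of degree at most n are independent, and since the polynomials
   of degree at most n, restricted to the sphere, are spanned by (n + 1)^2 monomials, they are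
   all spherical polynomials of degree at most n. In particular degrees add under products.

   For the counterexamples let K_n(x) be the sum of the squares of the basis functions of degree at
   most n at x; its integral is (n + 1)^2. A positive rule that is nearly exact, plus an atom of mass
   (n + 1)^(-1/2) at a point where K_n is at least its mean, satisfies (QC), but L_n 1 is unbounded
   in L^2. The single atom of mass K_n(x)^(-1/2) at x satisfies (MZ12), and it violates (MZ1) and
   (MZ2) when x is chosen so that K_m(x) / K_n(x)^(1/2) is large for m = n div 2; such x exist by
   averaging. *)
theory Submission
  imports Defs "HOL-Library.Function_Algebras"
begin

text \<open>The definitions present spherical polynomials only as sums of harmonics, yet constants,
  products and Stone-Weierstrass approximants have to be recognised as such sums. The hypothesis
  supplies \<open>2 * l + 1\<close> orthonormal harmonics in each degree, so a dimension count
  recognises them all at once. The count concerns restrictions to the sphere, where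
  \<open>x $ 3\<close> may be reduced. Every estimate for \<open>L_n\<close> rests on one identity:
  pairing \<open>L_n f\<close> with a polynomial \<open>p\<close> of degree at most \<open>n\<close>
  gives \<open>Q_n (f * p)\<close>. An atom of mass \<open>a\<close> contributes
  \<open>a^2 * K_n\<close> to the sum of squared coefficients of \<open>L_n 1\<close>. At the chosen
  points \<open>K_n\<close> is at least of order \<open>n^2\<close>, so a mass that tends to 0 more
  slowly than \<open>1 / n\<close> disturbs (FAP) and (MZ12) while vanishing in the limit for (QC);
  \<open>(n + 1)^(-1/2)\<close> is such a mass. In the second example the mass is the reciprocal of
  the norm of point evaluation on degree \<open>n\<close>, which yields (MZ12) with constant 1.
  (MZ1) is tested on the square of a kernel; the square must keep degree at most \<open>n\<close>,
  whence the half degree \<open>n div 2\<close>.\<close>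

section \<open>Integration over the sphere\<close>

lemma surface_measure_eq_density:
  "surface_measure =
     density (distr (restrict_space lborel (cball 0 1 - {0})) (restrict_space borel unit_sphere)
          (\<lambda>x. x /\<^sub>R norm x)) (\<lambda>_. 3)"
  unfolding surface_measure_def
  by (rule measure_eqI) (simp_all add: emeasure_density_const)

lemma finite_measure_surface_measure: "finite_measure surface_measure"
proof (rule finite_measureI)
  have "space surface_measure = unit_sphere" by (rule space_surface_measure)
  moreover have "emeasure surface_measure unit_sphere \<noteq> \<infinity>"
    using measure_surface_measure_sphere measure_eq_emeasure_eq_ennreal
    by (metis emeasure_eq_ennreal_measure ennreal_neq_top measure_def enn2real_top
        infinity_ennreal_def mult_eq_0_iff pi_neq_zero zero_neq_numeral)
  ultimately show "emeasure surface_measure (space surface_measure) \<noteq> \<infinity>" by simp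
qed

interpretation surface: finite_measure surface_measure
  by (rule finite_measure_surface_measure)

lemma borel_measurable_surface_measure:
  "continuous_on unit_sphere (f :: real^3 \<Rightarrow> real) \<Longrightarrow> f \<in> borel_measurable surface_measure"
  using borel_measurable_continuous_on_restrict[of unit_sphere f]
  by (simp cong: measurable_cong_sets add: sets_surface_measure)

lemma continuous_on_sphere_bounded:
  fixes f :: "real^3 \<Rightarrow> real"
  assumes "continuous_on unit_sphere f"
  obtains B where "B \<ge> 0" "\<And>x. x \<in> unit_sphere \<Longrightarrow> \<bar>f x\<bar> \<le> B"
proof -
  have "bounded (f ` unit_sphere)"
    using assms compact_continuous_image compact_imp_bounded compact_sphere by blast
  then obtain B where "\<forall>x\<in>unit_sphere. \<bar>f x\<bar> \<le> B"
    unfolding bounded_iff by auto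
  then show ?thesis by (intro that[of "max B 0"]) (auto simp: le_max_iff_disj)
qed

lemma integrable_surface_measure:
  assumes "continuous_on unit_sphere (f :: real^3 \<Rightarrow> real)"
  shows "integrable surface_measure f"
proof -
  obtain B where "\<And>x. x \<in> unit_sphere \<Longrightarrow> \<bar>f x\<bar> \<le> B"
    using continuous_on_sphere_bounded[OF assms] by blast
  then show ?thesis
    using borel_measurable_surface_measure[OF assms]
    by (intro surface.integrable_const_bound[of _ B]) (auto simp: space_surface_measure)
qed

lemma sphere_integral_cong:
  "(\<And>x. x \<in> unit_sphere \<Longrightarrow> f x = g x) \<Longrightarrow> sphere_integral f = sphere_integral g"
  unfolding sphere_integral_def
  by (rule Bochner_Integration.integral_cong) (auto simp: space_surface_measure)

lemma sphere_integral_mono: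
  assumes "continuous_on unit_sphere f" "continuous_on unit_sphere g"
    and "\<And>x. x \<in> unit_sphere \<Longrightarrow> f x \<le> g x"
  shows "sphere_integral f \<le> sphere_integral g"
  unfolding sphere_integral_def
  using assms by (intro integral_mono integrable_surface_measure) (auto simp: space_surface_measure)

lemma sphere_integral_nonneg:
  "(\<And>x. x \<in> unit_sphere \<Longrightarrow> 0 \<le> f x) \<Longrightarrow> 0 \<le> sphere_integral f"
  unfolding sphere_integral_def
  by (rule integral_nonneg_AE) (auto simp: space_surface_measure)

lemma sphere_integral_const [simp]: "sphere_integral (\<lambda>_. c) = 4 * pi * c"
  unfolding sphere_integral_def
  by (simp add: space_surface_measure measure_surface_measure_sphere)

lemma sphere_integral_add:
  "continuous_on unit_sphere f \<Longrightarrow> continuous_on unit_sphere g \<Longrightarrow>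
   sphere_integral (\<lambda>x. f x + g x) = sphere_integral f + sphere_integral g"
  unfolding sphere_integral_def by (simp add: integrable_surface_measure)

lemma sphere_integral_diff:
  "continuous_on unit_sphere f \<Longrightarrow> continuous_on unit_sphere g \<Longrightarrow>
   sphere_integral (\<lambda>x. f x - g x) = sphere_integral f - sphere_integral g"
  unfolding sphere_integral_def by (simp add: integrable_surface_measure)

lemma sphere_integral_cmult: "sphere_integral (\<lambda>x. c * f x) = c * sphere_integral f"
  unfolding sphere_integral_def by simp

lemma sphere_integral_sum:
  "(\<And>i. i \<in> I \<Longrightarrow> continuous_on unit_sphere (f i)) \<Longrightarrow>
   sphere_integral (\<lambda>x. \<Sum>i\<in>I. f i x) = (\<Sum>i\<in>I. sphere_integral (f i))"
  unfolding sphere_integral_def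
  by (rule Bochner_Integration.integral_sum) (simp add: integrable_surface_measure)

text \<open>The integral of the square of \<open>s f - t g\<close> is a nonnegative quadratic form
  in \<open>s\<close> and \<open>t\<close>. The choice \<open>s = c\<close>, \<open>t = b\<close>
  turns it into \<open>c * (a * c - b^2)\<close>. If \<open>c = 0\<close>, the form is affine in
  \<open>t\<close>, which forces \<open>b = 0\<close>.\<close>

lemma sphere_integral_Cauchy_Schwarz:
  assumes f: "continuous_on unit_sphere f" and g: "continuous_on unit_sphere g"
  shows "(sphere_integral (\<lambda>x. f x * g x))\<^sup>2
           \<le> sphere_integral (\<lambda>x. (f x)\<^sup>2) * sphere_integral (\<lambda>x. (g x)\<^sup>2)"
proof -
  define a b c where "a = sphere_integral (\<lambda>x. (f x)\<^sup>2)" and "b = sphere_integral (\<lambda>x. f x * g x)"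
    and "c = sphere_integral (\<lambda>x. (g x)\<^sup>2)"
  have quad: "0 \<le> s\<^sup>2 * a - 2 * s * t * b + t\<^sup>2 * c" for s t
  proof -
    have "0 \<le> sphere_integral (\<lambda>x. (s * f x - t * g x)\<^sup>2)"
      by (rule sphere_integral_nonneg) simp
    also have "(\<lambda>x. (s * f x - t * g x)\<^sup>2)
        = (\<lambda>x. (s\<^sup>2 * (f x)\<^sup>2 - 2 * s * t * (f x * g x)) + t\<^sup>2 * (g x)\<^sup>2)"
      by (auto simp: fun_eq_iff power2_eq_square algebra_simps)
    also have "sphere_integral \<dots> = s\<^sup>2 * a - 2 * s * t * b + t\<^sup>2 * c"
      unfolding a_def b_def c_def using f g
      by (subst sphere_integral_add sphere_integral_diff;
          (intro continuous_intros)?; simp add: sphere_integral_cmult sphere_integral_diff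
            continuous_intros)
    finally show ?thesis .
  qed
  have nn: "a \<ge> 0" "c \<ge> 0"
    unfolding a_def c_def by (auto intro: sphere_integral_nonneg)
  have "b\<^sup>2 \<le> a * c"
  proof (cases "c = 0")
    case True
    have "b = 0"
    proof (rule ccontr)
      assume "b \<noteq> 0"
      then show False
        using quad[of 1 "(a + 1) / (2 * b)"] True by simp
    qed
    then show ?thesis using nn by simp
  next
    case False
    then have "c > 0" using nn by simp
    have "0 \<le> c * (a * c - b\<^sup>2)"
      using quad[of c b] by (simp add: power2_eq_square algebra_simps)
    then show ?thesis using \<open>c > 0\<close> by (simp add: zero_le_mult_iff)
  qed
  then show ?thesis by (simp add: a_def b_def c_def)
qed

lemma L2_norm_nonneg [simp]: "0 \<le> L2_norm f"
  unfolding L2_norm_def by (auto intro: sphere_integral_nonneg)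

lemma L2_norm_power2: "(L2_norm f)\<^sup>2 = sphere_integral (\<lambda>x. (f x)\<^sup>2)"
  unfolding L2_norm_def by (auto intro: sphere_integral_nonneg)

lemma L2_norm_cong: "(\<And>x. x \<in> unit_sphere \<Longrightarrow> f x = g x) \<Longrightarrow> L2_norm f = L2_norm g"
  unfolding L2_norm_def by (intro arg_cong[where f = sqrt] sphere_integral_cong) simp

lemma sphere_integral_abs_le_L2_norm:
  assumes "continuous_on unit_sphere f" "continuous_on unit_sphere g"
  shows "\<bar>sphere_integral (\<lambda>x. f x * g x)\<bar> \<le> L2_norm f * L2_norm g"
proof (rule power2_le_imp_le)
  show "\<bar>sphere_integral (\<lambda>x. f x * g x)\<bar>\<^sup>2 \<le> (L2_norm f * L2_norm g)\<^sup>2"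
    using sphere_integral_Cauchy_Schwarz[OF assms] by (simp add: power_mult_distrib L2_norm_power2)
qed simp

lemma L2_norm_triangle:
  assumes "continuous_on unit_sphere f" "continuous_on unit_sphere g"
  shows "L2_norm (\<lambda>x. f x + g x) \<le> L2_norm f + L2_norm g"
proof (rule power2_le_imp_le)
  have "(L2_norm (\<lambda>x. f x + g x))\<^sup>2
      = sphere_integral (\<lambda>x. ((f x)\<^sup>2 + 2 * (f x * g x)) + (g x)\<^sup>2)"
    unfolding L2_norm_power2 by (rule sphere_integral_cong) (simp add: power2_eq_square algebra_simps)
  also have "\<dots> = (L2_norm f)\<^sup>2 + 2 * sphere_integral (\<lambda>x. f x * g x) + (L2_norm g)\<^sup>2"
    unfolding L2_norm_power2 using assms
    by (subst sphere_integral_add;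
          (intro continuous_intros)?; simp add: sphere_integral_cmult sphere_integral_add
            continuous_intros)
  also have "\<dots> \<le> (L2_norm f + L2_norm g)\<^sup>2"
    using sphere_integral_abs_le_L2_norm[OF assms] by (simp add: power2_sum)
  finally show "(L2_norm (\<lambda>x. f x + g x))\<^sup>2 \<le> (L2_norm f + L2_norm g)\<^sup>2" .
qed simp

lemma L2_norm_cmult: "L2_norm (\<lambda>x. c * f x) = \<bar>c\<bar> * L2_norm f"
  unfolding L2_norm_def by (simp add: power_mult_distrib sphere_integral_cmult real_sqrt_mult)

lemma L2_norm_one: "L2_norm (\<lambda>_. 1) = sqrt (4 * pi)"
  by (simp add: L2_norm_def)

lemma L2_norm_le_bound:
  assumes "continuous_on unit_sphere f" and "\<And>x. x \<in> unit_sphere \<Longrightarrow> \<bar>f x\<bar> \<le> B"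
  shows "L2_norm f \<le> sqrt (4 * pi) * B"
proof -
  have "B \<ge> 0"
    using assms(2)[of "axis 1 1"] by (simp add: norm_axis_1)
  have "sphere_integral (\<lambda>x. (f x)\<^sup>2) \<le> sphere_integral (\<lambda>x. B\<^sup>2)"
    using assms by (intro sphere_integral_mono continuous_intros)
      (auto simp: abs_le_square_iff[symmetric] intro: order_trans[OF _ abs_ge_self])
  then show ?thesis
    unfolding L2_norm_def using \<open>B \<ge> 0\<close>
    by (metis real_sqrt_le_iff real_sqrt_mult real_sqrt_unique sphere_integral_const)
qed

text \<open>A maximum point qualifies, since the total mass is \<open>4 * pi\<close>. This averaging
  step selects the points of both counterexamples.\<close>

lemma exists_average_le:
  assumes "continuous_on unit_sphere f"
  obtains x where "x \<in> unit_sphere" "sphere_integral f \<le> 4 * pi * f x"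
proof (rule ccontr)
  assume "\<not> thesis"
  then have less: "\<And>x. x \<in> unit_sphere \<Longrightarrow> 4 * pi * f x < sphere_integral f"
    using that by force
  obtain z where z: "z \<in> unit_sphere" "\<And>x. x \<in> unit_sphere \<Longrightarrow> f x \<le> f z"
    using continuous_attains_sup[OF compact_sphere _ assms]
    by (metis dist_0_norm empty_iff norm_axis_1 mem_sphere)
  have "sphere_integral f \<le> sphere_integral (\<lambda>_. f z)"
    using assms z by (intro sphere_integral_mono continuous_intros) auto
  then show False using less[OF z(1)] by simp
qed

text \<open>The orthogonality argument integrates a divergence over the whole space; this is the
  passage between that volume integral and the surface integral.\<close>

lemma sphere_integral_eq_lborel:
  assumes "continuous_on unit_sphere f"
  shows "sphere_integral f
    = 3 * (LINT x|lborel. indicator (cball 0 1 - {0}) x * f (x /\<^sub>R norm x))"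
proof -
  let ?B = "cball 0 1 - {0} :: (real^3) set"
  let ?g = "\<lambda>x::real^3. x /\<^sub>R norm x"
  have meas: "?g \<in> measurable (restrict_space lborel ?B) (restrict_space borel unit_sphere)"
  proof (rule measurable_restrict_space2)
    show "?g \<in> space (restrict_space lborel ?B) \<rightarrow> unit_sphere"
      by (auto simp: space_restrict_space)
    show "?g \<in> borel_measurable (restrict_space lborel ?B)"
      by (rule measurable_restrict_space1) simp
  qed
  have f: "f \<in> borel_measurable (restrict_space borel unit_sphere)"
    by (rule borel_measurable_continuous_on_restrict[OF assms])
  have "sphere_integral f
    = (LINT x|distr (restrict_space lborel ?B) (restrict_space borel unit_sphere) ?g. 3 * f x)"
    unfolding sphere_integral_def surface_measure_eq_density
    using integral_density[of f "distr (restrict_space lborel ?B) (restrict_space borel unit_sphere) ?g" "\<lambda>_. 3"] f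
    by simp
  also have "\<dots> = 3 * (LINT x|restrict_space lborel ?B. f (?g x))"
    using integral_distr[OF meas, of f] f by simp
  also have "(LINT x|restrict_space lborel ?B. f (?g x))
      = (LINT x|lborel. indicator ?B x * f (?g x))"
    by (subst integral_restrict_space) (auto simp: mult.commute)
  finally show ?thesis .
qed

section \<open>Orthogonality of spherical harmonics of different degrees\<close>

text \<open>Keeping the partial derivatives within the polynomial functions allows a second
  application, which produces the Hessian.\<close>

lemma real_polynomial_function_gradient:
  fixes p :: "real^'n \<Rightarrow> real"
  assumes "real_polynomial_function p"
  shows "\<exists>D. (\<forall>i. real_polynomial_function (D i)) \<and>
             (\<forall>x. (p has_derivative (\<lambda>h. \<Sum>i\<in>UNIV. h $ i * D i x)) (at x))"
  using assms
proof induction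
  case (linear f)
  have "f h = (\<Sum>i\<in>UNIV. h $ i * f (axis i 1))" for h
  proof -
    interpret f: bounded_linear f by fact
    have "f h = f (\<Sum>i\<in>UNIV. h $ i *\<^sub>R axis i 1)"
      using basis_expansion[of h] by (simp add: scalar_mult_eq_scaleR)
    then show ?thesis by (simp add: f.sum f.scaleR)
  qed
  then have eq: "(\<lambda>h. \<Sum>i\<in>UNIV. h $ i * f (axis i 1)) = f" by (rule ext[OF sym])
  show ?case
  proof (intro exI[of _ "\<lambda>i _. f (axis i 1)"] conjI allI)
    show "real_polynomial_function (\<lambda>_. f (axis i 1))" for i
      by (rule real_polynomial_function.intros(2))
    show "(f has_derivative (\<lambda>h. \<Sum>i\<in>UNIV. h $ i * f (axis i 1))) (at x)" for x
      unfolding eq using linear by (rule bounded_linear_imp_has_derivative)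
  qed
next
  case (const c)
  show ?case
  proof (intro exI[of _ "\<lambda>_ _. 0"] conjI allI)
    show "real_polynomial_function (\<lambda>_. 0)"
      by (rule real_polynomial_function.intros(2))
  qed auto
next
  case (add f g)
  then obtain D E where D: "\<And>i. real_polynomial_function (D i)"
      "\<And>x. (f has_derivative (\<lambda>h. \<Sum>i\<in>UNIV. h $ i * D i x)) (at x)"
    and E: "\<And>i. real_polynomial_function (E i)"
      "\<And>x. (g has_derivative (\<lambda>h. \<Sum>i\<in>UNIV. h $ i * E i x)) (at x)" by blast
  show ?case
  proof (intro exI[of _ "\<lambda>i x. D i x + E i x"] conjI allI)
    show "real_polynomial_function (\<lambda>x. D i x + E i x)" for i
      using D(1) E(1) by (rule real_polynomial_function.intros(3))
    show "((\<lambda>x. f x + g x) has_derivative (\<lambda>h. \<Sum>i\<in>UNIV. h $ i * (D i x + E i x))) (at x)" for x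
      using has_derivative_add[OF D(2) E(2)] by (simp add: ring_distribs sum.distrib)
  qed
next
  case (mult f g)
  then obtain D E where D: "\<And>i. real_polynomial_function (D i)"
      "\<And>x. (f has_derivative (\<lambda>h. \<Sum>i\<in>UNIV. h $ i * D i x)) (at x)"
    and E: "\<And>i. real_polynomial_function (E i)"
      "\<And>x. (g has_derivative (\<lambda>h. \<Sum>i\<in>UNIV. h $ i * E i x)) (at x)" by blast
  show ?case
  proof (intro exI[of _ "\<lambda>i x. f x * E i x + D i x * g x"] conjI allI)
    show "real_polynomial_function (\<lambda>x. f x * E i x + D i x * g x)" for i
      using D(1)[of i] E(1)[of i] mult.hyps by (intro real_polynomial_function.intros(3,4))
    show "((\<lambda>x. f x * g x) has_derivative
         (\<lambda>h. \<Sum>i\<in>UNIV. h $ i * (f x * E i x + D i x * g x))) (at x)" for x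
      by (rule has_derivative_eq_rhs[OF has_derivative_mult[OF D(2) E(2)]])
        (auto simp: fun_eq_iff sum_distrib_left sum_distrib_right sum.distrib algebra_simps)
  qed
qed

lemma real_polynomial_function_hessian:
  fixes p :: "real^'n \<Rightarrow> real"
  assumes "real_polynomial_function p"
  shows "\<exists>D H. (\<forall>i. real_polynomial_function (D i)) \<and> (\<forall>i j. real_polynomial_function (H i j)) \<and>
             (\<forall>x. (p has_derivative (\<lambda>h. \<Sum>i\<in>UNIV. h $ i * D i x)) (at x)) \<and>
             (\<forall>i x. (D i has_derivative (\<lambda>h. \<Sum>j\<in>UNIV. h $ j * H i j x)) (at x))"
proof -
  obtain D where D: "\<And>i. real_polynomial_function (D i)"
      "\<And>x. (p has_derivative (\<lambda>h. \<Sum>i\<in>UNIV. h $ i * D i x)) (at x)"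
    using real_polynomial_function_gradient[OF assms] by blast
  have "\<forall>i. \<exists>H. (\<forall>j. real_polynomial_function (H j)) \<and>
             (\<forall>x. (D i has_derivative (\<lambda>h. \<Sum>j\<in>UNIV. h $ j * H j x)) (at x))"
    using real_polynomial_function_gradient[OF D(1)] by blast
  from choice[OF this] obtain H where H: "\<And>i j. real_polynomial_function (H i j)"
      "\<And>i x. (D i has_derivative (\<lambda>h. \<Sum>j\<in>UNIV. h $ j * H i j x)) (at x)" by blast
  show ?thesis using D H by (intro exI[of _ D] exI[of _ H] conjI allI)
qed

lemma has_derivative_along_axis:
  fixes p :: "real^'n \<Rightarrow> real"
  assumes "\<And>x. (p has_derivative (\<lambda>h. \<Sum>i\<in>UNIV. h $ i * D i x)) (at x)"
  shows "((\<lambda>t. p (x + t *\<^sub>R axis i 1)) has_real_derivative D i (x + t *\<^sub>R axis i 1)) (at t)"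
proof -
  have "((\<lambda>t. x + t *\<^sub>R axis i 1) has_derivative (\<lambda>s. s *\<^sub>R axis i 1)) (at t)"
    by (auto intro!: derivative_eq_intros)
  then have "((\<lambda>t. p (x + t *\<^sub>R axis i 1)) has_derivative
      (\<lambda>s. \<Sum>j\<in>UNIV. (s *\<^sub>R axis i 1) $ j * D j (x + t *\<^sub>R axis i 1))) (at t)"
    using assms by (rule has_derivative_compose)
  moreover have "(\<Sum>j\<in>UNIV. (s *\<^sub>R axis i 1) $ j * D j y) = D i y * s" for s y
  proof -
    have "(\<Sum>j\<in>UNIV. (s *\<^sub>R axis i 1) $ j * D j y) = (\<Sum>j\<in>UNIV. if j = i then s * D j y else 0)"
      by (rule sum.cong) (auto simp: axis_def)
    then show ?thesis by (simp add: mult.commute)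
  qed
  ultimately show ?thesis by (simp add: has_field_derivative_def)
qed

lemma sum_Basis_vec:
  fixes f :: "real^'n \<Rightarrow> 'b::comm_monoid_add"
  shows "sum f Basis = (\<Sum>i\<in>UNIV. f (axis i 1))"
proof -
  have "Basis = range (\<lambda>i. axis i (1::real) :: real^'n)"
    by (auto simp: Basis_vec_def)
  moreover have "inj (\<lambda>i. axis i (1::real) :: real^'n)"
    by (auto simp: inj_def axis_eq_axis)
  ultimately show ?thesis using sum.reindex[of "\<lambda>i. axis i (1::real) :: real^'n" UNIV f] by (simp add: o_def)
qed

text \<open>\<open>laplacian\<close> iterates one-variable derivatives along the axes; the
  divergence computation works with the trace of the Hessian instead.\<close>

lemma laplacian_eq_sum:
  assumes D: "\<And>x. (p has_derivative (\<lambda>h. \<Sum>i\<in>UNIV. h $ i * D i x)) (at x)"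
    and E: "\<And>i x. (D i has_derivative (\<lambda>h. \<Sum>j\<in>UNIV. h $ j * E i j x)) (at x)"
  shows "laplacian p x = (\<Sum>i\<in>UNIV. E i i x)"
proof -
  have "deriv (deriv (\<lambda>t. p (x + t *\<^sub>R axis i 1))) 0 = E i i x" for i
  proof -
    have "deriv (\<lambda>t. p (x + t *\<^sub>R axis i 1)) = (\<lambda>t. D i (x + t *\<^sub>R axis i 1))"
      using has_derivative_along_axis[of p D, OF D] by (auto intro!: DERIV_imp_deriv)
    then show ?thesis
      using has_derivative_along_axis[of "D i" "E i" x i 0, OF E] by (auto intro!: DERIV_imp_deriv)
  qed
  then show ?thesis by (simp add: laplacian_def sum_Basis_vec numeral_2_eq_2)
qed

text \<open>Both sides are the derivative of \<open>p (t x)\<close> in \<open>t\<close> at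
  \<open>t = 1\<close>: one by the chain rule, the other by homogeneity.\<close>

lemma Euler_homogeneous:
  fixes p :: "real^'n \<Rightarrow> real"
  assumes D: "\<And>x. (p has_derivative (\<lambda>h. \<Sum>i\<in>UNIV. h $ i * D i x)) (at x)"
    and hom: "\<And>c x. p (c *\<^sub>R x) = c ^ l * p x"
  shows "(\<Sum>i\<in>UNIV. x $ i * D i x) = real l * p x"
proof -
  have "((\<lambda>t. t *\<^sub>R x) has_derivative (\<lambda>s. s *\<^sub>R x)) (at 1)"
    by (auto intro!: derivative_eq_intros)
  from has_derivative_compose[OF this D]
  have "((\<lambda>t. p (t *\<^sub>R x)) has_derivative (\<lambda>s. \<Sum>i\<in>UNIV. (s *\<^sub>R x) $ i * D i x)) (at 1)" by simp
  moreover have "(\<lambda>s. \<Sum>i\<in>UNIV. (s *\<^sub>R x) $ i * D i x) = (*) (\<Sum>i\<in>UNIV. x $ i * D i x)"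
    by (auto simp: fun_eq_iff sum_distrib_left sum_distrib_right mult_ac)
  ultimately have 1: "((\<lambda>t. p (t *\<^sub>R x)) has_real_derivative (\<Sum>i\<in>UNIV. x $ i * D i x)) (at 1)"
    by (simp add: has_field_derivative_def)
  have "((\<lambda>t. t ^ l * p x) has_real_derivative real l * p x) (at 1)"
    by (auto intro!: derivative_eq_intros)
  then have "((\<lambda>t. p (t *\<^sub>R x)) has_real_derivative real l * p x) (at 1)"
    using hom by simp
  then show ?thesis using 1 DERIV_unique by blast
qed

section \<open>Divergences integrate to zero, and orthogonality across degrees\<close>

lemma integrable_lborel_compact_support:
  fixes G :: "'a::euclidean_space \<Rightarrow> real"
  assumes "continuous_on UNIV G" and "\<And>x. norm x \<ge> R \<Longrightarrow> G x = 0"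
  shows "integrable lborel G"
proof -
  have "integrable lborel (\<lambda>x. indicator (cball 0 R) x *\<^sub>R G x)"
    using assms by (intro borel_integrable_compact) (auto intro: continuous_on_subset)
  moreover have "(\<lambda>x. indicator (cball 0 R) x *\<^sub>R G x) = G"
    using assms(2) by (auto simp: fun_eq_iff indicator_def)
  ultimately show ?thesis by simp
qed

text \<open>The integral of \<open>G\<close> is invariant under translation along \<open>e\<close>; differentiate this under
  the integral sign.\<close>

lemma integral_directional_derivative_eq_0:
  fixes G G' :: "'a::euclidean_space \<Rightarrow> real"
  assumes G: "continuous_on UNIV G" and G': "continuous_on UNIV G'"
    and deriv: "\<And>x t. ((\<lambda>t. G (x + t *\<^sub>R e)) has_real_derivative G' (x + t *\<^sub>R e)) (at t)"
    and supp: "\<And>x. norm x \<ge> R \<Longrightarrow> G x = 0" and e: "norm e = 1"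
  shows "(LINT x|lborel. G' x) = 0"
proof -
  \<comment> \<open>Difference quotients along \<open>e\<close> with step
    \<open>1 / (n + 1)\<close>. Translation invariance makes their integrals vanish, and they
    converge to \<open>G'\<close> pointwise.\<close>
  define s where "s n x = (G (x + (1 / real (Suc n)) *\<^sub>R e) - G x) * real (Suc n)" for n x
  have int_G: "integrable lborel G"
    by (rule integrable_lborel_compact_support[OF G supp])
  have shift: "integrable lborel (\<lambda>x. G (x + c))" "(LINT x|lborel. G (x + c)) = (LINT x|lborel. G x)"
    for c
  proof -
    have "integrable (distr lborel borel ((+) c)) G"
      using int_G lborel_distr_plus[of c] by simp
    then show "integrable lborel (\<lambda>x. G (x + c))"
      by (subst (asm) integrable_distr_eq) (use int_G in \<open>auto simp: add.commute\<close>)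
    have "(LINT x|distr lborel borel ((+) c). G x) = (LINT x|lborel. G (c + x))"
      by (rule integral_distr) (use int_G in auto)
    then show "(LINT x|lborel. G (x + c)) = (LINT x|lborel. G x)"
      using lborel_distr_plus[of c] by (simp add: add.commute)
  qed
  have s0: "(LINT x|lborel. s n x) = 0" for n
    unfolding s_def using shift int_G by simp
  have "bounded (G' ` cball 0 (R + 2))"
    using G' by (intro compact_imp_bounded compact_continuous_image) (auto intro: continuous_on_subset)
  then obtain M where "\<forall>x\<in>cball 0 (R + 2). \<bar>G' x\<bar> \<le> M"
    unfolding bounded_iff by auto
  then have M: "\<bar>G' x\<bar> \<le> M" if "norm x \<le> R + 2" for x using that by auto
  \<comment> \<open>Since the step is at most 1, the quotient vanishes beyond radius
    \<open>R + 1\<close>. Inside, it is a value of \<open>G'\<close> at a point moved by at most 1,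
    which explains the bound \<open>M\<close> on radius \<open>R + 2\<close>.\<close>
  have bound: "\<bar>s n x\<bar> \<le> indicator (cball 0 (R + 1)) x * M" for n x
  proof -
    define h where "h = 1 / real (Suc n)"
    have h: "0 < h" "h \<le> 1" by (auto simp: h_def)
    show ?thesis
    proof (cases "norm x \<le> R + 1")
      case True
      obtain z where z: "0 < z" "z < h"
          "G (x + h *\<^sub>R e) - G (x + 0 *\<^sub>R e) = (h - 0) * G' (x + z *\<^sub>R e)"
        using MVT2[OF h(1), of "\<lambda>t. G (x + t *\<^sub>R e)" "\<lambda>t. G' (x + t *\<^sub>R e)"] deriv by blast
      have "s n x = G' (x + z *\<^sub>R e)"
        using z(3) by (simp add: s_def h_def divide_simps)
      moreover have "norm (x + z *\<^sub>R e) \<le> R + 2"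
        using norm_triangle_ineq[of x "z *\<^sub>R e"] True z h e by simp
      ultimately show ?thesis using M True by simp
    next
      case False
      have "norm (x + h *\<^sub>R e) \<ge> R"
        using norm_triangle_ineq4[of "x + h *\<^sub>R e" "h *\<^sub>R e"] False h e by simp
      then have "s n x = 0" using False supp by (simp add: s_def h_def)
      then show ?thesis using False by simp
    qed
  qed
  have lim: "(\<lambda>n. s n x) \<longlonglongrightarrow> G' x" for x
  proof -
    have "((\<lambda>h. (G (x + h *\<^sub>R e) - G x) / h) \<longlongrightarrow> G' x) (at 0)"
      using deriv[of x 0] by (simp add: DERIV_def)
    moreover have "filterlim (\<lambda>n. 1 / real (Suc n)) (at 0) sequentially"
      using LIMSEQ_inverse_real_of_nat
      by (auto simp: filterlim_at inverse_eq_divide simp del: of_nat_Suc)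
    ultimately have "(\<lambda>n. (G (x + (1 / real (Suc n)) *\<^sub>R e) - G x) / (1 / real (Suc n))) \<longlonglongrightarrow> G' x"
      by (rule filterlim_compose)
    then show ?thesis by (simp add: s_def)
  qed
  have "(\<lambda>n. LINT x|lborel. s n x) \<longlonglongrightarrow> (LINT x|lborel. G' x)"
  proof (rule integral_dominated_convergence)
    show "G' \<in> borel_measurable lborel"
      using G' by (simp add: borel_measurable_continuous_onI)
    show "s n \<in> borel_measurable lborel" for n
      unfolding s_def using shift(1) int_G by (intro borel_measurable_times borel_measurable_diff) auto
    show "integrable lborel (\<lambda>x. indicator (cball 0 (R + 1)) x * M :: real)"
      using borel_integrable_compact[of "cball 0 (R + 1)" "\<lambda>_. M"] by simp
    show "AE x in lborel. (\<lambda>n. s n x) \<longlonglongrightarrow> G' x" using lim by simp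
    show "AE x in lborel. norm (s n x) \<le> indicator (cball 0 (R + 1)) x * M" for n
      using bound by simp
  qed
  then show ?thesis unfolding s0 using LIMSEQ_unique tendsto_const by blast
qed

text \<open>The vector field \<open>p \<nabla>q - q \<nabla>p\<close> is divergence free and its radial component is
  \<open>(m - l) p q\<close>, so integrating the divergence of its product with the radial cutoff
  \<open>W (norm x ^ 2)\<close>, where \<open>W' = - g\<close>, over the whole space gives the claim.\<close>

lemma harmonic_product_radial_integral_eq_0:
  fixes p q :: "real^3 \<Rightarrow> real" and g :: "real \<Rightarrow> real"
  assumes p: "real_polynomial_function p" and q: "real_polynomial_function q"
    and homp: "\<And>c x. p (c *\<^sub>R x) = c ^ l * p x" and homq: "\<And>c x. q (c *\<^sub>R x) = c ^ m * q x"
    and lapp: "\<And>x. laplacian p x = 0" and lapq: "\<And>x. laplacian q x = 0"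
    and "l \<noteq> m"
    and g: "continuous_on UNIV g" and g0: "\<And>u. u \<ge> 2 \<Longrightarrow> g u = 0"
  shows "(LINT x|lborel. p x * q x * g (x \<bullet> x)) = 0"
proof -
  obtain D DD where D: "\<And>i. real_polynomial_function (D i)"
      "\<And>x. (p has_derivative (\<lambda>h. \<Sum>i\<in>UNIV. h $ i * D i x)) (at x)"
    and DD: "\<And>i j. real_polynomial_function (DD i j)"
      "\<And>i x. (D i has_derivative (\<lambda>h. \<Sum>j\<in>UNIV. h $ j * DD i j x)) (at x)"
    using real_polynomial_function_hessian[OF p] by blast
  obtain E EE where E: "\<And>i. real_polynomial_function (E i)"
      "\<And>x. (q has_derivative (\<lambda>h. \<Sum>i\<in>UNIV. h $ i * E i x)) (at x)"
    and EE: "\<And>i j. real_polynomial_function (EE i j)"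
      "\<And>i x. (E i has_derivative (\<lambda>h. \<Sum>j\<in>UNIV. h $ j * EE i j x)) (at x)"
    using real_polynomial_function_hessian[OF q] by blast
  have cont: "continuous_on UNIV p" "continuous_on UNIV q" "\<And>i. continuous_on UNIV (D i)"
    "\<And>i. continuous_on UNIV (E i)" "\<And>i j. continuous_on UNIV (DD i j)"
    "\<And>i j. continuous_on UNIV (EE i j)"
    using p q D(1) E(1) DD(1) EE(1)
    by (auto simp: real_polynomial_function_eq intro: continuous_on_polymonial_function)
  \<comment> \<open>\<open>W u\<close> is the integral of \<open>g\<close> from \<open>u\<close> to
    2. The base point -1 keeps \<open>u = 0\<close> in the interior of the interval, so that the
    derivative at 0 is two-sided.\<close>
  define W where "W u = integral {-1..2} g - integral {-1..u} g" for u :: real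
  have W_deriv: "(W has_real_derivative - g u) (at u)" if "u \<ge> 0" for u
  proof -
    have "((\<lambda>u. integral {-1..u} g) has_real_derivative g u) (at u within {-1..u+1})"
      by (rule integral_has_real_derivative) (use that g in \<open>auto intro: continuous_on_subset\<close>)
    then have "((\<lambda>u. integral {-1..u} g) has_real_derivative g u) (at u)"
      using that at_within_interior[of u "{-1..u+1}"] by simp
    then show ?thesis unfolding W_def by (auto intro!: derivative_eq_intros)
  qed
  have W0: "W u = 0" if "u \<ge> 2" for u
  proof -
    have "integral {-1..2} g + integral {2..u} g = integral {-1..u} g"
      by (rule Henstock_Kurzweil_Integration.integral_combine)
        (use that g in \<open>auto intro!: integrable_continuous_real continuous_on_subset[OF g]\<close>)
    moreover have "integral {2..u} g = 0"
      using g0 Henstock_Kurzweil_Integration.integral_cong[of "{2..u}" g "\<lambda>_. 0"] by auto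
    ultimately show ?thesis by (simp add: W_def)
  qed
  have contW: "continuous_on UNIV (\<lambda>x::real^3. W (x \<bullet> x))"
  proof -
    have "continuous_on {0..} W"
      using W_deriv by (intro continuous_at_imp_continuous_on ballI) (auto intro: DERIV_isCont)
    then show ?thesis
      by (rule continuous_on_compose2) (auto intro!: continuous_intros)
  qed
  have contg: "continuous_on UNIV (\<lambda>x::real^3. g (x \<bullet> x))"
    by (rule continuous_on_compose2[OF g]) (auto intro!: continuous_intros)
  \<comment> \<open>\<open>G i\<close> is a component of the cut-off field and \<open>G' i\<close>
    its derivative along the same axis; the products \<open>D i x * E i x\<close> have cancelled in
    it.\<close>
  define G where "G i x = (p x * E i x - q x * D i x) * W (x \<bullet> x)" for i x
  define G' where "G' i x = (p x * EE i i x - q x * DD i i x) * W (x \<bullet> x)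
      - 2 * (x $ i) * g (x \<bullet> x) * (p x * E i x - q x * D i x)" for i x
  have large: "x \<bullet> x \<ge> 2" if "norm x \<ge> 2" for x :: "real^3"
  proof -
    have "(2::real)\<^sup>2 \<le> (norm x)\<^sup>2" using that by (intro power_mono) auto
    then show ?thesis by (simp add: power2_norm_eq_inner)
  qed
  have contG': "continuous_on UNIV (G' i)" for i
    unfolding G'_def by (intro continuous_intros cont contW contg)
  have "(LINT x|lborel. G' i x) = 0" for i
  proof (rule integral_directional_derivative_eq_0[of "G i" _ "axis i 1" 2])
    show "continuous_on UNIV (G i)"
      unfolding G_def by (intro continuous_intros cont contW)
    show "continuous_on UNIV (G' i)" by (rule contG')
    show "G i x = 0" if "norm x \<ge> 2" for x
      using W0 large[OF that] by (simp add: G_def)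
    show "norm (axis i 1 :: real^3) = 1" by (simp add: norm_axis_1)
    fix x :: "real^3" and t
    define y where "y s = x + s *\<^sub>R axis i 1" for s
    have "((\<lambda>s. y s \<bullet> y s) has_real_derivative 2 * (y t $ i)) (at t)"
    proof -
      have "(\<lambda>s. y s \<bullet> y s) = (\<lambda>s. x \<bullet> x + 2 * s * (x $ i) + s\<^sup>2)"
        by (auto simp: y_def fun_eq_iff inner_add_left inner_add_right inner_axis inner_axis'
            power2_eq_square algebra_simps)
      moreover have "((\<lambda>s. x \<bullet> x + 2 * s * (x $ i) + s\<^sup>2) has_real_derivative 2 * (y t $ i)) (at t)"
        by (auto intro!: derivative_eq_intros simp: y_def algebra_simps)
      ultimately show ?thesis by simp
    qed
    from DERIV_chain2[OF W_deriv this]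
    have W': "((\<lambda>s. W (y s \<bullet> y s)) has_real_derivative - g (y t \<bullet> y t) * (2 * (y t $ i))) (at t)"
      by simp
    show "((\<lambda>t. G i (x + t *\<^sub>R axis i 1)) has_real_derivative G' i (x + t *\<^sub>R axis i 1)) (at t)"
      unfolding G_def G'_def y_def[symmetric]
      using has_derivative_along_axis[OF D(2), where x = x and i = i and t = t]
        has_derivative_along_axis[OF E(2), where x = x and i = i and t = t]
        has_derivative_along_axis[OF DD(2), where x = x and i = i and t = t]
        has_derivative_along_axis[OF EE(2), where x = x and i = i and t = t] W'
      unfolding y_def[symmetric]
      by (auto intro!: derivative_eq_intros simp: algebra_simps)
  qed
  moreover have intG': "integrable lborel (G' i)" for i
    by (rule integrable_lborel_compact_support[of _ 2, OF contG'])
      (use W0 g0 large in \<open>simp add: G'_def\<close>)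
  ultimately have "(LINT x|lborel. (\<Sum>i\<in>UNIV. G' i x)) = 0"
    by (subst Bochner_Integration.integral_sum) auto
  moreover have "(\<Sum>i\<in>UNIV. G' i x) = (2 * (real l - real m)) * (p x * q x * g (x \<bullet> x))" for x
  proof -
    have "(\<Sum>i\<in>UNIV. G' i x) = (p x * (\<Sum>i\<in>UNIV. EE i i x) - q x * (\<Sum>i\<in>UNIV. DD i i x)) * W (x \<bullet> x)
       - 2 * g (x \<bullet> x) * (p x * (\<Sum>i\<in>UNIV. x $ i * E i x) - q x * (\<Sum>i\<in>UNIV. x $ i * D i x))"
      by (simp add: G'_def sum_distrib_left sum_distrib_right sum_subtractf sum.distrib algebra_simps)
    also have "\<dots> = - 2 * g (x \<bullet> x) * (p x * (real m * q x) - q x * (real l * p x))"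
      using Euler_homogeneous[OF D(2) homp] Euler_homogeneous[OF E(2) homq]
        laplacian_eq_sum[of p D DD x, OF D(2) DD(2)] laplacian_eq_sum[of q E EE x, OF E(2) EE(2)]
        lapp lapq
      by simp
    finally show ?thesis by (simp add: algebra_simps)
  qed
  ultimately show ?thesis using \<open>l \<noteq> m\<close> by simp
qed

text \<open>The product \<open>F\<close> is homogeneous of degree \<open>d\<close>, so the weight
  \<open>norm x ^ (-d)\<close> on the unit ball would turn its volume integral into the surface
  integral. That weight is singular at 0 and jumps at radius 1; continuous weights admissible for
  the previous lemma approximate it, and dominated convergence passes to the limit.\<close>

lemma spherical_harmonics_orthogonal:
  assumes f: "f \<in> spherical_harmonics l" and h: "h \<in> spherical_harmonics m" and "l \<noteq> m"
  shows "sphere_integral (\<lambda>x. f x * h x) = 0"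
proof -
  obtain p where p: "real_polynomial_function p" "\<And>c x. p (c *\<^sub>R x) = c ^ l * p x"
      "\<And>x. laplacian p x = 0" "\<And>x. x \<in> unit_sphere \<Longrightarrow> f x = p x"
    using f by (auto simp: spherical_harmonics_def)
  obtain q where q: "real_polynomial_function q" "\<And>c x. q (c *\<^sub>R x) = c ^ m * q x"
      "\<And>x. laplacian q x = 0" "\<And>x. x \<in> unit_sphere \<Longrightarrow> h x = q x"
    using h by (auto simp: spherical_harmonics_def)
  have cont: "continuous_on A p" "continuous_on A q" for A
    using p(1) q(1) by (auto simp: real_polynomial_function_eq intro: continuous_on_polymonial_function)
  define d where "d = l + m"
  define F where "F x = p x * q x" for x
  have homF: "F (c *\<^sub>R x) = c ^ d * F x" for c x
    by (simp add: F_def d_def p(2) q(2) power_add)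
  have contF: "continuous_on A F" for A
    unfolding F_def by (intro continuous_intros cont)
  \<comment> \<open>Different degrees force \<open>d > 0\<close>. The origin, where
    \<open>x /\<^sub>R norm x\<close> is 0 by convention, therefore causes no trouble below.\<close>
  have F0: "F 0 = 0"
    using homF[of 0 0] \<open>l \<noteq> m\<close> by (cases "d = 0") (auto simp: d_def zero_power)
  have F_eq: "F x = norm x ^ d * F (x /\<^sub>R norm x)" if "x \<noteq> 0" for x
    using homF[of "norm x" "x /\<^sub>R norm x"] that by simp
  \<comment> \<open>In the variable \<open>u = x \<bullet> x\<close>, the factor \<open>a n\<close>
    is the power \<open>u powr (-d / 2)\<close> capped near 0, and \<open>b n\<close> descends
    linearly from 1 at \<open>u = 1\<close> to 0 at \<open>u = 1 + 1 / (n + 1)\<close>.\<close>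
  define a where "a n u = max u (1 / real (Suc n)) powr (- real d / 2)" for n u
  define b where "b n u = max 0 (min 1 (1 - real (Suc n) * (u - 1)))" for n and u :: real
  define g where "g n u = a n u * b n u" for n u
  have pos: "max u (1 / real (Suc n)) > 0" for u n
    by (simp add: less_max_iff_disj)
  have g_cont: "continuous_on UNIV (g n)" for n
    unfolding g_def a_def b_def using pos[of _ n]
    by (intro continuous_intros) (auto simp: less_imp_neq[symmetric])
  have b2: "b n u = 0" if "u \<ge> 2" for n u
  proof -
    have "1 * 1 \<le> real (Suc n) * (u - 1)" using that by (intro mult_mono) auto
    then have "1 - real (Suc n) * (u - 1) \<le> 0" using that by linarith
    then show ?thesis unfolding b_def by linarith
  qed
  have b01: "0 \<le> b n u" "b n u \<le> 1" for n u by (auto simp: b_def)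
  have norm_powr: "(x \<bullet> x) powr (- real d / 2) * norm x ^ d = 1" if "x \<noteq> 0" for x :: "real^3"
  proof -
    have "(x \<bullet> x) = norm x powr 2"
      using that by (simp add: power2_norm_eq_inner[symmetric])
    then have "(x \<bullet> x) powr (- real d / 2) = norm x powr (- real d)"
      by (simp only: powr_powr) simp
    then show ?thesis using that by (simp add: powr_minus powr_realpow)
  qed
  obtain B where B: "B \<ge> 0" "\<And>x. x \<in> unit_sphere \<Longrightarrow> \<bar>F x\<bar> \<le> B"
    using continuous_on_sphere_bounded[OF contF] by blast
  define L where "L x = indicator (cball 0 1 - {0}) x * F (x /\<^sub>R norm x)" for x
  have bound: "\<bar>F x * g n (x \<bullet> x)\<bar> \<le> indicator (cball 0 2) x * B" for x n
  proof (cases "x = 0")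
    case True
    then show ?thesis using B(1) F0 by simp
  next
    case False
    then have "x \<bullet> x > 0" by simp
    have "a n (x \<bullet> x) \<le> (x \<bullet> x) powr (- real d / 2)"
      unfolding a_def using \<open>x \<bullet> x > 0\<close> by (intro powr_mono2') auto
    moreover have "0 \<le> a n (x \<bullet> x)" by (simp add: a_def)
    ultimately have "norm x ^ d * a n (x \<bullet> x) \<le> 1"
      using norm_powr[OF False] mult_left_mono[of "a n (x \<bullet> x)" "(x \<bullet> x) powr (- real d / 2)" "norm x ^ d"]
      by (simp add: mult.commute)
    then have 1: "norm x ^ d * a n (x \<bullet> x) * b n (x \<bullet> x) \<le> 1 * indicator (cball 0 2) x"
    proof (cases "norm x \<le> 2")
      case True
      then show ?thesis
        using \<open>norm x ^ d * a n (x \<bullet> x) \<le> 1\<close> b01[where n = n and u = "x \<bullet> x"] \<open>0 \<le> a n (x \<bullet> x)\<close>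
        by (simp add: mult_le_one)
    next
      case False
      have "(2::real)\<^sup>2 \<le> (norm x)\<^sup>2" using False by (intro power_mono) auto
      then have "b n (x \<bullet> x) = 0" by (intro b2) (simp add: power2_norm_eq_inner)
      then show ?thesis by simp
    qed
    have "\<bar>F x * g n (x \<bullet> x)\<bar> = \<bar>F (x /\<^sub>R norm x)\<bar> * (norm x ^ d * a n (x \<bullet> x) * b n (x \<bullet> x))"
      by (subst F_eq[OF False]) (use b01[where n = n and u = "x \<bullet> x"] \<open>0 \<le> a n (x \<bullet> x)\<close> in \<open>simp add: g_def abs_mult\<close>)
    also have "\<dots> \<le> B * (1 * indicator (cball 0 2) x)"
    proof (rule mult_mono)
      show "\<bar>F (x /\<^sub>R norm x)\<bar> \<le> B" using False by (intro B(2)) simp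
      show "0 \<le> norm x ^ d * a n (x \<bullet> x) * b n (x \<bullet> x)"
        using b01[where n = n and u = "x \<bullet> x"] \<open>0 \<le> a n (x \<bullet> x)\<close> by simp
    qed (fact B 1)+
    finally show ?thesis by (simp add: mult.commute)
  qed
  have lim: "(\<lambda>n. F x * g n (x \<bullet> x)) \<longlonglongrightarrow> L x" for x
  proof (cases "x = 0")
    case True
    then show ?thesis using F0 by (simp add: L_def)
  next
    case False
    then have pos': "x \<bullet> x > 0" by simp
    have ev_a: "eventually (\<lambda>n. a n (x \<bullet> x) = (x \<bullet> x) powr (- real d / 2)) sequentially"
    proof -
      have "eventually (\<lambda>n. 1 / real (Suc n) < x \<bullet> x) sequentially"
        using order_tendstoD(2)[OF LIMSEQ_inverse_real_of_nat pos'] by (simp add: inverse_eq_divide)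
      then show ?thesis by eventually_elim (simp add: a_def max_def)
    qed
    have ev_b: "eventually (\<lambda>n. b n (x \<bullet> x) = indicator (cball 0 1) x) sequentially"
    proof (cases "norm x \<le> 1")
      case True
      then have "x \<bullet> x \<le> 1"
        by (simp add: power2_norm_eq_inner[symmetric] power_le_one)
      then have "b n (x \<bullet> x) = 1" for n
        using mult_nonneg_nonpos[of "real (Suc n)" "x \<bullet> x - 1"] by (simp add: b_def)
      then show ?thesis using True by simp
    next
      case False
      then have "x \<bullet> x - 1 > 0"
        using one_less_power[of "norm x" 2] by (simp add: power2_norm_eq_inner)
      have "eventually (\<lambda>n. 1 / real (Suc n) < x \<bullet> x - 1) sequentially"
        using order_tendstoD(2)[OF LIMSEQ_inverse_real_of_nat \<open>x \<bullet> x - 1 > 0\<close>]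
        by (simp add: inverse_eq_divide)
      then show ?thesis
      proof eventually_elim
        case (elim n)
        then have "1 < (x \<bullet> x - 1) * real (Suc n)" by (simp add: pos_divide_less_eq)
        then show ?case using False by (simp add: b_def mult.commute)
      qed
    qed
    from ev_a ev_b have "eventually (\<lambda>n. F x * g n (x \<bullet> x) = L x) sequentially"
    proof eventually_elim
      case (elim n)
      have "F x * g n (x \<bullet> x)
          = F (x /\<^sub>R norm x) * ((x \<bullet> x) powr (- real d / 2) * norm x ^ d) * indicator (cball 0 1) x"
        by (subst F_eq[OF False]) (simp add: g_def elim)
      also have "\<dots> = F (x /\<^sub>R norm x) * indicator (cball 0 1) x"
        by (simp only: norm_powr[OF False] mult_1_right)
      also have "\<dots> = L x"
        unfolding L_def indicator_def using False by auto
      finally show ?case .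
    qed
    then show ?thesis by (rule tendsto_eventually)
  qed
  have "(\<lambda>n. LINT x|lborel. F x * g n (x \<bullet> x)) \<longlonglongrightarrow> (LINT x|lborel. L x)"
  proof (rule integral_dominated_convergence)
    show meas: "(\<lambda>x. F x * g n (x \<bullet> x)) \<in> borel_measurable lborel" for n
    proof -
      have "continuous_on UNIV (\<lambda>x. F x * g n (x \<bullet> x))"
        by (intro continuous_intros contF continuous_on_compose2[OF g_cont]) auto
      then show ?thesis by (simp add: borel_measurable_continuous_onI)
    qed
    show "L \<in> borel_measurable lborel"
      by (rule borel_measurable_LIMSEQ_real[OF lim meas])
    show "integrable lborel (\<lambda>x::real^3. indicator (cball 0 2) x * B)"
      using borel_integrable_compact[of "cball 0 2 :: (real^3) set" "\<lambda>_. B"] by simp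
    show "AE x in lborel. (\<lambda>n. F x * g n (x \<bullet> x)) \<longlonglongrightarrow> L x" using lim by simp
    show "AE x in lborel. norm (F x * g n (x \<bullet> x)) \<le> indicator (cball 0 2) x * B" for n
      using bound by simp
  qed
  moreover have "(LINT x|lborel. F x * g n (x \<bullet> x)) = 0" for n
    unfolding F_def
    by (rule harmonic_product_radial_integral_eq_0[OF p(1) q(1) p(2) q(2) p(3) q(3) \<open>l \<noteq> m\<close> g_cont])
      (simp add: g_def b2)
  ultimately have "(LINT x|lborel. L x) = 0"
    by (simp add: LIMSEQ_const_iff)
  moreover have "sphere_integral (\<lambda>x. f x * h x) = sphere_integral F"
    by (rule sphere_integral_cong) (simp add: F_def p(4) q(4))
  ultimately show ?thesis
    using sphere_integral_eq_lborel[OF contF] by (simp add: L_def)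
qed

section \<open>Polynomials restricted to the sphere\<close>

text \<open>A grading of the polynomial functions on the space by upper bounds for the degree: the
  dimension count must know the bound, not merely that a function is polynomial.\<close>

inductive degree_le :: "nat \<Rightarrow> (real^3 \<Rightarrow> real) \<Rightarrow> bool" where
  const: "degree_le n (\<lambda>_. c)"
| coord: "degree_le (Suc n) (\<lambda>x. x $ i)"
| add: "degree_le n f \<Longrightarrow> degree_le n g \<Longrightarrow> degree_le n (\<lambda>x. f x + g x)"
| mult: "degree_le m f \<Longrightarrow> degree_le n g \<Longrightarrow> degree_le (m + n) (\<lambda>x. f x * g x)"

text \<open>The surplus \<open>n - m\<close> is carried by the constant factor 1, for which every
  bound is allowed.\<close>

lemma degree_le_mono: "degree_le m f \<Longrightarrow> m \<le> n \<Longrightarrow> degree_le n f"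
  using degree_le.mult[of "n - m" "\<lambda>_. 1" m f] degree_le.const by auto

lemma degree_le_sum:
  "(\<And>i. i \<in> I \<Longrightarrow> degree_le n (f i)) \<Longrightarrow> degree_le n (\<lambda>x. \<Sum>i\<in>I. f i x)"
  by (induction I rule: infinite_finite_induct) (auto intro: degree_le.const degree_le.add)

lemma continuous_on_degree_le: "degree_le n f \<Longrightarrow> continuous_on A f"
  by (induction rule: degree_le.induct) (auto intro!: continuous_intros)

text \<open>\<open>c j\<close> is the homogeneous part of degree \<open>j\<close>, encoded as the
  coefficient of \<open>t ^ j\<close> in \<open>p (t x)\<close>. The parts extract a degree bound
  from a function known only to be polynomial; their vanishing beyond \<open>N\<close> makes the
  convolution formula for products applicable.\<close>

lemma real_polynomial_function_homogeneous_parts: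
  fixes p :: "real^3 \<Rightarrow> real"
  assumes "real_polynomial_function p"
  shows "\<exists>N c. (\<forall>j. degree_le j (c j)) \<and> (\<forall>j>N. \<forall>x. c j x = 0) \<and>
               (\<forall>t x. p (t *\<^sub>R x) = (\<Sum>j\<le>N. c j x * t ^ j))"
  using assms
proof induction
  case (linear f)
  interpret f: bounded_linear f by fact
  have f_eq: "f h = (\<Sum>i\<in>UNIV. f (axis i 1) * h $ i)" for h
  proof -
    have "f h = f (\<Sum>i\<in>UNIV. h $ i *\<^sub>R axis i 1)"
      using basis_expansion[of h] by (simp add: scalar_mult_eq_scaleR)
    then show ?thesis by (simp add: f.sum f.scaleR mult.commute)
  qed
  have eq: "f = (\<lambda>h. \<Sum>i\<in>UNIV. f (axis i 1) * h $ i)"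
    by (rule ext, rule f_eq)
  have "degree_le (0 + 1) (\<lambda>h. f (axis i 1) * h $ i)" for i
    by (intro degree_le.mult degree_le.const) (simp add: degree_le.coord[of 0, simplified])
  then have "degree_le (Suc 0) (\<lambda>h. \<Sum>i\<in>UNIV. f (axis i 1) * h $ i)"
    by (intro degree_le_sum) simp
  then have deg: "degree_le (Suc 0) f" by (subst eq)
  have "degree_le j (if j = 1 then f else (\<lambda>_. 0))" for j
    using deg by (auto intro: degree_le.const)
  then show ?case
    by (intro exI[of _ 1] exI[of _ "\<lambda>j. if j = 1 then f else (\<lambda>_. 0)"]) (auto simp: f.scaleR)
next
  case (const c)
  have "degree_le j (if j = 0 then (\<lambda>_. c) else (\<lambda>_. 0))" for j
    by (auto intro: degree_le.const)
  then show ?case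
    by (intro exI[of _ 0] exI[of _ "\<lambda>j. if j = 0 then (\<lambda>_. c) else (\<lambda>_. 0)"]) auto
next
  case (add f g)
  from add.IH(1) obtain M a where
    a: "\<And>j. degree_le j (a j)" "\<And>j x. j > M \<Longrightarrow> a j x = 0"
      "\<And>t x. f (t *\<^sub>R x) = (\<Sum>j\<le>M. a j x * t ^ j)"
    by blast
  from add.IH(2) obtain N b where
    b: "\<And>j. degree_le j (b j)" "\<And>j x. j > N \<Longrightarrow> b j x = 0"
      "\<And>t x. g (t *\<^sub>R x) = (\<Sum>j\<le>N. b j x * t ^ j)"
    by blast
  have "(\<Sum>j\<le>M. a j x * t ^ j) = (\<Sum>j\<le>max M N. a j x * t ^ j)" for x and t :: real
    by (rule sum.mono_neutral_left) (auto simp: a(2))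
  moreover have "(\<Sum>j\<le>N. b j x * t ^ j) = (\<Sum>j\<le>max M N. b j x * t ^ j)" for x and t :: real
    by (rule sum.mono_neutral_left) (auto simp: b(2))
  ultimately have "\<forall>t x. f (t *\<^sub>R x) + g (t *\<^sub>R x) = (\<Sum>j\<le>max M N. (a j x + b j x) * t ^ j)"
    by (simp add: a(3) b(3) ring_distribs sum.distrib)
  moreover have "degree_le j (\<lambda>x. a j x + b j x)" for j
    by (intro degree_le.add a(1) b(1))
  ultimately show ?case
    by (intro exI[of _ "max M N"] exI[of _ "\<lambda>j x. a j x + b j x"]) (simp add: a(2) b(2))
next
  case (mult f g)
  from mult.IH(1) obtain M a where
    a: "\<And>j. degree_le j (a j)" "\<And>j x. j > M \<Longrightarrow> a j x = 0"
      "\<And>t x. f (t *\<^sub>R x) = (\<Sum>j\<le>M. a j x * t ^ j)"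
    by blast
  from mult.IH(2) obtain N b where
    b: "\<And>j. degree_le j (b j)" "\<And>j x. j > N \<Longrightarrow> b j x = 0"
      "\<And>t x. g (t *\<^sub>R x) = (\<Sum>j\<le>N. b j x * t ^ j)"
    by blast
  have "\<forall>t x. f (t *\<^sub>R x) * g (t *\<^sub>R x) = (\<Sum>r\<le>M + N. (\<Sum>k\<le>r. a k x * b (r - k) x) * t ^ r)"
    unfolding a(3) b(3) by (intro allI polynomial_product a(2) b(2))
  moreover have "degree_le r (\<lambda>x. \<Sum>k\<le>r. a k x * b (r - k) x)" for r
  proof (rule degree_le_sum)
    fix k assume "k \<in> {..r}"
    then show "degree_le r (\<lambda>x. a k x * b (r - k) x)"
      using degree_le.mult[OF a(1)[of k] b(1)[of "r - k"]] by simp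
  qed
  moreover have "(\<Sum>k\<le>r. a k x * b (r - k) x) = 0" if "r > M + N" for r x
  proof (rule sum.neutral, rule ballI)
    fix k
    show "a k x * b (r - k) x = 0"
      using that a(2)[of k x] b(2)[of "r - k" x] by (cases "k > M") auto
  qed
  ultimately show ?case
    by (intro exI[of _ "M + N"] exI[of _ "\<lambda>r x. \<Sum>k\<le>r. a k x * b (r - k) x"]) blast
qed

lemma real_polynomial_function_degree_le:
  assumes "real_polynomial_function (p :: real^3 \<Rightarrow> real)"
  shows "\<exists>n. degree_le n p"
proof -
  obtain N c where c: "\<And>j. degree_le j (c j)" "\<And>t x. p (t *\<^sub>R x) = (\<Sum>j\<le>N. c j x * t ^ j)"
    using real_polynomial_function_homogeneous_parts[OF assms] by blast
  have "p = (\<lambda>x. \<Sum>j\<le>N. c j x)"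
    using c(2)[of 1] by (simp add: fun_eq_iff)
  moreover have "degree_le N (\<lambda>x. \<Sum>j\<le>N. c j x)"
    using c(1) degree_le_mono by (intro degree_le_sum) auto
  ultimately show ?thesis by auto
qed

text \<open>By homogeneity \<open>p (t x)\<close> is the single power \<open>t ^ l * p x\<close>.
  Comparing coefficients in \<open>t\<close> at fixed \<open>x\<close> identifies \<open>p\<close>
  with its part \<open>c l\<close>, which carries the bound \<open>l\<close>.\<close>

lemma spherical_harmonics_degree_le:
  assumes "f \<in> spherical_harmonics l"
  shows "\<exists>p. degree_le l p \<and> (\<forall>x\<in>unit_sphere. f x = p x)"
proof -
  obtain p where p: "real_polynomial_function p" "\<And>c x. p (c *\<^sub>R x) = c ^ l * p x"
      "\<And>x. x \<in> unit_sphere \<Longrightarrow> f x = p x"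
    using assms by (auto simp: spherical_harmonics_def)
  obtain N c where c: "\<And>j. degree_le j (c j)" "\<And>j x. j > N \<Longrightarrow> c j x = 0"
      "\<And>t x. p (t *\<^sub>R x) = (\<Sum>j\<le>N. c j x * t ^ j)"
    using real_polynomial_function_homogeneous_parts[OF p(1)] by blast
  have "c l x = p x" for x
  proof -
    \<comment> \<open>Both polynomials in \<open>t\<close> are written with the same length
      \<open>max N l\<close>, since \<open>l\<close> may exceed \<open>N\<close>.\<close>
    have "(\<Sum>j\<le>max N l. c j x * t ^ j) = (\<Sum>j\<le>max N l. (if j = l then p x else 0) * t ^ j)" for t
    proof -
      have "(\<Sum>j\<le>max N l. c j x * t ^ j) = (\<Sum>j\<le>N. c j x * t ^ j)"
        by (rule sum.mono_neutral_right) (auto simp: c(2))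
      also have "\<dots> = p x * t ^ l"
        using c(3)[of t x] p(2)[of t x] by (simp add: mult.commute)
      also have "\<dots> = (\<Sum>j\<le>max N l. if j = l then p x * t ^ j else 0)"
        by simp
      also have "\<dots> = (\<Sum>j\<le>max N l. (if j = l then p x else 0) * t ^ j)"
        by (rule sum.cong) auto
      finally show ?thesis .
    qed
    then show ?thesis
      using polyfun_eq_coeffs[where c = "\<lambda>j. c j x" and n = "max N l" and d = "\<lambda>j. if j = l then p x else 0"]
      by simp
  qed
  then show ?thesis using c(1)[of l] p(3) by auto
qed

lemma continuous_on_spherical_harmonics:
  assumes "f \<in> spherical_harmonics l" shows "continuous_on unit_sphere f"
proof -
  obtain p where p: "degree_le l p" "\<And>x. x \<in> unit_sphere \<Longrightarrow> f x = p x"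
    using spherical_harmonics_degree_le[OF assms] by blast
  show ?thesis
    using continuous_on_cong[THEN iffD2, OF refl p(2) continuous_on_degree_le[OF p(1)]] .
qed

section \<open>Reduced monomials and the dimension bound\<close>

interpretation function_space: vector_space "\<lambda>(c::real) (f::real^3 \<Rightarrow> real) x. c * f x"
  by standard (auto simp: fun_eq_iff algebra_simps)

text \<open>Values off the sphere are replaced by 0, so that agreement on the sphere becomes
  equality of functions. Span and independence then refer to the restrictions.\<close>

definition restrict_to_sphere :: "(real^3 \<Rightarrow> real) \<Rightarrow> real^3 \<Rightarrow> real" where
  "restrict_to_sphere f x = (if x \<in> unit_sphere then f x else 0)"

text \<open>On the sphere \<open>x\<^sub>3\<^sup>2 = 1 - x\<^sub>1\<^sup>2 - x\<^sub>2\<^sup>2\<close>, so exponents of \<open>x\<^sub>3\<close> up to 1 suffice.\<close>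

definition reduced_monomial :: "nat \<times> nat \<times> nat \<Rightarrow> real^3 \<Rightarrow> real" where
  "reduced_monomial = (\<lambda>(a, b, e) x. if x \<in> unit_sphere then x $ 1 ^ a * x $ 2 ^ b * x $ 3 ^ e else 0)"

definition reduced_exponents :: "nat \<Rightarrow> (nat \<times> nat \<times> nat) set" where
  "reduced_exponents n = {(a, b, e). a + b + e \<le> n \<and> e \<le> 1}"

abbreviation reduced_monomials :: "nat \<Rightarrow> (real^3 \<Rightarrow> real) set" where
  "reduced_monomials n \<equiv> reduced_monomial ` reduced_exponents n"

lemma finite_reduced_exponents: "finite (reduced_exponents n)"
proof (rule finite_subset)
  show "reduced_exponents n \<subseteq> {..n} \<times> {..n} \<times> {..n}" by (auto simp: reduced_exponents_def)
qed auto

lemma card_reduced_exponents: "card (reduced_exponents n) \<le> (n + 1)\<^sup>2"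
proof -
  \<comment> \<open>The triples with \<open>e = 0\<close> fill the triangle
    \<open>a + b \<le> n\<close> of the square. Those with \<open>e = 1\<close> satisfy
    \<open>a + b < n\<close>, and the point reflection sends them to pairs with sum above
    \<open>n\<close>, so the two images are disjoint.\<close>
  let ?f = "\<lambda>(a, b, e). if e = 0 then (a, b) else (n - a, n - b)"
  have "inj_on ?f (reduced_exponents n)"
    by (rule inj_onI) (auto simp: reduced_exponents_def split: if_splits)
  moreover have "?f ` reduced_exponents n \<subseteq> {..n} \<times> {..n}"
    by (auto simp: reduced_exponents_def split: if_splits)
  ultimately have "card (reduced_exponents n) \<le> card ({..n} \<times> {..n})"
    by (intro card_inj_on_le) auto
  then show ?thesis by (simp add: card_cartesian_product power2_eq_square)
qed

lemma sum_squares_on_sphere: "x \<in> unit_sphere \<Longrightarrow> (x $ 1)\<^sup>2 + (x $ 2)\<^sup>2 + (x $ 3)\<^sup>2 = (1::real)"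
  by (simp add: norm_vec_def L2_set_def sum_3 real_sqrt_eq_1_iff)

lemma reduced_monomial_mult:
  assumes "s \<in> reduced_exponents m" "t \<in> reduced_exponents n"
  shows "(\<lambda>x. reduced_monomial s x * reduced_monomial t x)
           \<in> function_space.span (reduced_monomials (m + n))"
proof -
  obtain a b e where s: "s = (a, b, e)" by (cases s)
  obtain a' b' e' where t: "t = (a', b', e')" by (cases t)
  have in_span: "reduced_monomial (i, j, k) \<in> function_space.span (reduced_monomials (m + n))"
    if "i + j + k \<le> m + n" "k \<le> 1" for i j k
    using that by (intro function_space.span_base imageI) (simp add: reduced_exponents_def)
  show ?thesis
  proof (cases "e + e' \<le> 1")
    case True
    have "(\<lambda>x. reduced_monomial s x * reduced_monomial t x) = reduced_monomial (a + a', b + b', e + e')"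
      by (auto simp: s t reduced_monomial_def fun_eq_iff power_add)
    then show ?thesis
      using in_span[of "a + a'" "b + b'" "e + e'"] True assms by (auto simp: s t reduced_exponents_def)
  next
    case False
    then have e: "e = 1" "e' = 1" using assms by (auto simp: s t reduced_exponents_def)
    \<comment> \<open>Only a factor \<open>x $ 3 ^ 2\<close> leaves the family. The sphere equation
      replaces it by \<open>1 - x $ 1 ^ 2 - x $ 2 ^ 2\<close>, which does not raise the
      degree.\<close>
    let ?u = "reduced_monomial (a + a', b + b', 0)"
    let ?v = "reduced_monomial (a + a' + 2, b + b', 0)"
    let ?w = "reduced_monomial (a + a', b + b' + 2, 0)"
    have "(\<lambda>x. reduced_monomial s x * reduced_monomial t x) = ?u - ?v - ?w"
    proof
      fix x :: "real^3"
      show "reduced_monomial s x * reduced_monomial t x = (?u - ?v - ?w) x"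
      proof (cases "x \<in> unit_sphere")
        case True
        have x3: "x $ 3 * x $ 3 = 1 - x $ 1 * x $ 1 - x $ 2 * x $ 2"
          using sum_squares_on_sphere[OF True] by (simp add: power2_eq_square)
        have "reduced_monomial s x * reduced_monomial t x
            = x $ 1 ^ (a + a') * x $ 2 ^ (b + b') * (x $ 3 * x $ 3)"
          using True by (simp add: s t e reduced_monomial_def power_add)
        also have "\<dots> = (?u - ?v - ?w) x"
          unfolding x3 using True by (simp add: reduced_monomial_def power_add power2_eq_square algebra_simps)
        finally show ?thesis .
      qed (simp add: s t reduced_monomial_def)
    qed
    moreover have "?u - ?v - ?w \<in> function_space.span (reduced_monomials (m + n))"
      using assms by (intro function_space.span_diff in_span) (auto simp: s t e reduced_exponents_def)
    ultimately show ?thesis by simp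
  qed
qed

lemma span_reduced_monomials_mult:
  assumes "f \<in> function_space.span (reduced_monomials m)"
    and "g \<in> function_space.span (reduced_monomials n)"
  shows "(\<lambda>x. f x * g x) \<in> function_space.span (reduced_monomials (m + n))"
  using assms(1)
proof (induction rule: function_space.span_induct_alt)
  case base
  have "(\<lambda>x. (0 :: real^3 \<Rightarrow> real) x * g x) = 0" by auto
  then show ?case by (simp only: function_space.span_zero)
next
  case (step c u v)
  have "(\<lambda>x. u x * g x) \<in> function_space.span (reduced_monomials (m + n))"
    using assms(2)
  proof (induction rule: function_space.span_induct_alt)
    case base
    have "(\<lambda>x. u x * (0 :: real^3 \<Rightarrow> real) x) = 0" by auto
    then show ?case by (simp only: function_space.span_zero)
  next
    case (step d w z)
    have "(\<lambda>x. u x * w x) \<in> function_space.span (reduced_monomials (m + n))"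
      using \<open>u \<in> _\<close> step(1) reduced_monomial_mult by auto
    then have "(\<lambda>x. d * (u x * w x)) + (\<lambda>x. u x * z x) \<in> function_space.span (reduced_monomials (m + n))"
      by (intro function_space.span_add function_space.span_scale step(2))
    moreover have "(\<lambda>x. d * (u x * w x)) + (\<lambda>x. u x * z x) = (\<lambda>x. u x * ((\<lambda>x. d * w x) + z) x)"
      by (auto simp: fun_eq_iff algebra_simps)
    ultimately show ?case by simp
  qed
  then have "(\<lambda>x. c * (u x * g x)) + (\<lambda>x. v x * g x) \<in> function_space.span (reduced_monomials (m + n))"
    by (intro function_space.span_add function_space.span_scale step(2))
  moreover have "(\<lambda>x. c * (u x * g x)) + (\<lambda>x. v x * g x) = (\<lambda>x. ((\<lambda>x. c * u x) + v) x * g x)"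
    by (auto simp: fun_eq_iff algebra_simps)
  ultimately show ?case by simp
qed

text \<open>Together with \<open>card_reduced_exponents\<close> this bounds the dimension of the
  restrictions by \<open>(n + 1)^2\<close>, the upper half of the dimension count.\<close>

lemma degree_le_in_span_reduced_monomials:
  "degree_le n f \<Longrightarrow> restrict_to_sphere f \<in> function_space.span (reduced_monomials n)"
proof (induction rule: degree_le.induct)
  case (const n c)
  have "restrict_to_sphere (\<lambda>_. c) = (\<lambda>x. c * reduced_monomial (0, 0, 0) x)"
    by (auto simp: fun_eq_iff restrict_to_sphere_def reduced_monomial_def)
  also have "\<dots> \<in> function_space.span (reduced_monomials n)"
    by (intro function_space.span_scale function_space.span_base imageI) (simp add: reduced_exponents_def)
  finally show ?case .
next
  case (coord n i)
  have "i = 1 \<or> i = 2 \<or> i = 3" using exhaust_3 by blast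
  then have "\<exists>t\<in>reduced_exponents (Suc n). restrict_to_sphere (\<lambda>x. x $ i) = reduced_monomial t"
  proof (elim disjE)
    show ?thesis if "i = 1"
      by (rule bexI[of _ "(1, 0, 0)"])
        (auto simp: that fun_eq_iff restrict_to_sphere_def reduced_monomial_def reduced_exponents_def)
    show ?thesis if "i = 2"
      by (rule bexI[of _ "(0, 1, 0)"])
        (auto simp: that fun_eq_iff restrict_to_sphere_def reduced_monomial_def reduced_exponents_def)
    show ?thesis if "i = 3"
      by (rule bexI[of _ "(0, 0, 1)"])
        (auto simp: that fun_eq_iff restrict_to_sphere_def reduced_monomial_def reduced_exponents_def)
  qed
  then show ?case by (auto intro: function_space.span_base)
next
  case (add n f g)
  have "restrict_to_sphere (\<lambda>x. f x + g x) = restrict_to_sphere f + restrict_to_sphere g"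
    by (auto simp: fun_eq_iff restrict_to_sphere_def)
  then show ?case using add.IH by (simp only: function_space.span_add)
next
  case (mult m f n g)
  have "restrict_to_sphere (\<lambda>x. f x * g x) = (\<lambda>x. restrict_to_sphere f x * restrict_to_sphere g x)"
    by (auto simp: fun_eq_iff restrict_to_sphere_def)
  then show ?case using span_reduced_monomials_mult[OF mult.IH] by simp
qed

section \<open>Uniform boundedness and quadrature functionals\<close>

text \<open>Baire's theorem gives a ball on which all \<open>T n\<close> share a bound, and
  subadditivity moves that bound to the unit ball. The form with seminorms covers both applications:
  the absolute value of \<open>Q_n f\<close> and the \<open>L2_norm\<close> of
  \<open>L_n f\<close>.\<close>

lemma uniform_boundedness_seminorms:
  fixes T :: "nat \<Rightarrow> 'a::{real_normed_vector, complete_space} \<Rightarrow> real"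
  assumes sub: "\<And>n x y. T n (x + y) \<le> T n x + T n y"
    and scale: "\<And>n c x. T n (c *\<^sub>R x) = \<bar>c\<bar> * T n x"
    and bdd: "\<And>n. \<exists>B. \<forall>x. T n x \<le> B * norm x"
    and pointwise: "\<And>x. \<exists>B. \<forall>n. T n x \<le> B"
  shows "\<exists>C>0. \<forall>n x. norm x \<le> 1 \<longrightarrow> T n x \<le> C"
proof -
  \<comment> \<open>Continuity makes the sets \<open>A k\<close> closed. It follows from the reverse
    triangle inequality and \<open>bdd\<close>.\<close>
  have cont: "continuous_on UNIV (T n)" for n
  proof -
    obtain B where B: "\<And>x. T n x \<le> B * norm x" using bdd by blast
    have "T n (x - y) \<ge> T n x - T n y" for x y using sub[of n "x - y" y] by simp
    moreover have "T n (y - x) = T n (x - y)" for x y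
      using scale[of n "-1" "x - y"] by simp
    ultimately have diff: "\<bar>T n x - T n y\<bar> \<le> T n (x - y)" for x y
      by (metis abs_le_iff minus_diff_eq)
    have "isCont (T n) x" for x
      unfolding continuous_at tendsto_iff dist_real_def
    proof safe
      fix e :: real assume "e > 0"
      have "((\<lambda>y. B * norm (y - x)) \<longlongrightarrow> B * norm (x - x)) (at x)"
        by (intro tendsto_intros)
      then have "eventually (\<lambda>y. B * norm (y - x) < e) (at x)"
        using \<open>e > 0\<close> by (intro order_tendstoD(2)) auto
      then show "eventually (\<lambda>y. \<bar>T n y - T n x\<bar> < e) (at x)"
      proof eventually_elim
        case (elim y)
        then show ?case using diff[of y x] B[of "y - x"] by linarith
      qed
    qed
    then show ?thesis by (simp add: continuous_at_imp_continuous_on)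
  qed
  define A where "A k = {x. \<forall>n. T n x \<le> real k}" for k
  have closed: "closed (A k)" for k
    unfolding A_def by (intro closed_Collect_all closed_Collect_le cont continuous_on_const)
  have "(\<Union>k. A k) = UNIV"
  proof -
    have "x \<in> (\<Union>k. A k)" for x
    proof -
      obtain B where "\<And>n. T n x \<le> B" using pointwise by blast
      moreover obtain k where "B \<le> real k" using real_arch_simple by blast
      ultimately show ?thesis by (auto simp: A_def intro: order_trans)
    qed
    then show ?thesis by auto
  qed
  moreover have "\<exists>k. interior (A k) \<noteq> {}"
  proof (rule ccontr)
    assume "\<nexists>k. interior (A k) \<noteq> {}"
    then have "(euclidean :: 'a topology) interior_of (\<Union>(range A)) = {}"
      by (intro Baire_category_alt disjI1 completely_metrizable_space_euclidean) (auto simp: closed)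
    then show False using \<open>(\<Union>k. A k) = UNIV\<close> by simp
  qed
  ultimately obtain k z where "z \<in> interior (A k)" by auto
  then obtain r where r: "r > 0" "cball z r \<subseteq> A k"
    by (meson interior_subset open_contains_cball open_interior subset_trans)
  \<comment> \<open>Both \<open>z + r x\<close> and \<open>z\<close> lie in the ball, and
    \<open>r x\<close> is their difference, so \<open>r * T n x\<close> is at most
    \<open>2 * k\<close>.\<close>
  have "T n x \<le> 2 * real k / r" if "norm x \<le> 1" for n x
  proof -
    have "z + r *\<^sub>R x \<in> cball z r" using that r(1) by (simp add: dist_norm mult_left_le)
    then have "T n (z + r *\<^sub>R x) \<le> real k" using r(2) by (auto simp: A_def)
    moreover have "z \<in> cball z r" using r(1) by simp
    then have "T n z \<le> real k" using r(2) unfolding A_def by blast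
    moreover have "T n (- z) = T n z" using scale[of n "-1" z] by simp
    moreover have "T n (r *\<^sub>R x) \<le> T n (z + r *\<^sub>R x) + T n (- z)"
      using sub[of n "z + r *\<^sub>R x" "- z"] by simp
    ultimately have "r * T n x \<le> 2 * real k" using scale[of n r x] r(1) by simp
    then show ?thesis using r(1) by (simp add: field_simps)
  qed
  then have "\<forall>n x. norm x \<le> 1 \<longrightarrow> T n x \<le> 2 * real k / r + 1" by (meson le_add_same_cancel1 order_trans zero_le_one)
  moreover have "2 * real k / r + 1 > 0" using r(1) by (simp add: add_nonneg_pos)
  ultimately show ?thesis by blast
qed

lemma continuous_extension_from_sphere:
  fixes f :: "real^3 \<Rightarrow> real"
  assumes "continuous_on unit_sphere f" "\<And>x. x \<in> unit_sphere \<Longrightarrow> \<bar>f x\<bar> \<le> M"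
  obtains g where "continuous_on UNIV g" "\<And>x. x \<in> unit_sphere \<Longrightarrow> g x = f x" "\<And>x. \<bar>g x\<bar> \<le> M"
proof -
  have "M \<ge> 0" using assms(2)[of "axis 1 1"] by (simp add: norm_axis_1)
  moreover have "closedin (top_of_set UNIV) (unit_sphere :: (real^3) set)" by simp
  ultimately show ?thesis
    using Tietze[of unit_sphere f UNIV M] assms that by auto
qed

text \<open>The Banach space used is that of bounded continuous functions on the whole space.
  Tietze's theorem extends a function from the sphere with the same bound, and \<open>cong\<close>
  says that \<open>T\<close> sees only the values on the sphere.\<close>

lemma uniform_boundedness_sphere:
  fixes T :: "nat \<Rightarrow> (real^3 \<Rightarrow> real) \<Rightarrow> real"
  assumes sub: "\<And>n f g. continuous_on unit_sphere f \<Longrightarrow> continuous_on unit_sphere g \<Longrightarrow>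
      T n (\<lambda>x. f x + g x) \<le> T n f + T n g"
    and scale: "\<And>n c f. T n (\<lambda>x. c * f x) = \<bar>c\<bar> * T n f"
    and cong: "\<And>n f g. (\<And>x. x \<in> unit_sphere \<Longrightarrow> f x = g x) \<Longrightarrow> T n f = T n g"
    and bdd: "\<And>n. \<exists>B. \<forall>f M. continuous_on unit_sphere f \<longrightarrow> (\<forall>x\<in>unit_sphere. \<bar>f x\<bar> \<le> M) \<longrightarrow> T n f \<le> B * M"
    and pointwise: "\<And>f. continuous_on unit_sphere f \<Longrightarrow> \<exists>B. \<forall>n. T n f \<le> B"
  shows "\<exists>C>0. \<forall>n f. continuous_on unit_sphere f \<longrightarrow> (\<forall>x\<in>unit_sphere. \<bar>f x\<bar> \<le> 1) \<longrightarrow> T n f \<le> C"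
proof -
  have "\<exists>C>0. \<forall>n (h :: (real^3) \<Rightarrow>\<^sub>C real). norm h \<le> 1 \<longrightarrow> T n (apply_bcontfun h) \<le> C"
  proof (rule uniform_boundedness_seminorms[where T = "\<lambda>n h. T n (apply_bcontfun h)"])
    show "T n (apply_bcontfun (f + g)) \<le> T n (apply_bcontfun f) + T n (apply_bcontfun g)"
      for n and f g :: "(real^3) \<Rightarrow>\<^sub>C real"
      using sub[of "apply_bcontfun f" "apply_bcontfun g" n] by (simp add: plus_bcontfun.rep_eq)
    show "T n (apply_bcontfun (c *\<^sub>R f)) = \<bar>c\<bar> * T n (apply_bcontfun f)"
      for n c and f :: "(real^3) \<Rightarrow>\<^sub>C real"
      using scale[of n c "apply_bcontfun f"] by (simp add: scaleR_bcontfun.rep_eq)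
    show "\<exists>B. \<forall>h :: (real^3) \<Rightarrow>\<^sub>C real. T n (apply_bcontfun h) \<le> B * norm h" for n
    proof -
      obtain B where B: "\<And>f M. continuous_on unit_sphere f \<Longrightarrow> (\<forall>x\<in>unit_sphere. \<bar>f x\<bar> \<le> M) \<Longrightarrow> T n f \<le> B * M"
        using bdd[of n] by blast
      have "T n (apply_bcontfun h) \<le> B * norm h" for h :: "(real^3) \<Rightarrow>\<^sub>C real"
        using norm_bounded[of h] by (intro B) auto
      then show ?thesis by blast
    qed
    show "\<exists>B. \<forall>n. T n (apply_bcontfun h) \<le> B" for h :: "(real^3) \<Rightarrow>\<^sub>C real"
      by (rule pointwise) simp
  qed
  then obtain C where C: "C > 0" "\<And>n (h :: (real^3) \<Rightarrow>\<^sub>C real). norm h \<le> 1 \<Longrightarrow> T n (apply_bcontfun h) \<le> C"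
    by blast
  have "T n f \<le> C" if f: "continuous_on unit_sphere f" "\<And>x. x \<in> unit_sphere \<Longrightarrow> \<bar>f x\<bar> \<le> 1" for n f
  proof -
    obtain g where g: "continuous_on UNIV g" "\<And>x. x \<in> unit_sphere \<Longrightarrow> g x = f x" "\<And>x. \<bar>g x\<bar> \<le> 1"
      using continuous_extension_from_sphere[OF f] by blast
    have "g \<in> bcontfun" by (rule bcontfun_normI[of _ 1]) (use g in auto)
    then have eq: "apply_bcontfun (Bcontfun g) = g" by (rule Bcontfun_inverse)
    have "norm (Bcontfun g) \<le> 1" by (rule norm_bound) (simp add: eq g(3))
    then have "T n g \<le> C" using C(2)[of "Bcontfun g" n] eq by simp
    then show ?thesis using cong[of f g n] g(2) by simp
  qed
  then show ?thesis using C(1) by blast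
qed

section \<open>Quadrature functionals and their norms\<close>

lemma sup_norm_le_iff:
  assumes "continuous_on unit_sphere f"
  shows "sup_norm f \<le> M \<longleftrightarrow> (\<forall>x\<in>unit_sphere. \<bar>f x\<bar> \<le> M)"
proof -
  obtain B where "\<And>x. x \<in> unit_sphere \<Longrightarrow> \<bar>f x\<bar> \<le> B"
    using continuous_on_sphere_bounded[OF assms] by blast
  then have "bdd_above ((\<lambda>x. \<bar>f x\<bar>) ` unit_sphere)" by (intro bdd_aboveI2)
  moreover have "(unit_sphere :: (real^3) set) \<noteq> {}"
    using norm_axis_1 by (metis dist_0_norm empty_iff mem_sphere)
  ultimately show ?thesis unfolding sup_norm_def by (intro cSUP_le_iff)
qed

text \<open>One expression for several conditions: evaluated at 1 it is the sum in (PS), at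
  \<open>p\<close> the left side of (MZ12) and (MZ1), at the square of \<open>p\<close> the left
  side of (MZ2).\<close>

definition abs_quad :: "quadrature \<Rightarrow> (real^3 \<Rightarrow> real) \<Rightarrow> real" where
  "abs_quad q f = (\<Sum>j=1..num_nodes q. \<bar>weight q j\<bar> * \<bar>f (node q j)\<bar>)"

lemma node_in_sphere: "is_quadrature q \<Longrightarrow> j \<in> {1..num_nodes q} \<Longrightarrow> node q j \<in> unit_sphere"
  unfolding is_quadrature_def image_subset_iff by blast

lemma quad_cong:
  "is_quadrature q \<Longrightarrow> (\<And>x. x \<in> unit_sphere \<Longrightarrow> f x = g x) \<Longrightarrow> quad q f = quad q g"
  unfolding quad_def by (rule sum.cong) (simp_all only: node_in_sphere)

lemma quad_add: "quad q (\<lambda>x. f x + g x) = quad q f + quad q g"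
  by (simp add: quad_def ring_distribs sum.distrib)

lemma quad_diff: "quad q (\<lambda>x. f x - g x) = quad q f - quad q g"
  by (simp add: quad_def ring_distribs sum_subtractf)

lemma quad_cmult: "quad q (\<lambda>x. c * f x) = c * quad q f"
  by (simp add: quad_def sum_distrib_left mult_ac)

lemma quad_sum: "quad q (\<lambda>x. \<Sum>i\<in>I. f i x) = (\<Sum>i\<in>I. quad q (f i))"
  unfolding quad_def by (subst sum.swap) (simp add: sum_distrib_left)

lemma quad_le_abs_quad: "\<bar>quad q f\<bar> \<le> abs_quad q f"
  unfolding quad_def abs_quad_def by (rule order_trans[OF sum_abs]) (simp add: abs_mult)

lemma abs_quad_mult_le:
  assumes "is_quadrature q" "\<And>x. x \<in> unit_sphere \<Longrightarrow> \<bar>f x\<bar> \<le> M"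
  shows "abs_quad q (\<lambda>x. f x * g x) \<le> M * abs_quad q g"
  unfolding abs_quad_def sum_distrib_left
proof (rule sum_mono)
  fix j assume "j \<in> {1..num_nodes q}"
  then have "\<bar>f (node q j)\<bar> \<le> M" using assms by (intro assms(2) node_in_sphere)
  then have "\<bar>f (node q j)\<bar> * (\<bar>weight q j\<bar> * \<bar>g (node q j)\<bar>) \<le> M * (\<bar>weight q j\<bar> * \<bar>g (node q j)\<bar>)"
    by (rule mult_right_mono) simp
  then show "\<bar>weight q j\<bar> * \<bar>f (node q j) * g (node q j)\<bar> \<le> M * (\<bar>weight q j\<bar> * \<bar>g (node q j)\<bar>)"
    by (simp add: abs_mult mult_ac)
qed

lemma quad_le_bound:
  assumes "is_quadrature q" "\<And>x. x \<in> unit_sphere \<Longrightarrow> \<bar>f x\<bar> \<le> M"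
  shows "\<bar>quad q f\<bar> \<le> M * abs_quad q (\<lambda>_. 1)"
  using abs_quad_mult_le[where q = q and f = f and M = M and g = "\<lambda>_. 1", OF assms] quad_le_abs_quad[of q f] by simp

text \<open>The witness interpolates the signs of the summands at the nodes.\<close>

lemma abs_quad_attained:
  assumes q: "is_quadrature q"
  obtains f where "continuous_on unit_sphere f" "\<And>x. \<bar>f x\<bar> \<le> 1"
    "quad q (\<lambda>x. f x * g x) = abs_quad q g"
proof -
  let ?I = "{1..num_nodes q}"
  \<comment> \<open>The sign is prescribed at a point of space, so the index of the node has to be
    recovered from its position; this is unambiguous because the nodes are distinct.\<close>
  define s where "s x = sgn (weight q (inv_into ?I (node q) x) * g x)" for x
  have "continuous_on (node q ` ?I) s" by (rule continuous_on_finite) simp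
  moreover have "closedin (top_of_set UNIV) (node q ` ?I)"
    by (simp add: finite_imp_closed)
  moreover have "norm (s x) \<le> 1" for x by (simp add: s_def abs_sgn_eq)
  ultimately obtain f where f: "continuous_on UNIV f" "\<And>x. x \<in> node q ` ?I \<Longrightarrow> f x = s x"
      "\<And>x. norm (f x) \<le> 1"
    using Tietze[of "node q ` ?I" s UNIV 1] by auto
  have "quad q (\<lambda>x. f x * g x) = abs_quad q g"
    unfolding quad_def abs_quad_def
  proof (rule sum.cong)
    fix j assume j: "j \<in> ?I"
    have "inv_into ?I (node q) (node q j) = j"
      using q j by (intro inv_into_f_f) (auto simp: is_quadrature_def)
    then have "f (node q j) = sgn (weight q j * g (node q j))"
      using j by (simp add: f(2) s_def)
    then have "weight q j * (f (node q j) * g (node q j))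
        = (weight q j * g (node q j)) * sgn (weight q j * g (node q j))"
      by (simp only: mult_ac)
    also have "\<dots> = \<bar>weight q j\<bar> * \<bar>g (node q j)\<bar>"
      by (simp only: abs_sgn[symmetric] abs_mult)
    finally show "weight q j * (f (node q j) * g (node q j)) = \<bar>weight q j\<bar> * \<bar>g (node q j)\<bar>" .
  qed simp
  then show ?thesis
    using that[of f] f(1,3) by (auto intro: continuous_on_subset)
qed

lemma PS_iff: "PS Q \<longleftrightarrow> (\<exists>M>0. \<forall>n\<ge>1. abs_quad (Q n) (\<lambda>_. 1) \<le> M)"
  by (auto simp: PS_def SUP_le_iff abs_quad_def)

lemma MZ12_iff: "MZ12 Q \<longleftrightarrow> (\<exists>C>0. \<forall>n\<ge>1. \<forall>p\<in>sphere_polys_upto n. abs_quad (Q n) p \<le> C * L2_norm p)"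
  by (simp add: MZ12_def abs_quad_def)

lemma QB_iff:
  "QB Q \<longleftrightarrow> (\<exists>M>0. \<forall>n\<ge>1. \<forall>f. continuous_on unit_sphere f \<longrightarrow>
      (\<forall>x\<in>unit_sphere. \<bar>f x\<bar> \<le> 1) \<longrightarrow> \<bar>quad (Q n) f\<bar> \<le> M)"
  proof -
  have "quad_norm q \<le> ereal M \<longleftrightarrow> (\<forall>f. continuous_on unit_sphere f \<longrightarrow>
      (\<forall>x\<in>unit_sphere. \<bar>f x\<bar> \<le> 1) \<longrightarrow> \<bar>quad q f\<bar> \<le> M)" for q M
    unfolding quad_norm_def SUP_le_iff ereal_less_eq mem_Collect_eq Ball_def
    by (simp only: sup_norm_le_iff[of _ 1] Ball_def imp_conjL cong: conj_cong)
  then show ?thesis by (simp only: QB_def SUP_le_iff Ball_def atLeast_iff)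
qed

lemma PS_iff_QB:
  assumes "quadrature_seq Q"
  shows "PS Q \<longleftrightarrow> QB Q"
proof -
  have "abs_quad (Q n) (\<lambda>_. 1) \<le> M \<longleftrightarrow> (\<forall>f. continuous_on unit_sphere f \<longrightarrow>
      (\<forall>x\<in>unit_sphere. \<bar>f x\<bar> \<le> 1) \<longrightarrow> \<bar>quad (Q n) f\<bar> \<le> M)" if "n \<ge> 1" for n M
  proof -
    have q: "is_quadrature (Q n)" using assms that by (simp add: quadrature_seq_def)
    obtain f where f: "continuous_on unit_sphere f" "\<And>x. \<bar>f x\<bar> \<le> 1"
        "quad (Q n) (\<lambda>x. f x * 1) = abs_quad (Q n) (\<lambda>_. 1)"
      using abs_quad_attained[OF q, of "\<lambda>_. 1"] by blast
    show ?thesis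
    proof (intro iffI allI impI)
      fix h :: "real^3 \<Rightarrow> real"
      assume "abs_quad (Q n) (\<lambda>_. 1) \<le> M" "\<forall>x\<in>unit_sphere. \<bar>h x\<bar> \<le> 1"
      then show "\<bar>quad (Q n) h\<bar> \<le> M" using quad_le_bound[OF q, of h 1] by simp
    next
      assume "\<forall>f. continuous_on unit_sphere f \<longrightarrow>
        (\<forall>x\<in>unit_sphere. \<bar>f x\<bar> \<le> 1) \<longrightarrow> \<bar>quad (Q n) f\<bar> \<le> M"
      then have "\<bar>quad (Q n) f\<bar> \<le> M" using f by blast
      then show "abs_quad (Q n) (\<lambda>_. 1) \<le> M" using f(3) by simp
    qed
  qed
  then show ?thesis by (simp add: PS_iff QB_iff)
qed

section \<open>Expansions in spherical harmonics\<close>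

text \<open>\<open>laplacian\<close> is built from \<open>deriv\<close>, whose linearity depends on
  differentiability. Hence the detour through polynomial Hessians, where it is the linearity of a
  trace.\<close>

lemma spherical_harmonics_add_cmult:
  assumes "f \<in> spherical_harmonics l" "g \<in> spherical_harmonics l"
  shows "(\<lambda>x. a * f x + g x) \<in> spherical_harmonics l"
proof -
  obtain p where p: "real_polynomial_function p" "\<And>c x. p (c *\<^sub>R x) = c ^ l * p x"
      "\<And>x. laplacian p x = 0" "\<And>x. x \<in> unit_sphere \<Longrightarrow> f x = p x"
    using assms(1) by (auto simp: spherical_harmonics_def)
  obtain q where q: "real_polynomial_function q" "\<And>c x. q (c *\<^sub>R x) = c ^ l * q x"
      "\<And>x. laplacian q x = 0" "\<And>x. x \<in> unit_sphere \<Longrightarrow> g x = q x"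
    using assms(2) by (auto simp: spherical_harmonics_def)
  obtain D DD where D: "\<And>i. real_polynomial_function (D i)"
      "\<And>x. (p has_derivative (\<lambda>h. \<Sum>i\<in>UNIV. h $ i * D i x)) (at x)"
    and DD: "\<And>i j. real_polynomial_function (DD i j)"
      "\<And>i x. (D i has_derivative (\<lambda>h. \<Sum>j\<in>UNIV. h $ j * DD i j x)) (at x)"
    using real_polynomial_function_hessian[OF p(1)] by blast
  obtain E EE where E: "\<And>i. real_polynomial_function (E i)"
      "\<And>x. (q has_derivative (\<lambda>h. \<Sum>i\<in>UNIV. h $ i * E i x)) (at x)"
    and EE: "\<And>i j. real_polynomial_function (EE i j)"
      "\<And>i x. (E i has_derivative (\<lambda>h. \<Sum>j\<in>UNIV. h $ j * EE i j x)) (at x)"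
    using real_polynomial_function_hessian[OF q(1)] by blast
  have lin: "((\<lambda>x. a * u x + v x) has_derivative (\<lambda>h. \<Sum>i\<in>UNIV. h $ i * (a * U i x + V i x))) (at x)"
    if "(u has_derivative (\<lambda>h. \<Sum>i\<in>UNIV. h $ i * U i x)) (at x)"
      "(v has_derivative (\<lambda>h. \<Sum>i\<in>UNIV. h $ i * V i x)) (at x)"
    for u v :: "real^3 \<Rightarrow> real" and U V and x
    by (rule has_derivative_eq_rhs[OF has_derivative_add[OF has_derivative_mult_right[OF that(1)] that(2)]])
      (auto simp: fun_eq_iff ring_distribs sum.distrib sum_distrib_left mult_ac)
  have "laplacian (\<lambda>x. a * p x + q x) x = (\<Sum>i\<in>UNIV. a * DD i i x + EE i i x)" for x
    by (rule laplacian_eq_sum[where D = "\<lambda>i x. a * D i x + E i x"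
          and E = "\<lambda>i j x. a * DD i j x + EE i j x"])
      (intro lin D(2) E(2) DD(2) EE(2))+
  then have "laplacian (\<lambda>x. a * p x + q x) x = a * laplacian p x + laplacian q x" for x
    using laplacian_eq_sum[of p D DD x, OF D(2) DD(2)] laplacian_eq_sum[of q E EE x, OF E(2) EE(2)]
    by (simp add: sum.distrib sum_distrib_left)
  then have "laplacian (\<lambda>x. a * p x + q x) x = 0" for x
    using p(3) q(3) by simp
  moreover have "real_polynomial_function (\<lambda>x. a * p x + q x)"
    using p(1) q(1) by (intro real_polynomial_function.intros(2-4))
  moreover have "a * p (c *\<^sub>R x) + q (c *\<^sub>R x) = c ^ l * (a * p x + q x)" for c x
    by (simp add: p(2) q(2) algebra_simps)
  ultimately show ?thesis
    using p(4) q(4) unfolding spherical_harmonics_def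
    by (intro CollectI exI[of _ "\<lambda>x. a * p x + q x"]) simp
qed

lemma zero_in_spherical_harmonics: "(\<lambda>_. 0) \<in> spherical_harmonics l"
proof -
  have "deriv (\<lambda>t::real. 0::real) = (\<lambda>_. 0)" by simp
  then have "laplacian (\<lambda>_::real^3. 0) x = 0" for x
    by (simp add: laplacian_def numeral_2_eq_2)
  then show ?thesis
    unfolding spherical_harmonics_def
    using real_polynomial_function.intros(2)[of 0] by (intro CollectI exI[of _ "\<lambda>_. 0"]) simp
qed

lemma spherical_harmonics_linear_combination:
  assumes "\<And>i. i \<in> I \<Longrightarrow> f i \<in> spherical_harmonics l"
  shows "(\<lambda>x. \<Sum>i\<in>I. c i * f i x) \<in> spherical_harmonics l"
  using assms
proof (induction I rule: infinite_finite_induct)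
  case (insert i I)
  then show ?case
    using spherical_harmonics_add_cmult[of "f i" l "\<lambda>x. \<Sum>i\<in>I. c i * f i x" "c i"] by simp
qed (auto simp: zero_in_spherical_harmonics)

lemma sphere_polys_upto_cong:
  "f \<in> sphere_polys_upto n \<Longrightarrow> (\<And>x. x \<in> unit_sphere \<Longrightarrow> g x = f x) \<Longrightarrow> g \<in> sphere_polys_upto n"
  by (auto simp: sphere_polys_upto_def)

lemma sphere_polys_upto_mono:
  assumes "m \<le> n" shows "sphere_polys_upto m \<subseteq> sphere_polys_upto n"
proof
  fix f assume "f \<in> sphere_polys_upto m"
  then obtain h where h: "\<And>l. l \<le> m \<Longrightarrow> h l \<in> spherical_harmonics l"
      "\<And>x. x \<in> unit_sphere \<Longrightarrow> f x = (\<Sum>l\<le>m. h l x)"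
    unfolding sphere_polys_upto_def by blast
  have "(\<Sum>l\<le>m. h l x) = (\<Sum>l\<le>n. (if l \<le> m then h l else (\<lambda>_. 0)) x)" for x
    using assms by (intro sum.mono_neutral_cong_left) auto
  then show "f \<in> sphere_polys_upto n"
    unfolding sphere_polys_upto_def using h
    by (intro CollectI exI[of _ "\<lambda>l. if l \<le> m then h l else (\<lambda>_. 0)"])
      (auto simp: zero_in_spherical_harmonics)
qed

lemma sphere_polys_upto_degree_le:
  assumes "f \<in> sphere_polys_upto n"
  shows "\<exists>p. degree_le n p \<and> (\<forall>x\<in>unit_sphere. f x = p x)"
proof -
  obtain h where h: "\<And>l. l \<le> n \<Longrightarrow> h l \<in> spherical_harmonics l"
      "\<And>x. x \<in> unit_sphere \<Longrightarrow> f x = (\<Sum>l\<le>n. h l x)"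
    using assms unfolding sphere_polys_upto_def by blast
  have "\<forall>l. \<exists>p. l \<le> n \<longrightarrow> degree_le l p \<and> (\<forall>x\<in>unit_sphere. h l x = p x)"
    using spherical_harmonics_degree_le[OF h(1)] by blast
  from choice[OF this] obtain p where
    p: "\<And>l. l \<le> n \<Longrightarrow> degree_le l (p l)" "\<And>l x. l \<le> n \<Longrightarrow> x \<in> unit_sphere \<Longrightarrow> h l x = p l x" by blast
  have "degree_le n (\<lambda>x. \<Sum>l\<le>n. p l x)"
    using p(1) by (intro degree_le_sum) (auto intro: degree_le_mono)
  moreover have "f x = (\<Sum>l\<le>n. p l x)" if "x \<in> unit_sphere" for x
    unfolding h(2)[OF that] using that by (intro sum.cong refl p(2)) auto
  ultimately show ?thesis by blast
qed

lemma continuous_on_sphere_polys_upto: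
  assumes "f \<in> sphere_polys_upto n" shows "continuous_on unit_sphere f"
proof -
  obtain p where p: "degree_le n p" "\<And>x. x \<in> unit_sphere \<Longrightarrow> f x = p x"
    using sphere_polys_upto_degree_le[OF assms] by blast
  show ?thesis
    using continuous_on_cong[THEN iffD2, OF refl p(2) continuous_on_degree_le[OF p(1)]] .
qed

lemma continuous_on_sphere_polys: "f \<in> sphere_polys \<Longrightarrow> continuous_on unit_sphere f"
  by (auto simp: sphere_polys_def intro: continuous_on_sphere_polys_upto)

lemma sum_fun_apply: "(\<Sum>i\<in>I. f i) x = (\<Sum>i\<in>I. f i x)"
  for f :: "'i \<Rightarrow> 'a \<Rightarrow> 'b::comm_monoid_add"
  by (induction I rule: infinite_finite_induct) auto

section \<open>Orthonormal expansions and the space of spherical polynomials\<close>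

locale harmonic_basis =
  fixes Y :: "nat \<Rightarrow> int \<Rightarrow> real^3 \<Rightarrow> real"
  assumes basis: "\<And>l. orthonormal_basis_of_harmonics l (Y l)"
begin

definition ix :: "nat \<Rightarrow> (nat \<times> int) set" where
  "ix n = (SIGMA l:{..n}. {- int l..int l})"

definition y :: "nat \<times> int \<Rightarrow> real^3 \<Rightarrow> real" where
  "y b = Y (fst b) (snd b)"

definition expansion :: "nat \<Rightarrow> (nat \<times> int \<Rightarrow> real) \<Rightarrow> real^3 \<Rightarrow> real" where
  "expansion n c x = (\<Sum>b\<in>ix n. c b * y b x)"

lemma finite_ix [simp]: "finite (ix n)"
  by (simp add: ix_def)

lemma ix_mono: "m \<le> n \<Longrightarrow> ix m \<subseteq> ix n"
  by (auto simp: ix_def)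

lemma card_ix: "card (ix n) = (n + 1)\<^sup>2"
proof -
  have "card (ix n) = (\<Sum>l\<le>n. card {- int l..int l})"
    unfolding ix_def by (rule card_SigmaI) auto
  also have "\<dots> = (\<Sum>l\<le>n. 2 * l + 1)" by (rule sum.cong) auto
  also have "\<dots> = (n + 1)\<^sup>2"
    by (induction n) (auto simp: power2_eq_square algebra_simps)
  finally show ?thesis .
qed

lemma y_in_spherical_harmonics: "b \<in> ix n \<Longrightarrow> y b \<in> spherical_harmonics (fst b)"
  using basis by (auto simp: orthonormal_basis_of_harmonics_def ix_def y_def)

lemma continuous_on_y: "b \<in> ix n \<Longrightarrow> continuous_on unit_sphere (y b)"
  by (rule continuous_on_spherical_harmonics[OF y_in_spherical_harmonics])

text \<open>Within one degree this is the hypothesis on the basis; across degrees it is the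
  orthogonality theorem for harmonics.\<close>

lemma y_orthonormal:
  assumes "b \<in> ix n" "c \<in> ix n"
  shows "sphere_integral (\<lambda>x. y b x * y c x) = (if b = c then 1 else 0)"
proof (cases "fst b = fst c")
  case True
  then have "snd b \<in> {- int (fst b)..int (fst b)}" "snd c \<in> {- int (fst b)..int (fst b)}"
    using assms by (auto simp: ix_def)
  then have "sphere_integral (\<lambda>x. Y (fst b) (snd b) x * Y (fst b) (snd c) x) = (if snd b = snd c then 1 else 0)"
    using basis[of "fst b"] unfolding orthonormal_basis_of_harmonics_def by blast
  then show ?thesis using True by (auto simp: y_def prod_eq_iff)
next
  case False
  then show ?thesis
    using spherical_harmonics_orthogonal[OF y_in_spherical_harmonics[OF assms(1)]
        y_in_spherical_harmonics[OF assms(2)]] by auto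
qed

lemma continuous_on_expansion: "continuous_on unit_sphere (expansion n c)"
  unfolding expansion_def by (intro continuous_intros continuous_on_y)

lemma integral_expansion_mult:
  assumes "continuous_on unit_sphere g"
  shows "sphere_integral (\<lambda>x. expansion n c x * g x) = (\<Sum>b\<in>ix n. c b * sphere_integral (\<lambda>x. y b x * g x))"
proof -
  have "sphere_integral (\<lambda>x. expansion n c x * g x)
      = sphere_integral (\<lambda>x. \<Sum>b\<in>ix n. c b * (y b x * g x))"
    by (simp add: expansion_def sum_distrib_right mult.assoc)
  also have "\<dots> = (\<Sum>b\<in>ix n. c b * sphere_integral (\<lambda>x. y b x * g x))"
    by (subst sphere_integral_sum)
      (auto simp: sphere_integral_cmult intro!: continuous_intros continuous_on_y assms)
  finally show ?thesis .
qed

lemma integral_y_expansion: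
  assumes "b \<in> ix n"
  shows "sphere_integral (\<lambda>x. y b x * expansion n c x) = c b"
proof -
  have "sphere_integral (\<lambda>x. y b x * expansion n c x) = (\<Sum>a\<in>ix n. c a * sphere_integral (\<lambda>x. y a x * y b x))"
    using integral_expansion_mult[OF continuous_on_y[OF assms]] by (simp add: mult.commute)
  also have "\<dots> = (\<Sum>a\<in>ix n. if a = b then c a else 0)"
    using assms by (intro sum.cong refl) (simp add: y_orthonormal)
  finally show ?thesis using assms by simp
qed

lemma integral_expansion_expansion:
  "sphere_integral (\<lambda>x. expansion n c x * expansion n d x) = (\<Sum>b\<in>ix n. c b * d b)"
  by (simp add: integral_expansion_mult[OF continuous_on_expansion] integral_y_expansion cong: sum.cong)

lemma L2_norm_expansion: "(L2_norm (expansion n c))\<^sup>2 = (\<Sum>b\<in>ix n. (c b)\<^sup>2)"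
  unfolding L2_norm_power2 using integral_expansion_expansion[of n c c] by (simp add: power2_eq_square)

lemma expansion_in_sphere_polys_upto: "expansion n c \<in> sphere_polys_upto n"
proof -
  have "(\<lambda>x. \<Sum>k=- int l..int l. c (l, k) * Y l k x) \<in> spherical_harmonics l" for l
    using basis by (intro spherical_harmonics_linear_combination)
      (auto simp: orthonormal_basis_of_harmonics_def)
  moreover have "expansion n c x = (\<Sum>l\<le>n. \<Sum>k=- int l..int l. c (l, k) * Y l k x)" for x
    by (simp add: expansion_def ix_def y_def sum.Sigma split_def)
  ultimately show ?thesis
    unfolding sphere_polys_upto_def
    by (intro CollectI exI[of _ "\<lambda>l x. \<Sum>k=- int l..int l. c (l, k) * Y l k x"]) auto
qed

lemma sphere_polys_upto_expansion:
  assumes "f \<in> sphere_polys_upto n"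
  obtains c where "\<And>x. x \<in> unit_sphere \<Longrightarrow> f x = expansion n c x"
proof -
  obtain h where h: "\<And>l. l \<le> n \<Longrightarrow> h l \<in> spherical_harmonics l"
      "\<And>x. x \<in> unit_sphere \<Longrightarrow> f x = (\<Sum>l\<le>n. h l x)"
    using assms unfolding sphere_polys_upto_def by blast
  have "\<forall>l. \<exists>c. l \<le> n \<longrightarrow> (\<forall>x\<in>unit_sphere. h l x = (\<Sum>k=- int l..int l. c k * Y l k x))"
    using basis h(1) unfolding orthonormal_basis_of_harmonics_def by blast
  from choice[OF this] obtain c where
    c: "\<And>l x. l \<le> n \<Longrightarrow> x \<in> unit_sphere \<Longrightarrow> h l x = (\<Sum>k=- int l..int l. c l k * Y l k x)" by blast
  show ?thesis
  proof (rule that)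
    fix x :: "real^3" assume x: "x \<in> unit_sphere"
    have "f x = (\<Sum>l\<le>n. \<Sum>k=- int l..int l. c l k * Y l k x)"
      unfolding h(2)[OF x] using x by (intro sum.cong refl c) auto
    then show "f x = expansion n (\<lambda>(l, k). c l k) x"
      by (simp add: expansion_def ix_def y_def sum.Sigma split_def)
  qed
qed

text \<open>The \<open>(n + 1)\<^sup>2\<close> independent functions \<open>y b\<close> lie in the span of at most \<open>(n + 1)\<^sup>2\<close>
  reduced monomials, so by Steinitz exchange the two families have the same span.\<close>

lemma degree_le_in_sphere_polys_upto:
  assumes "degree_le n f"
  shows "f \<in> sphere_polys_upto n"
proof -
  define r where "r b = restrict_to_sphere (y b)" for b
  define A where "A = r ` ix n"
  have r_eq: "r b x = y b x" if "x \<in> unit_sphere" for b x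
    using that by (simp add: r_def restrict_to_sphere_def)
  \<comment> \<open>Injectivity gives \<open>A\<close> its full cardinality
    \<open>(n + 1)^2\<close>: if two basis functions agreed on the sphere, the value 1 of a squared
    norm would equal the value 0 of an inner product.\<close>
  have inj: "inj_on r (ix n)"
  proof (rule inj_onI, rule ccontr)
    fix b c assume bc: "b \<in> ix n" "c \<in> ix n" "r b = r c" "b \<noteq> c"
    have "sphere_integral (\<lambda>x. y b x * y b x) = sphere_integral (\<lambda>x. y b x * y c x)"
      using r_eq bc(3) by (intro sphere_integral_cong) metis
    then show False using bc by (simp add: y_orthonormal)
  qed
  have finA: "finite A" by (simp add: A_def)
  have sumA: "(\<Sum>v\<in>A. (\<lambda>x. u v * v x)) x = expansion n (\<lambda>b. u (r b)) x" if "x \<in> unit_sphere" for u x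
    unfolding sum_fun_apply A_def expansion_def using that
    by (subst sum.reindex[OF inj]) (simp add: r_eq)
  \<comment> \<open>A vanishing combination has norm 0, and by Parseval's identity the squares of
    its coefficients sum to 0.\<close>
  have indep: "\<not> function_space.dependent A"
  proof (rule function_space.independent_if_scalars_zero[OF finA])
    fix u v assume u: "(\<Sum>v\<in>A. (\<lambda>x. u v * v x)) = 0" and v: "v \<in> A"
    have "(L2_norm (expansion n (\<lambda>b. u (r b))))\<^sup>2 = sphere_integral (\<lambda>_. 0)"
      unfolding L2_norm_power2 using sumA[of _ u] u by (intro sphere_integral_cong) simp
    then have "(\<Sum>b\<in>ix n. (u (r b))\<^sup>2) = 0" by (simp add: L2_norm_expansion)
    then show "u v = 0" using v by (auto simp: sum_nonneg_eq_0_iff A_def)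
  qed
  have "A \<subseteq> function_space.span (reduced_monomials n)"
  proof
    fix v assume "v \<in> A"
    then obtain b where b: "b \<in> ix n" "v = restrict_to_sphere (y b)" by (auto simp: A_def r_def)
    obtain p where p: "degree_le (fst b) p" "\<And>x. x \<in> unit_sphere \<Longrightarrow> y b x = p x"
      using spherical_harmonics_degree_le[OF y_in_spherical_harmonics[OF b(1)]] by blast
    have "v = restrict_to_sphere p" using p(2) b(2) by (auto simp: fun_eq_iff restrict_to_sphere_def)
    moreover have "degree_le n p" using p(1) b(1) by (auto simp: ix_def intro: degree_le_mono)
    ultimately show "v \<in> function_space.span (reduced_monomials n)"
      using degree_le_in_span_reduced_monomials by simp
  qed
  note A_span = this
  \<comment> \<open>Otherwise \<open>A\<close> could be enlarged to an independent set with more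
    members than there are reduced monomials spanning it.\<close>
  have "restrict_to_sphere f \<in> function_space.span A"
  proof (rule ccontr)
    let ?v = "restrict_to_sphere f"
    assume v: "?v \<notin> function_space.span A"
    then have "\<not> function_space.dependent (insert ?v A)"
      using indep by (rule function_space.independent_insertI)
    moreover have "insert ?v A \<subseteq> function_space.span (reduced_monomials n)"
      using A_span degree_le_in_span_reduced_monomials[OF assms] by simp
    ultimately have "card (insert ?v A) \<le> card (reduced_monomials n)"
      using function_space.independent_span_bound[of "reduced_monomials n"] finite_reduced_exponents by auto
    also have "\<dots> \<le> card (reduced_exponents n)"
      using finite_reduced_exponents by (rule card_image_le)
    also have "\<dots> \<le> card A"
      using card_reduced_exponents[of n] card_image[OF inj] by (simp add: A_def card_ix)
    finally have "card (insert ?v A) \<le> card A" .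
    moreover have "?v \<notin> A" using v function_space.span_base by blast
    ultimately show False using finA by simp
  qed
  then obtain u where u: "restrict_to_sphere f = (\<Sum>v\<in>A. (\<lambda>x. u v * v x))"
    unfolding function_space.span_finite[OF finA] by blast
  have "f x = expansion n (\<lambda>b. u (r b)) x" if "x \<in> unit_sphere" for x
    using sumA[OF that, of u] that unfolding u[symmetric] by (simp add: restrict_to_sphere_def)
  then show ?thesis
    by (rule sphere_polys_upto_cong[OF expansion_in_sphere_polys_upto])
qed

end

section \<open>Relations between the conditions\<close>

text \<open>The density argument in abstract form: \<open>e\<close> is the uniform distance from
  \<open>f\<close> to a spherical polynomial, \<open>C * e\<close> the error caused by that
  replacement, and \<open>b\<close> the error for the polynomial itself.\<close>

lemma tendsto_0_from_approximation:
  fixes a :: "nat \<Rightarrow> real"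
  assumes nonneg: "\<And>n. 0 \<le> a n" and "0 \<le> C"
    and approx: "\<And>e. e > 0 \<Longrightarrow> \<exists>b. b \<longlonglongrightarrow> 0 \<and> (\<forall>n\<ge>1. a n \<le> C * e + b n)"
  shows "a \<longlonglongrightarrow> 0"
proof (rule order_tendstoI)
  fix l :: real assume "l < 0"
  then have "l < a n" for n using nonneg[of n] by linarith
  then show "eventually (\<lambda>n. l < a n) sequentially" by simp
next
  fix u :: real assume "0 < u"
  \<comment> \<open>Half of \<open>u\<close> is reserved for \<open>b n\<close>; the summand 1 keeps
    the denominator positive when \<open>C = 0\<close>.\<close>
  define e where "e = u / (2 * (C + 1))"
  have e: "e > 0" "C * e < u / 2"
    using \<open>0 < u\<close> \<open>0 \<le> C\<close> by (auto simp: e_def field_simps)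
  obtain b where b: "b \<longlonglongrightarrow> 0" "\<And>n. n \<ge> 1 \<Longrightarrow> a n \<le> C * e + b n"
    using approx[OF e(1)] by blast
  have "eventually (\<lambda>n. b n < u / 2) sequentially"
    using order_tendstoD(2)[OF b(1)] half_gt_zero[OF \<open>0 < u\<close>] .
  then show "eventually (\<lambda>n. a n < u) sequentially"
    using eventually_ge_at_top[of 1]
  proof eventually_elim
    case (elim n)
    then show ?case using b(2)[of n] e(2) by simp
  qed
qed

context harmonic_basis
begin

text \<open>Degrees visibly add for polynomials on the space but not for sums of harmonics, so the
  product is formed there and brought back by the dimension count.\<close>

lemma sphere_polys_upto_mult:
  assumes "f \<in> sphere_polys_upto m" "g \<in> sphere_polys_upto n"
  shows "(\<lambda>x. f x * g x) \<in> sphere_polys_upto (m + n)"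
proof -
  obtain p where p: "degree_le m p" "\<And>x. x \<in> unit_sphere \<Longrightarrow> f x = p x"
    using sphere_polys_upto_degree_le[OF assms(1)] by blast
  obtain q where q: "degree_le n q" "\<And>x. x \<in> unit_sphere \<Longrightarrow> g x = q x"
    using sphere_polys_upto_degree_le[OF assms(2)] by blast
  show ?thesis
    by (rule sphere_polys_upto_cong[OF degree_le_in_sphere_polys_upto[OF degree_le.mult[OF p(1) q(1)]]])
      (simp only: p(2) q(2))
qed

lemma const_in_sphere_polys_upto: "(\<lambda>_. c) \<in> sphere_polys_upto n"
  by (rule degree_le_in_sphere_polys_upto[OF degree_le.const])

text \<open>Stone-Weierstrass yields a polynomial on the space, which the dimension count recognises
  as a spherical polynomial.\<close>

lemma sphere_polys_dense:
  assumes "continuous_on unit_sphere f" "e > 0"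
  obtains p where "p \<in> sphere_polys" "\<And>x. x \<in> unit_sphere \<Longrightarrow> \<bar>f x - p x\<bar> < e"
proof -
  obtain g where g: "real_polynomial_function g" "\<And>x. x \<in> unit_sphere \<Longrightarrow> \<bar>f x - g x\<bar> < e"
    using Stone_Weierstrass_real_polynomial_function[OF compact_sphere assms] by blast
  obtain n where "degree_le n g" using real_polynomial_function_degree_le[OF g(1)] by blast
  then have "g \<in> sphere_polys" using degree_le_in_sphere_polys_upto by (auto simp: sphere_polys_def)
  then show ?thesis using that g(2) by blast
qed

section \<open>Hyperinterpolation, its norm and the elementary implications\<close>

lemma hyperinterp_eq_expansion: "hyperinterp Y n q f = expansion n (\<lambda>b. quad q (\<lambda>z. f z * y b z))"
  by (rule ext) (simp add: hyperinterp_def expansion_def ix_def y_def sum.Sigma split_def)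

lemma hyperinterp_in_sphere_polys_upto: "hyperinterp Y n q f \<in> sphere_polys_upto n"
  unfolding hyperinterp_eq_expansion by (rule expansion_in_sphere_polys_upto)

lemma continuous_on_hyperinterp: "continuous_on unit_sphere (hyperinterp Y n q f)"
  unfolding hyperinterp_eq_expansion by (rule continuous_on_expansion)

lemma hyperinterp_add: "hyperinterp Y n q (\<lambda>x. f x + g x) = (\<lambda>x. hyperinterp Y n q f x + hyperinterp Y n q g x)"
  by (rule ext) (simp add: hyperinterp_eq_expansion expansion_def ring_distribs quad_add sum.distrib)

lemma hyperinterp_diff: "hyperinterp Y n q (\<lambda>x. f x - g x) = (\<lambda>x. hyperinterp Y n q f x - hyperinterp Y n q g x)"
  by (rule ext) (simp add: hyperinterp_eq_expansion expansion_def left_diff_distrib quad_diff sum_subtractf)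

lemma hyperinterp_cmult: "hyperinterp Y n q (\<lambda>x. c * f x) = (\<lambda>x. c * hyperinterp Y n q f x)"
  by (rule ext) (simp add: hyperinterp_eq_expansion expansion_def mult.assoc quad_cmult sum_distrib_left)

lemma quad_mult_expansion:
  "quad q (\<lambda>z. f z * expansion n c z) = (\<Sum>b\<in>ix n. c b * quad q (\<lambda>z. f z * y b z))"
proof -
  have "quad q (\<lambda>z. f z * expansion n c z) = quad q (\<lambda>z. \<Sum>b\<in>ix n. c b * (f z * y b z))"
    by (simp add: expansion_def sum_distrib_left mult_ac)
  then show ?thesis by (simp add: quad_sum quad_cmult)
qed

lemma integral_hyperinterp_mult_expansion:
  "sphere_integral (\<lambda>x. hyperinterp Y n q f x * expansion n c x) = quad q (\<lambda>z. f z * expansion n c z)"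
  by (simp add: hyperinterp_eq_expansion integral_expansion_expansion quad_mult_expansion mult.commute)

text \<open>The discrete analogue of orthogonal projection: the coefficients of
  \<open>hyperinterp\<close> are quadratures against the basis, so pairing with any polynomial of
  degree at most \<open>n\<close> is again a quadrature.\<close>

lemma integral_hyperinterp_mult:
  assumes "is_quadrature q" "p \<in> sphere_polys_upto n"
  shows "sphere_integral (\<lambda>x. hyperinterp Y n q f x * p x) = quad q (\<lambda>z. f z * p z)"
proof -
  obtain c where c: "\<And>x. x \<in> unit_sphere \<Longrightarrow> p x = expansion n c x"
    using sphere_polys_upto_expansion[OF assms(2)] by blast
  have "sphere_integral (\<lambda>x. hyperinterp Y n q f x * p x)
      = sphere_integral (\<lambda>x. hyperinterp Y n q f x * expansion n c x)"
    by (rule sphere_integral_cong) (simp only: c)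
  also have "\<dots> = quad q (\<lambda>z. f z * expansion n c z)" by (rule integral_hyperinterp_mult_expansion)
  also have "\<dots> = quad q (\<lambda>z. f z * p z)" by (rule quad_cong[OF assms(1)]) (simp only: c)
  finally show ?thesis .
qed

lemma L2_norm_hyperinterp_le:
  assumes q: "is_quadrature q" and mz: "\<And>p. p \<in> sphere_polys_upto n \<Longrightarrow> abs_quad q p \<le> C * L2_norm p"
    and f: "\<And>x. x \<in> unit_sphere \<Longrightarrow> \<bar>f x\<bar> \<le> M" and "0 \<le> C" "0 \<le> M"
  shows "L2_norm (hyperinterp Y n q f) \<le> C * M"
proof -
  let ?h = "hyperinterp Y n q f"
  have h: "?h \<in> sphere_polys_upto n" by (rule hyperinterp_in_sphere_polys_upto)
  have "(L2_norm ?h)\<^sup>2 = quad q (\<lambda>z. f z * ?h z)"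
    unfolding L2_norm_power2 using integral_hyperinterp_mult[OF q h, of f] by (simp add: power2_eq_square)
  also have "\<dots> \<le> abs_quad q (\<lambda>z. f z * ?h z)" using quad_le_abs_quad abs_le_D1 by blast
  also have "\<dots> \<le> M * abs_quad q ?h" by (rule abs_quad_mult_le[OF q f])
  also have "\<dots> \<le> M * (C * L2_norm ?h)" using mz[OF h] \<open>0 \<le> M\<close> by (rule mult_left_mono)
  finally have "L2_norm ?h * L2_norm ?h \<le> (C * M) * L2_norm ?h" by (simp add: power2_eq_square mult_ac)
  then show ?thesis using \<open>0 \<le> C\<close> \<open>0 \<le> M\<close> L2_norm_nonneg[of ?h]
    by (cases "L2_norm ?h = 0") (auto simp: mult_le_cancel_right)
qed

lemma abs_quad_le_hyperinterp:
  assumes q: "is_quadrature q" and p: "p \<in> sphere_polys_upto n"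
    and L: "\<And>f. continuous_on unit_sphere f \<Longrightarrow> (\<And>x. x \<in> unit_sphere \<Longrightarrow> \<bar>f x\<bar> \<le> 1) \<Longrightarrow>
              L2_norm (hyperinterp Y n q f) \<le> C"
  shows "abs_quad q p \<le> C * L2_norm p"
proof -
  obtain f where f: "continuous_on unit_sphere f" "\<And>x. \<bar>f x\<bar> \<le> 1"
    "quad q (\<lambda>x. f x * p x) = abs_quad q p"
    using abs_quad_attained[OF q, of p] by blast
  have "abs_quad q p = sphere_integral (\<lambda>x. hyperinterp Y n q f x * p x)"
    unfolding integral_hyperinterp_mult[OF q p] f(3) ..
  also have "\<dots> \<le> L2_norm (hyperinterp Y n q f) * L2_norm p"
    using sphere_integral_abs_le_L2_norm[OF continuous_on_hyperinterp continuous_on_sphere_polys_upto[OF p]]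
      abs_le_D1 by blast
  also have "\<dots> \<le> C * L2_norm p"
    by (rule mult_right_mono[OF L[OF f(1)]]) (use f(2) in auto)
  finally show ?thesis .
qed

lemma LB_iff:
  "LB Y Q \<longleftrightarrow> (\<exists>C>0. \<forall>n\<ge>1. \<forall>f. continuous_on unit_sphere f \<longrightarrow>
      (\<forall>x\<in>unit_sphere. \<bar>f x\<bar> \<le> 1) \<longrightarrow> L2_norm (hyperinterp Y n (Q n) f) \<le> C)"
proof -
  have "hyperinterp_norm Y n q \<le> ereal M \<longleftrightarrow> (\<forall>f. continuous_on unit_sphere f \<longrightarrow>
      (\<forall>x\<in>unit_sphere. \<bar>f x\<bar> \<le> 1) \<longrightarrow> L2_norm (hyperinterp Y n q f) \<le> M)" for n q M
    unfolding hyperinterp_norm_def SUP_le_iff ereal_less_eq mem_Collect_eq Ball_def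
    by (simp only: sup_norm_le_iff[of _ 1] Ball_def imp_conjL cong: conj_cong)
  then show ?thesis by (simp only: LB_def SUP_le_iff Ball_def atLeast_iff)
qed

lemma MZ12_iff_LB:
  assumes "quadrature_seq Q"
  shows "MZ12 Q \<longleftrightarrow> LB Y Q"
proof
  assume "MZ12 Q"
  then obtain C where C: "C > 0" "\<And>n p. n \<ge> 1 \<Longrightarrow> p \<in> sphere_polys_upto n \<Longrightarrow> abs_quad (Q n) p \<le> C * L2_norm p"
    unfolding MZ12_iff by blast
  have "L2_norm (hyperinterp Y n (Q n) f) \<le> C" if "n \<ge> 1" "\<forall>x\<in>unit_sphere. \<bar>f x\<bar> \<le> 1" for n f
    using L2_norm_hyperinterp_le[of "Q n" n C f 1] C that assms by (simp add: quadrature_seq_def)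
  then show "LB Y Q" unfolding LB_iff using C(1) by blast
next
  assume "LB Y Q"
  then obtain C where C: "C > 0" "\<And>n f. n \<ge> 1 \<Longrightarrow> continuous_on unit_sphere f \<Longrightarrow>
      (\<forall>x\<in>unit_sphere. \<bar>f x\<bar> \<le> 1) \<Longrightarrow> L2_norm (hyperinterp Y n (Q n) f) \<le> C"
    unfolding LB_iff by blast
  have "abs_quad (Q n) p \<le> C * L2_norm p" if "n \<ge> 1" "p \<in> sphere_polys_upto n" for n p
    by (rule abs_quad_le_hyperinterp[OF _ that(2)]) (use assms that(1) C(2) in \<open>auto simp: quadrature_seq_def\<close>)
  then show "MZ12 Q" unfolding MZ12_iff using C(1) by blast
qed

lemma quad_error_le:
  assumes q: "is_quadrature q" and f: "continuous_on unit_sphere f"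
  shows "\<bar>quad q f - sphere_integral f\<bar> \<le> L2_norm (\<lambda>x. hyperinterp Y n q f x - f x) * sqrt (4 * pi)"
proof -
  have "sphere_integral (\<lambda>x. hyperinterp Y n q f x * 1) = quad q (\<lambda>z. f z * 1)"
    by (rule integral_hyperinterp_mult[OF q const_in_sphere_polys_upto])
  then have "quad q f - sphere_integral f = sphere_integral (\<lambda>x. (hyperinterp Y n q f x - f x) * 1)"
    by (simp add: sphere_integral_diff[OF continuous_on_hyperinterp f])
  also have "\<bar>\<dots>\<bar> \<le> L2_norm (\<lambda>x. hyperinterp Y n q f x - f x) * L2_norm (\<lambda>_. 1)"
    by (intro sphere_integral_abs_le_L2_norm continuous_intros continuous_on_hyperinterp f)
  finally show ?thesis by (simp only: L2_norm_one)
qed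

lemma quad_error_tendsto:
  assumes Q: "quadrature_seq Q" and f: "continuous_on unit_sphere f"
    and lim: "(\<lambda>n. L2_norm (\<lambda>x. hyperinterp Y n (Q n) f x - f x)) \<longlonglongrightarrow> 0"
  shows "(\<lambda>n. \<bar>quad (Q n) f - sphere_integral f\<bar>) \<longlonglongrightarrow> 0"
proof (rule tendsto_sandwich[OF _ _ tendsto_const])
  show "(\<lambda>n. L2_norm (\<lambda>x. hyperinterp Y n (Q n) f x - f x) * sqrt (4 * pi)) \<longlonglongrightarrow> 0"
    using tendsto_mult_right[OF lim] by simp
  show "eventually (\<lambda>n. \<bar>quad (Q n) f - sphere_integral f\<bar>
      \<le> L2_norm (\<lambda>x. hyperinterp Y n (Q n) f x - f x) * sqrt (4 * pi)) sequentially"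
    using eventually_ge_at_top[of 1]
  proof eventually_elim
    case (elim n)
    then show ?case using Q f by (intro quad_error_le) (auto simp: quadrature_seq_def)
  qed
qed simp

lemma HC_imp_QC: "quadrature_seq Q \<Longrightarrow> HC Y Q \<Longrightarrow> QC Q"
  unfolding HC_def QC_def using quad_error_tendsto by blast

lemma FAP_imp_AP: "quadrature_seq Q \<Longrightarrow> FAP Y Q \<Longrightarrow> AP Q"
  unfolding FAP_def AP_def using quad_error_tendsto continuous_on_sphere_polys by blast

lemma HC_imp_FAP: "HC Y Q \<Longrightarrow> FAP Y Q"
  unfolding HC_def FAP_def using continuous_on_sphere_polys by blast

lemma QC_imp_AP: "QC Q \<Longrightarrow> AP Q"
  unfolding QC_def AP_def using continuous_on_sphere_polys by blast

text \<open>The constant 1 is an admissible test polynomial in every degree, with norm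
  \<open>sqrt (4 * pi)\<close>.\<close>

lemma MZ12_imp_PS:
  assumes "MZ12 Q" shows "PS Q"
proof -
  obtain C where C: "C > 0" "\<And>n p. n \<ge> 1 \<Longrightarrow> p \<in> sphere_polys_upto n \<Longrightarrow> abs_quad (Q n) p \<le> C * L2_norm p"
    using assms unfolding MZ12_iff by blast
  have "abs_quad (Q n) (\<lambda>_. 1) \<le> C * sqrt (4 * pi)" if "n \<ge> 1" for n
    using C(2)[OF that const_in_sphere_polys_upto[of 1]] by (simp only: L2_norm_one)
  moreover have "C * sqrt (4 * pi) > 0" using C(1) by simp
  ultimately show ?thesis unfolding PS_iff by blast
qed

text \<open>By Cauchy-Schwarz against the constant 1, the \<open>L1_norm\<close> is at most
  \<open>sqrt (4 * pi)\<close> times the \<open>L2_norm\<close>.\<close>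

lemma MZ1_imp_MZ12:
  assumes "MZ1 Q" shows "MZ12 Q"
proof -
  obtain c where c: "c > 0" "\<And>n p. n \<ge> 1 \<Longrightarrow> p \<in> sphere_polys_upto n \<Longrightarrow> abs_quad (Q n) p \<le> c * L1_norm p"
    using assms unfolding MZ1_def abs_quad_def by blast
  have "abs_quad (Q n) p \<le> (c * sqrt (4 * pi)) * L2_norm p" if "n \<ge> 1" "p \<in> sphere_polys_upto n" for n p
  proof -
    have cont: "continuous_on unit_sphere (\<lambda>x. \<bar>p x\<bar>)"
      by (intro continuous_intros continuous_on_sphere_polys_upto[OF that(2)])
    have "L1_norm p = sphere_integral (\<lambda>x. \<bar>p x\<bar> * 1)" by (simp add: L1_norm_def)
    also have "\<dots> \<le> L2_norm (\<lambda>x. \<bar>p x\<bar>) * L2_norm (\<lambda>_. 1)"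
      using sphere_integral_abs_le_L2_norm[OF cont continuous_on_const] abs_le_D1 by blast
    also have "L2_norm (\<lambda>x. \<bar>p x\<bar>) = L2_norm p" by (simp add: L2_norm_def)
    finally have "c * L1_norm p \<le> c * (L2_norm p * sqrt (4 * pi))"
      using c(1) by (simp add: L2_norm_one)
    then show ?thesis using c(2)[OF that] by (simp add: mult_ac)
  qed
  moreover have "c * sqrt (4 * pi) > 0" using c(1) by simp
  ultimately show ?thesis unfolding MZ12_iff by blast
qed

text \<open>Cauchy-Schwarz for the weighted sum, with each weight split into two square roots. The
  total weight that appears is bounded by (MZ2) for the constant 1.\<close>

lemma MZ2_imp_MZ12:
  assumes "MZ2 Q" shows "MZ12 Q"
proof -
  obtain c where c: "c > 0" "\<And>n p. n \<ge> 1 \<Longrightarrow> p \<in> sphere_polys_upto n \<Longrightarrow>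
      (\<Sum>j=1..num_nodes (Q n). \<bar>weight (Q n) j\<bar> * \<bar>p (node (Q n) j)\<bar>\<^sup>2) \<le> c * (L2_norm p)\<^sup>2"
    using assms unfolding MZ2_def by blast
  have "abs_quad (Q n) p \<le> (c * sqrt (4 * pi)) * L2_norm p" if n: "n \<ge> 1" and p: "p \<in> sphere_polys_upto n" for n p
  proof (rule power2_le_imp_le)
    let ?J = "{1..num_nodes (Q n)}" and ?w = "\<lambda>j. sqrt \<bar>weight (Q n) j\<bar>"
    let ?p = "\<lambda>j. \<bar>p (node (Q n) j)\<bar>"
    have "(\<Sum>j\<in>?J. \<bar>weight (Q n) j\<bar>) \<le> c * (4 * pi)"
      using c(2)[OF n const_in_sphere_polys_upto[of 1]] by (simp add: L2_norm_one)
    moreover have "(\<Sum>j\<in>?J. \<bar>weight (Q n) j\<bar> * (?p j)\<^sup>2) \<le> c * (L2_norm p)\<^sup>2" by (rule c(2)[OF n p])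
    moreover have "(abs_quad (Q n) p)\<^sup>2 = (\<Sum>j\<in>?J. ?w j * (?w j * ?p j))\<^sup>2"
      by (simp add: abs_quad_def mult.assoc[symmetric])
    moreover have "\<dots> \<le> (\<Sum>j\<in>?J. (?w j)\<^sup>2) * (\<Sum>j\<in>?J. (?w j * ?p j)\<^sup>2)"
      by (rule Cauchy_Schwarz_ineq_sum)
    moreover have "\<dots> = (\<Sum>j\<in>?J. \<bar>weight (Q n) j\<bar>) * (\<Sum>j\<in>?J. \<bar>weight (Q n) j\<bar> * (?p j)\<^sup>2)"
      by (simp add: power_mult_distrib)
    moreover have "\<dots> \<le> (c * (4 * pi)) * (c * (L2_norm p)\<^sup>2)"
      using calculation(1,2) c(1) by (intro mult_mono) (auto intro: sum_nonneg)
    ultimately have "(abs_quad (Q n) p)\<^sup>2 \<le> (c * (4 * pi)) * (c * (L2_norm p)\<^sup>2)" by linarith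
    then show "(abs_quad (Q n) p)\<^sup>2 \<le> ((c * sqrt (4 * pi)) * L2_norm p)\<^sup>2"
      by (simp add: power_mult_distrib power2_eq_square mult_ac)
    show "0 \<le> (c * sqrt (4 * pi)) * L2_norm p" using c(1) by simp
  qed
  moreover have "c * sqrt (4 * pi) > 0" using c(1) by simp
  ultimately show ?thesis unfolding MZ12_iff by blast
qed

section \<open>Necessity by uniform boundedness, sufficiency by density\<close>

lemma HC_imp_LB:
  assumes Q: "quadrature_seq Q" and HC: "HC Y Q"
  shows "LB Y Q"
proof -
  \<comment> \<open>The shift to \<open>Suc n\<close> matters: \<open>quadrature_seq\<close> says
    nothing about \<open>Q 0\<close>, while the uniform boundedness principle treats all
    indices.\<close>
  define T where "T n f = L2_norm (hyperinterp Y (Suc n) (Q (Suc n)) f)" for n f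
  have q: "is_quadrature (Q (Suc n))" for n using Q by (simp add: quadrature_seq_def)
  have "\<exists>C>0. \<forall>n f. continuous_on unit_sphere f \<longrightarrow> (\<forall>x\<in>unit_sphere. \<bar>f x\<bar> \<le> 1) \<longrightarrow> T n f \<le> C"
  proof (rule uniform_boundedness_sphere)
    show "T n (\<lambda>x. f x + g x) \<le> T n f + T n g" for n f g
      unfolding T_def hyperinterp_add by (intro L2_norm_triangle continuous_on_hyperinterp)
    show "T n (\<lambda>x. c * f x) = \<bar>c\<bar> * T n f" for n c f
      unfolding T_def hyperinterp_cmult by (rule L2_norm_cmult)
    show "T n f = T n g" if "\<And>x. x \<in> unit_sphere \<Longrightarrow> f x = g x" for n f g
    proof -
      have "quad (Q (Suc n)) (\<lambda>z. f z * y b z) = quad (Q (Suc n)) (\<lambda>z. g z * y b z)" for b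
        by (rule quad_cong[OF q]) (simp only: that)
      then show ?thesis by (simp add: T_def hyperinterp_eq_expansion)
    qed
    \<comment> \<open>For a fixed index a crude constant suffices: the Euclidean norm of the
      coefficients is at most the sum of their absolute values.\<close>
    show "\<exists>B. \<forall>f M. continuous_on unit_sphere f \<longrightarrow> (\<forall>x\<in>unit_sphere. \<bar>f x\<bar> \<le> M) \<longrightarrow> T n f \<le> B * M" for n
    proof (intro exI allI impI)
      fix f :: "real^3 \<Rightarrow> real" and M assume f: "\<forall>x\<in>unit_sphere. \<bar>f x\<bar> \<le> M"
      let ?a = "\<lambda>b. quad (Q (Suc n)) (\<lambda>z. f z * y b z)"
      have "T n f = L2_set ?a (ix (Suc n))"
        unfolding T_def L2_set_def hyperinterp_eq_expansion
        by (rule real_sqrt_unique[symmetric]) (simp_all add: L2_norm_expansion)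
      also have "\<dots> \<le> (\<Sum>b\<in>ix (Suc n). \<bar>?a b\<bar>)" by (rule L2_set_le_sum_abs)
      also have "\<dots> \<le> (\<Sum>b\<in>ix (Suc n). M * abs_quad (Q (Suc n)) (y b))"
        using f by (intro sum_mono order_trans[OF quad_le_abs_quad] abs_quad_mult_le[OF q]) auto
      finally show "T n f \<le> (\<Sum>b\<in>ix (Suc n). abs_quad (Q (Suc n)) (y b)) * M"
        by (simp add: sum_distrib_left mult.commute)
    qed
    show "\<exists>B. \<forall>n. T n f \<le> B" if f: "continuous_on unit_sphere f" for f
    proof -
      have "(\<lambda>n. L2_norm (\<lambda>x. hyperinterp Y n (Q n) f x - f x)) \<longlonglongrightarrow> 0"
        using HC f by (simp add: HC_def)
      then have "Bseq (\<lambda>n. L2_norm (\<lambda>x. hyperinterp Y n (Q n) f x - f x))"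
        by (intro convergent_imp_Bseq convergentI)
      then obtain K where K: "\<And>n. \<bar>L2_norm (\<lambda>x. hyperinterp Y n (Q n) f x - f x)\<bar> \<le> K"
        by (auto simp: Bseq_def)
      have "T n f \<le> K + L2_norm f" for n
      proof -
        have "T n f = L2_norm (\<lambda>x. (hyperinterp Y (Suc n) (Q (Suc n)) f x - f x) + f x)"
          by (simp add: T_def)
        also have "\<dots> \<le> L2_norm (\<lambda>x. hyperinterp Y (Suc n) (Q (Suc n)) f x - f x) + L2_norm f"
          by (intro L2_norm_triangle continuous_intros continuous_on_hyperinterp f)
        finally show ?thesis using K[of "Suc n"] by simp
      qed
      then show ?thesis by blast
    qed
  qed
  then obtain C where C: "C > 0" "\<And>n f. continuous_on unit_sphere f \<Longrightarrow> (\<forall>x\<in>unit_sphere. \<bar>f x\<bar> \<le> 1) \<Longrightarrow> T n f \<le> C"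
    by blast
  have "L2_norm (hyperinterp Y n (Q n) f) \<le> C"
    if "n \<ge> 1" "continuous_on unit_sphere f" "\<forall>x\<in>unit_sphere. \<bar>f x\<bar> \<le> 1" for n f
    using C(2)[OF that(2,3), of "n - 1"] that(1) by (simp add: T_def)
  then show ?thesis unfolding LB_iff using C(1) by blast
qed

lemma QC_imp_QB:
  assumes Q: "quadrature_seq Q" and QC: "QC Q"
  shows "QB Q"
proof -
  define T where "T n f = \<bar>quad (Q (Suc n)) f\<bar>" for n f
  have q: "is_quadrature (Q (Suc n))" for n using Q by (simp add: quadrature_seq_def)
  have "\<exists>C>0. \<forall>n f. continuous_on unit_sphere f \<longrightarrow> (\<forall>x\<in>unit_sphere. \<bar>f x\<bar> \<le> 1) \<longrightarrow> T n f \<le> C"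
  proof (rule uniform_boundedness_sphere)
    show "T n (\<lambda>x. f x + g x) \<le> T n f + T n g" for n f g
      by (simp add: T_def quad_add)
    show "T n (\<lambda>x. c * f x) = \<bar>c\<bar> * T n f" for n c f
      by (simp add: T_def quad_cmult abs_mult)
    show "T n f = T n g" if "\<And>x. x \<in> unit_sphere \<Longrightarrow> f x = g x" for n f g
      unfolding T_def using quad_cong[OF q that] by simp
    show "\<exists>B. \<forall>f M. continuous_on unit_sphere f \<longrightarrow> (\<forall>x\<in>unit_sphere. \<bar>f x\<bar> \<le> M) \<longrightarrow> T n f \<le> B * M" for n
    proof (intro exI allI impI)
      fix f :: "real^3 \<Rightarrow> real" and M assume "\<forall>x\<in>unit_sphere. \<bar>f x\<bar> \<le> M"
      then show "T n f \<le> abs_quad (Q (Suc n)) (\<lambda>_. 1) * M"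
        using quad_le_bound[OF q, of f M n] by (simp add: T_def mult.commute)
    qed
    show "\<exists>B. \<forall>n. T n f \<le> B" if f: "continuous_on unit_sphere f" for f
    proof -
      have "(\<lambda>n. \<bar>quad (Q n) f - sphere_integral f\<bar>) \<longlonglongrightarrow> 0"
        using QC f by (simp add: QC_def)
      then have "Bseq (\<lambda>n. \<bar>quad (Q n) f - sphere_integral f\<bar>)"
        by (intro convergent_imp_Bseq convergentI)
      then obtain K where K: "\<And>n. \<bar>quad (Q n) f - sphere_integral f\<bar> \<le> K"
        by (auto simp: Bseq_def)
      have "T n f \<le> K + \<bar>sphere_integral f\<bar>" for n
        using K[of "Suc n"] by (simp add: T_def)
      then show ?thesis by blast
    qed
  qed
  then obtain C where C: "C > 0" "\<And>n f. continuous_on unit_sphere f \<Longrightarrow> (\<forall>x\<in>unit_sphere. \<bar>f x\<bar> \<le> 1) \<Longrightarrow> T n f \<le> C"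
    by blast
  have "\<bar>quad (Q n) f\<bar> \<le> C"
    if "n \<ge> 1" "continuous_on unit_sphere f" "\<forall>x\<in>unit_sphere. \<bar>f x\<bar> \<le> 1" for n f
    using C(2)[OF that(2,3), of "n - 1"] that(1) by (simp add: T_def)
  then show ?thesis unfolding QB_iff using C(1) by blast
qed

text \<open>For \<open>p\<close> within \<open>e\<close> of \<open>f\<close>, the error of
  \<open>f\<close> splits into \<open>L_n (f - p)\<close>, minus \<open>f - p\<close>, plus the
  error of \<open>p\<close>. The first two have norms at most \<open>C * e\<close> and
  \<open>sqrt (4 * pi) * e\<close>, uniformly in \<open>n\<close>; (FAP) handles the third.\<close>

lemma FAP_MZ12_imp_HC:
  assumes Q: "quadrature_seq Q" and FAP: "FAP Y Q" and MZ12: "MZ12 Q"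
  shows "HC Y Q"
  unfolding HC_def
proof (intro allI impI)
  fix f :: "real^3 \<Rightarrow> real" assume f: "continuous_on unit_sphere f"
  obtain C where C: "C > 0" "\<And>n p. n \<ge> 1 \<Longrightarrow> p \<in> sphere_polys_upto n \<Longrightarrow> abs_quad (Q n) p \<le> C * L2_norm p"
    using MZ12 unfolding MZ12_iff by blast
  show "(\<lambda>n. L2_norm (\<lambda>x. hyperinterp Y n (Q n) f x - f x)) \<longlonglongrightarrow> 0"
  proof (rule tendsto_0_from_approximation[where C = "C + sqrt (4 * pi)"])
    fix e :: real assume "e > 0"
    obtain p where p: "p \<in> sphere_polys" "\<And>x. x \<in> unit_sphere \<Longrightarrow> \<bar>f x - p x\<bar> < e"
      using sphere_polys_dense[OF f \<open>e > 0\<close>] by blast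
    note cp = continuous_on_sphere_polys[OF p(1)]
    have "L2_norm (\<lambda>x. hyperinterp Y n (Q n) f x - f x)
        \<le> (C + sqrt (4 * pi)) * e + L2_norm (\<lambda>x. hyperinterp Y n (Q n) p x - p x)" if "n \<ge> 1" for n
    proof -
      let ?d = "\<lambda>x. f x - p x"
      have "L2_norm (\<lambda>x. hyperinterp Y n (Q n) f x - f x)
        = L2_norm (\<lambda>x. hyperinterp Y n (Q n) ?d x + ((- 1) * ?d x + (hyperinterp Y n (Q n) p x - p x)))"
        unfolding hyperinterp_diff by (rule L2_norm_cong) simp
      also have "\<dots> \<le> L2_norm (hyperinterp Y n (Q n) ?d)
          + L2_norm (\<lambda>x. (- 1) * ?d x + (hyperinterp Y n (Q n) p x - p x))"
        by (intro L2_norm_triangle continuous_intros continuous_on_hyperinterp f cp)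
      also have "L2_norm (\<lambda>x. (- 1) * ?d x + (hyperinterp Y n (Q n) p x - p x))
          \<le> L2_norm (\<lambda>x. (- 1) * ?d x) + L2_norm (\<lambda>x. hyperinterp Y n (Q n) p x - p x)"
        by (intro L2_norm_triangle continuous_intros continuous_on_hyperinterp f cp)
      also have "L2_norm (\<lambda>x. (- 1) * ?d x) = L2_norm ?d"
        using L2_norm_cmult[of "- 1" ?d] by simp
      also have "L2_norm ?d \<le> sqrt (4 * pi) * e"
        by (intro L2_norm_le_bound continuous_intros f cp less_imp_le p(2))
      also have "L2_norm (hyperinterp Y n (Q n) ?d) \<le> C * e"
        by (rule L2_norm_hyperinterp_le)
          (use Q that C p(2) \<open>e > 0\<close> in \<open>auto simp: quadrature_seq_def less_imp_le\<close>)
      finally show ?thesis by (simp add: algebra_simps)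
    qed
    moreover have "(\<lambda>n. L2_norm (\<lambda>x. hyperinterp Y n (Q n) p x - p x)) \<longlonglongrightarrow> 0"
      using FAP p(1) by (simp add: FAP_def)
    ultimately show "\<exists>b. b \<longlonglongrightarrow> 0 \<and> (\<forall>n\<ge>1. L2_norm (\<lambda>x. hyperinterp Y n (Q n) f x - f x)
        \<le> (C + sqrt (4 * pi)) * e + b n)" by blast
  qed (use C(1) in auto)
qed

text \<open>Replacing \<open>f\<close> by a polynomial within \<open>e\<close> changes the
  quadrature by at most \<open>M * e\<close> and the integral by at most \<open>4 * pi * e\<close>,
  both independent of \<open>n\<close>.\<close>

lemma AP_PS_imp_QC:
  assumes Q: "quadrature_seq Q" and AP: "AP Q" and PS: "PS Q"
  shows "QC Q"
  unfolding QC_def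
proof (intro allI impI)
  fix f :: "real^3 \<Rightarrow> real" assume f: "continuous_on unit_sphere f"
  obtain M where M: "M > 0" "\<And>n. n \<ge> 1 \<Longrightarrow> abs_quad (Q n) (\<lambda>_. 1) \<le> M"
    using PS unfolding PS_iff by blast
  show "(\<lambda>n. \<bar>quad (Q n) f - sphere_integral f\<bar>) \<longlonglongrightarrow> 0"
  proof (rule tendsto_0_from_approximation[where C = "M + 4 * pi"])
    fix e :: real assume "e > 0"
    obtain p where p: "p \<in> sphere_polys" "\<And>x. x \<in> unit_sphere \<Longrightarrow> \<bar>f x - p x\<bar> < e"
      using sphere_polys_dense[OF f \<open>e > 0\<close>] by blast
    note cp = continuous_on_sphere_polys[OF p(1)]
    have int: "\<bar>sphere_integral f - sphere_integral p\<bar> \<le> 4 * pi * e"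
    proof -
      have "sphere_integral (\<lambda>x. f x - p x) \<le> sphere_integral (\<lambda>_. e)"
        "sphere_integral (\<lambda>_. - e) \<le> sphere_integral (\<lambda>x. f x - p x)"
        using p(2) by (intro sphere_integral_mono continuous_intros f cp; fastforce simp: abs_less_iff)+
      then show ?thesis by (simp add: sphere_integral_diff f cp abs_le_iff)
    qed
    have "\<bar>quad (Q n) f - sphere_integral f\<bar>
        \<le> (M + 4 * pi) * e + \<bar>quad (Q n) p - sphere_integral p\<bar>" if "n \<ge> 1" for n
    proof -
      have "\<bar>quad (Q n) (\<lambda>x. f x - p x)\<bar> \<le> e * abs_quad (Q n) (\<lambda>_. 1)"
        by (rule quad_le_bound) (use Q that p(2) in \<open>auto simp: quadrature_seq_def less_imp_le\<close>)
      also have "\<dots> \<le> e * M" using M(2)[OF that] \<open>e > 0\<close> by simp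
      finally have "\<bar>quad (Q n) f - quad (Q n) p\<bar> \<le> e * M" by (simp add: quad_diff)
      then show ?thesis using int by (simp add: algebra_simps)
    qed
    moreover have "(\<lambda>n. \<bar>quad (Q n) p - sphere_integral p\<bar>) \<longlonglongrightarrow> 0"
      using AP p(1) by (simp add: AP_def)
    ultimately show "\<exists>b. b \<longlonglongrightarrow> 0 \<and> (\<forall>n\<ge>1. \<bar>quad (Q n) f - sphere_integral f\<bar>
        \<le> (M + 4 * pi) * e + b n)" by blast
  qed (use M(1) in auto)
qed

end

section \<open>Counterexamples\<close>

text \<open>Rules can be constructed as weighted finite sets of points; a bijective enumeration then
  guarantees distinct nodes.\<close>

lemma quadrature_of_finite_set:
  fixes w :: "real^3 \<Rightarrow> real"
  assumes "finite S" "S \<noteq> {}" "S \<subseteq> unit_sphere"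
  shows "\<exists>q. is_quadrature q \<and> (\<forall>f. quad q f = (\<Sum>x\<in>S. w x * f x)) \<and>
             (\<forall>f. abs_quad q f = (\<Sum>x\<in>S. \<bar>w x\<bar> * \<bar>f x\<bar>))"
proof -
  obtain h where h: "bij_betw h {1..card S} S"
    using ex_bij_betw_nat_finite_1[OF \<open>finite S\<close>] by blast
  define q where "q = \<lparr>num_nodes = card S, weight = (\<lambda>j. w (h j)), node = h\<rparr>"
  have "card S \<ge> 1" using assms by (simp add: Suc_leI card_gt_0_iff)
  then have "is_quadrature q"
    using h assms(3) by (simp add: is_quadrature_def q_def bij_betw_def)
  moreover have "quad q f = (\<Sum>x\<in>S. w x * f x)" for f
    using sum.reindex_bij_betw[OF h, of "\<lambda>x. w x * f x"] by (simp add: quad_def q_def)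
  moreover have "abs_quad q f = (\<Sum>x\<in>S. \<bar>w x\<bar> * \<bar>f x\<bar>)" for f
    using sum.reindex_bij_betw[OF h, of "\<lambda>x. \<bar>w x\<bar> * \<bar>f x\<bar>"] by (simp add: abs_quad_def q_def)
  ultimately show ?thesis by blast
qed

text \<open>The weights are the integrals of a continuous partition of unity subordinate to a cover of
  the sphere by small balls, and the nodes are the centres of these balls.\<close>

lemma exists_positive_quadrature_weights:
  fixes g :: "'i \<Rightarrow> real^3 \<Rightarrow> real"
  assumes "finite I" and g: "\<And>i. i \<in> I \<Longrightarrow> continuous_on unit_sphere (g i)" and "e > 0"
  shows "\<exists>S w. finite S \<and> S \<subseteq> unit_sphere \<and> (\<forall>x. 0 \<le> w x) \<and> (\<Sum>x\<in>S. w x) = 4 * pi \<and>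
           (\<forall>i\<in>I. \<bar>(\<Sum>x\<in>S. w x * g i x) - sphere_integral (g i)\<bar> \<le> e)"
proof -
  \<comment> \<open>A pointwise error of \<open>e'\<close> is integrated over total mass
    \<open>4 * pi\<close>.\<close>
  define e' where "e' = e / (4 * pi)"
  have "e' > 0" using \<open>e > 0\<close> by (simp add: e'_def)
  have "\<forall>i\<in>I. \<exists>d>0. \<forall>x\<in>unit_sphere. \<forall>z\<in>unit_sphere. dist x z < d \<longrightarrow> dist (g i x) (g i z) < e'"
    using compact_uniformly_continuous[OF g compact_sphere] \<open>e' > 0\<close>
    unfolding uniformly_continuous_on_def by (metis dist_commute)
  from bchoice[OF this] obtain d where d: "\<And>i. i \<in> I \<Longrightarrow> d i > 0"
      "\<And>i x z. i \<in> I \<Longrightarrow> x \<in> unit_sphere \<Longrightarrow> z \<in> unit_sphere \<Longrightarrow> dist x z < d i \<Longrightarrow> dist (g i x) (g i z) < e'"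
    by blast
  \<comment> \<open>The element 1 keeps the minimum defined for empty \<open>I\<close>.\<close>
  define r where "r = Min (insert 1 (d ` I))"
  have r: "r > 0" "\<And>i. i \<in> I \<Longrightarrow> r \<le> d i"
    using \<open>finite I\<close> d(1) by (auto simp: r_def)
  obtain S where S: "finite S" "S \<subseteq> unit_sphere" "unit_sphere \<subseteq> (\<Union>x\<in>S. ball x r)"
    using compactE_image[OF compact_sphere, of unit_sphere "\<lambda>x. ball x r"] r(1) by force
  \<comment> \<open>Tent functions around the centres; on the sphere their sum is positive because
    the balls cover it, so dividing by the sum gives the partition of unity.\<close>
  define \<psi> where "\<psi> k x = max 0 (r - dist k x)" for k x :: "real^3"
  define \<Psi> where "\<Psi> x = (\<Sum>k\<in>S. \<psi> k x)" for x
  define \<phi> where "\<phi> k x = \<psi> k x / \<Psi> x" for k x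
  have \<psi>_nonneg: "0 \<le> \<psi> k x" for k x by (simp add: \<psi>_def)
  have \<Psi>_pos: "\<Psi> x > 0" if x: "x \<in> unit_sphere" for x
  proof -
    obtain k where "k \<in> S" "dist k x < r" using S(3) x by auto
    then have "\<psi> k x > 0" by (simp add: \<psi>_def)
    then show ?thesis unfolding \<Psi>_def
      using \<open>k \<in> S\<close> S(1) \<psi>_nonneg by (meson sum_pos2)
  qed
  have cont\<psi>: "continuous_on A (\<psi> k)" for A k
    unfolding \<psi>_def by (intro continuous_intros)
  have cont\<Psi>: "continuous_on A \<Psi>" for A
    unfolding \<Psi>_def by (intro continuous_intros cont\<psi>)
  have cont\<phi>: "continuous_on unit_sphere (\<phi> k)" for k
    unfolding \<phi>_def using \<Psi>_pos by (intro continuous_intros cont\<psi> cont\<Psi>) (metis less_irrefl)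
  have \<phi>_nonneg: "0 \<le> \<phi> k x" for k x
    unfolding \<phi>_def \<Psi>_def by (intro divide_nonneg_nonneg sum_nonneg \<psi>_nonneg)
  have \<phi>_sum: "(\<Sum>k\<in>S. \<phi> k x) = 1" if "x \<in> unit_sphere" for x
    using \<Psi>_pos[OF that] by (simp add: \<phi>_def sum_divide_distrib[symmetric] \<Psi>_def[symmetric])
  define w where "w k = sphere_integral (\<phi> k)" for k
  have w_nonneg: "0 \<le> w k" for k
    unfolding w_def by (rule sphere_integral_nonneg) (rule \<phi>_nonneg)
  have "(\<Sum>k\<in>S. w k) = sphere_integral (\<lambda>x. \<Sum>k\<in>S. \<phi> k x)"
    unfolding w_def by (rule sphere_integral_sum[symmetric]) (rule cont\<phi>)
  also have "\<dots> = sphere_integral (\<lambda>_. 1)"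
    by (rule sphere_integral_cong) (rule \<phi>_sum)
  finally have w_sum: "(\<Sum>k\<in>S. w k) = 4 * pi" by simp
  have "\<bar>(\<Sum>k\<in>S. w k * g i k) - sphere_integral (g i)\<bar> \<le> e" if i: "i \<in> I" for i
  proof -
    define D where "D x = (\<Sum>k\<in>S. g i k * \<phi> k x) - g i x" for x
    have cont_sum: "continuous_on unit_sphere (\<lambda>x. \<Sum>k\<in>S. g i k * \<phi> k x)"
      by (intro continuous_intros cont\<phi>)
    have contD: "continuous_on unit_sphere D"
      unfolding D_def by (intro continuous_intros cont\<phi> g i)
    have "sphere_integral (\<lambda>x. \<Sum>k\<in>S. g i k * \<phi> k x) = (\<Sum>k\<in>S. sphere_integral (\<lambda>x. g i k * \<phi> k x))"
      by (rule sphere_integral_sum) (intro continuous_intros cont\<phi>)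
    also have "\<dots> = (\<Sum>k\<in>S. w k * g i k)"
      unfolding sphere_integral_cmult w_def by (rule sum.cong[OF refl]) (rule mult.commute)
    finally have eq: "(\<Sum>k\<in>S. w k * g i k) - sphere_integral (g i) = sphere_integral D"
      unfolding D_def sphere_integral_diff[OF cont_sum g[OF i]] by simp
    \<comment> \<open>\<open>D x\<close> is an average, with weights \<open>\<phi> k x\<close>, of
      the differences \<open>g i k - g i x\<close>, and only centres closer than \<open>r\<close>
      carry weight.\<close>
    have D_le: "\<bar>D x\<bar> \<le> e'" if x: "x \<in> unit_sphere" for x
    proof -
      have "g i x = (\<Sum>k\<in>S. g i x * \<phi> k x)"
        using \<phi>_sum[OF x] by (simp add: sum_distrib_left[symmetric])
      then have "D x = (\<Sum>k\<in>S. (g i k - g i x) * \<phi> k x)"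
        by (simp add: D_def left_diff_distrib sum_subtractf)
      also have "\<bar>\<dots>\<bar> \<le> (\<Sum>k\<in>S. \<bar>(g i k - g i x) * \<phi> k x\<bar>)" by (rule sum_abs)
      also have "\<dots> \<le> (\<Sum>k\<in>S. e' * \<phi> k x)"
      proof (rule sum_mono)
        fix k assume k: "k \<in> S"
        show "\<bar>(g i k - g i x) * \<phi> k x\<bar> \<le> e' * \<phi> k x"
        proof (cases "dist k x < r")
          case True
          then have "dist (g i k) (g i x) < e'"
            using d(2)[OF i _ x, of k] S(2) k r(2)[OF i] by auto
          then show ?thesis
            using \<phi>_nonneg[of k x] by (simp add: abs_mult dist_real_def mult_right_mono)
        next
          case False
          then have "\<phi> k x = 0" by (simp add: \<phi>_def \<psi>_def)
          then show ?thesis by simp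
        qed
      qed
      also have "\<dots> = e'" using \<phi>_sum[OF x] by (simp add: sum_distrib_left[symmetric])
      finally show ?thesis .
    qed
    have "sphere_integral D \<le> sphere_integral (\<lambda>_. e')"
      using D_le by (intro sphere_integral_mono contD continuous_intros) (auto simp: abs_le_iff)
    moreover have "sphere_integral (\<lambda>_. - e') \<le> sphere_integral D"
      using D_le by (intro sphere_integral_mono contD continuous_intros) (fastforce simp: abs_le_iff)
    ultimately show ?thesis unfolding eq by (simp add: e'_def abs_le_iff)
  qed
  then show ?thesis using S(1,2) w_nonneg w_sum by blast
qed

lemma exists_quadrature_with_atom:
  fixes g :: "'i \<Rightarrow> real^3 \<Rightarrow> real"
  assumes "finite I" and "\<And>i. i \<in> I \<Longrightarrow> continuous_on unit_sphere (g i)" and "e > 0"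
    and z: "z \<in> unit_sphere" and "a \<ge> 0"
  shows "\<exists>q. is_quadrature q \<and> abs_quad q (\<lambda>_. 1) = 4 * pi + a \<and>
           (\<forall>i\<in>I. \<bar>quad q (g i) - (sphere_integral (g i) + a * g i z)\<bar> \<le> e)"
proof -
  have "\<exists>S w. finite S \<and> S \<subseteq> unit_sphere \<and> (\<forall>x. 0 \<le> w x) \<and> (\<Sum>x\<in>S. w x) = 4 * pi \<and>
           (\<forall>i\<in>I. \<bar>(\<Sum>x\<in>S. w x * g i x) - sphere_integral (g i)\<bar> \<le> e)"
    by (rule exists_positive_quadrature_weights) (fact assms)+
  then obtain S w where S: "finite S" "S \<subseteq> unit_sphere" "\<forall>x. 0 \<le> w x" "(\<Sum>x\<in>S. w x) = 4 * pi"
      "\<forall>i\<in>I. \<bar>(\<Sum>x\<in>S. w x * g i x) - sphere_integral (g i)\<bar> \<le> e"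
    by (elim exE conjE)
  \<comment> \<open>The atom may fall on an existing node. As nodes must be distinct, its mass is
    then added to the weight already there.\<close>
  define v where "v x = (if x \<in> S then w x else 0) + (if x = z then a else 0)" for x
  have "\<exists>q. is_quadrature q \<and> (\<forall>f. quad q f = (\<Sum>x\<in>insert z S. v x * f x)) \<and>
             (\<forall>f. abs_quad q f = (\<Sum>x\<in>insert z S. \<bar>v x\<bar> * \<bar>f x\<bar>))"
    by (rule quadrature_of_finite_set) (use S z in auto)
  then obtain q where q: "is_quadrature q" "\<And>f. quad q f = (\<Sum>x\<in>insert z S. v x * f x)"
      "\<And>f. abs_quad q f = (\<Sum>x\<in>insert z S. \<bar>v x\<bar> * \<bar>f x\<bar>)" by blast
  have sum_v: "(\<Sum>x\<in>insert z S. v x * f x) = (\<Sum>x\<in>S. w x * f x) + a * f z" for f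
  proof -
    have "(\<Sum>x\<in>insert z S. v x * f x) = (\<Sum>x\<in>insert z S. (if x \<in> S then w x * f x else 0))
        + (\<Sum>x\<in>insert z S. (if x = z then a * f x else 0))"
      unfolding sum.distrib[symmetric] by (rule sum.cong) (auto simp: v_def ring_distribs)
    also have "(\<Sum>x\<in>insert z S. (if x \<in> S then w x * f x else 0)) = (\<Sum>x\<in>S. w x * f x)"
      using S(1) by (intro sum.mono_neutral_cong_right) auto
    also have "(\<Sum>x\<in>insert z S. (if x = z then a * f x else 0)) = a * f z"
      using S(1) by simp
    finally show ?thesis .
  qed
  have "0 \<le> v x" for x using S(3) \<open>a \<ge> 0\<close> by (simp add: v_def)
  then have "abs_quad q (\<lambda>_. 1) = 4 * pi + a"
    using sum_v[of "\<lambda>_. 1"] S(4) by (simp add: q(3))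
  moreover have "\<bar>quad q (g i) - (sphere_integral (g i) + a * g i z)\<bar> \<le> e" if "i \<in> I" for i
    using S(5) that by (simp add: q(2) sum_v algebra_simps)
  ultimately show ?thesis using q(1) by blast
qed

section \<open>The kernel diagonal and the two counterexamples\<close>

context harmonic_basis
begin

text \<open>The reciprocal of the Christoffel function: the squared norm of point evaluation at \<open>x\<close>
  on the polynomials of degree at most \<open>n\<close>.\<close>

definition kernel_diagonal :: "nat \<Rightarrow> real^3 \<Rightarrow> real" where
  "kernel_diagonal n x = (\<Sum>b\<in>ix n. (y b x)\<^sup>2)"

lemma kernel_diagonal_nonneg: "0 \<le> kernel_diagonal n x"
  by (simp add: kernel_diagonal_def sum_nonneg)

lemma kernel_diagonal_mono: "m \<le> n \<Longrightarrow> kernel_diagonal m x \<le> kernel_diagonal n x"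
  unfolding kernel_diagonal_def by (rule sum_mono2) (auto dest: ix_mono)

lemma continuous_on_kernel_diagonal: "continuous_on unit_sphere (kernel_diagonal n)"
  unfolding kernel_diagonal_def by (intro continuous_intros continuous_on_y)

lemma integral_kernel_diagonal: "sphere_integral (kernel_diagonal n) = (real n + 1)\<^sup>2"
proof -
  have "sphere_integral (kernel_diagonal n) = (\<Sum>b\<in>ix n. sphere_integral (\<lambda>x. (y b x)\<^sup>2))"
    unfolding kernel_diagonal_def by (rule sphere_integral_sum) (intro continuous_intros continuous_on_y)
  also have "\<dots> = (\<Sum>b\<in>ix n. 1)"
    by (rule sum.cong) (use y_orthonormal in \<open>auto simp: power2_eq_square\<close>)
  finally show ?thesis by (simp add: card_ix)
qed

text \<open>The coefficients \<open>y b x\<close> define the reproducing kernel at \<open>x\<close>.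
  Its value at \<open>x\<close> equals its squared norm (\<open>L2_norm_kernel\<close>), which makes
  it extremal for point evaluation and the natural test function below.\<close>

lemma expansion_at_kernel: "expansion n (\<lambda>b. y b x) x = kernel_diagonal n x"
  by (simp add: expansion_def kernel_diagonal_def power2_eq_square)

lemma L2_norm_kernel: "(L2_norm (expansion n (\<lambda>b. y b x)))\<^sup>2 = kernel_diagonal n x"
  by (simp add: L2_norm_expansion kernel_diagonal_def)

text \<open>Evaluation at \<open>x\<close> is the inner product with the reproducing kernel at
  \<open>x\<close>, so Cauchy-Schwarz applies.\<close>

lemma point_evaluation_le:
  assumes p: "p \<in> sphere_polys_upto n" and x: "x \<in> unit_sphere"
  shows "\<bar>p x\<bar> \<le> L2_norm p * sqrt (kernel_diagonal n x)"
proof -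
  obtain c where c: "\<And>x. x \<in> unit_sphere \<Longrightarrow> p x = expansion n c x"
    using sphere_polys_upto_expansion[OF p] by blast
  have "p x = sphere_integral (\<lambda>z. expansion n c z * expansion n (\<lambda>b. y b x) z)"
    unfolding c[OF x] integral_expansion_expansion by (simp add: expansion_def)
  also have "\<bar>\<dots>\<bar> \<le> L2_norm (expansion n c) * L2_norm (expansion n (\<lambda>b. y b x))"
    by (intro sphere_integral_abs_le_L2_norm continuous_on_expansion)
  also have "L2_norm (expansion n (\<lambda>b. y b x)) = sqrt (kernel_diagonal n x)"
    using L2_norm_kernel[of n x] by (metis L2_norm_nonneg real_sqrt_unique)
  also have "L2_norm (expansion n c) = L2_norm p" by (rule L2_norm_cong) (simp only: c)
  finally show ?thesis .
qed

text \<open>The integrals are the coefficients of the constant 1, whose squared norm is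
  \<open>4 * pi\<close>.\<close>

lemma sum_squares_integral_y: "(\<Sum>b\<in>ix n. (sphere_integral (y b))\<^sup>2) = 4 * pi"
proof -
  obtain c where c: "\<And>x. x \<in> unit_sphere \<Longrightarrow> 1 = expansion n c x"
    using sphere_polys_upto_expansion[OF const_in_sphere_polys_upto[of 1]] by blast
  have "sphere_integral (y b) = c b" if b: "b \<in> ix n" for b
  proof -
    have "sphere_integral (y b) = sphere_integral (\<lambda>x. y b x * expansion n c x)"
      by (rule sphere_integral_cong) (simp only: c[symmetric] mult_1_right)
    then show ?thesis using integral_y_expansion[OF b] by simp
  qed
  then have "(\<Sum>b\<in>ix n. (sphere_integral (y b))\<^sup>2) = (L2_norm (expansion n c))\<^sup>2"
    unfolding L2_norm_expansion by (intro sum.cong) auto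
  also have "L2_norm (expansion n c) = L2_norm (\<lambda>_. 1)"
    by (rule L2_norm_cong) (rule c[symmetric])
  finally show ?thesis by (simp add: L2_norm_one)
qed

lemma exists_QC_not_FAP_MZ12:
  "\<exists>Q. quadrature_seq Q \<and> QC Q \<and> \<not> FAP Y Q \<and> \<not> MZ12 Q"
proof -
  \<comment> \<open>The mass tends to 0, but its square times \<open>kernel_diagonal n (z n)\<close>
    is at least \<open>(n + 1) / (4 * pi)\<close>.\<close>
  define a where "a n = 1 / sqrt (real n + 1)" for n
  have a_nonneg: "0 \<le> a n" for n by (simp add: a_def)
  have a_sq: "(a n)\<^sup>2 = 1 / (real n + 1)" for n by (simp add: a_def power_divide)
  have inv_lim: "(\<lambda>n. 1 / (real n + 1)) \<longlonglongrightarrow> 0"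
    using LIMSEQ_inverse_real_of_nat by (simp add: inverse_eq_divide add.commute)
  have a_lim: "a \<longlonglongrightarrow> 0"
    using tendsto_real_sqrt[OF inv_lim] by (simp add: a_def[abs_def] real_sqrt_divide)
  have "\<forall>n. \<exists>z. z \<in> unit_sphere \<and> (real n + 1)\<^sup>2 \<le> 4 * pi * kernel_diagonal n z"
    using exists_average_le[OF continuous_on_kernel_diagonal] unfolding integral_kernel_diagonal by blast
  from choice[OF this] obtain z where z: "\<And>n. z n \<in> unit_sphere"
      "\<And>n. (real n + 1)\<^sup>2 \<le> 4 * pi * kernel_diagonal n (z n)"
    by blast
  \<comment> \<open>The tolerance \<open>1 / (n + 1)\<close> tends to 0, as (AP) demands, and its
    squares over the \<open>(n + 1)^2\<close> basis functions sum to exactly 1.\<close>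
  have "\<exists>q. is_quadrature q \<and> abs_quad q (\<lambda>_. 1) = 4 * pi + a n \<and>
      (\<forall>b\<in>ix n. \<bar>quad q (y b) - (sphere_integral (y b) + a n * y b (z n))\<bar> \<le> 1 / (real n + 1))" for n
    by (rule exists_quadrature_with_atom) (use continuous_on_y z(1) a_nonneg in auto)
  then have "\<forall>n. \<exists>q. is_quadrature q \<and> abs_quad q (\<lambda>_. 1) = 4 * pi + a n \<and>
      (\<forall>b\<in>ix n. \<bar>quad q (y b) - (sphere_integral (y b) + a n * y b (z n))\<bar> \<le> 1 / (real n + 1))" by blast
  from choice[OF this] obtain Q where Q: "\<And>n. is_quadrature (Q n)"
      "\<And>n. abs_quad (Q n) (\<lambda>_. 1) = 4 * pi + a n"
      "\<And>n b. b \<in> ix n \<Longrightarrow>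
         \<bar>quad (Q n) (y b) - (sphere_integral (y b) + a n * y b (z n))\<bar> \<le> 1 / (real n + 1)"
    by blast
  have seq: "quadrature_seq Q" by (simp add: quadrature_seq_def Q(1))
  have "PS Q"
    unfolding PS_iff
  proof (intro exI conjI allI impI)
    fix n :: nat
    have "a n \<le> 1" by (simp add: a_def)
    then show "abs_quad (Q n) (\<lambda>_. 1) \<le> 4 * pi + 1" by (simp add: Q(2))
  qed (simp add: add_pos_pos)
  moreover have "AP Q"
    unfolding AP_def
  proof
    fix p assume "p \<in> sphere_polys"
    then obtain m where "p \<in> sphere_polys_upto m" by (auto simp: sphere_polys_def)
    then obtain c where c: "\<And>x. x \<in> unit_sphere \<Longrightarrow> p x = expansion m c x"
      using sphere_polys_upto_expansion by metis
    \<comment> \<open>By linearity single basis functions suffice. Each is bounded on the sphere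
      independently of \<open>n\<close>, so the vanishing mass removes the atom in the
      limit.\<close>
    have lim: "(\<lambda>n. quad (Q n) (y b) - sphere_integral (y b)) \<longlonglongrightarrow> 0" if b: "b \<in> ix m" for b
    proof -
      obtain B where B: "\<And>x. x \<in> unit_sphere \<Longrightarrow> \<bar>y b x\<bar> \<le> B"
        using continuous_on_sphere_bounded[OF continuous_on_y[OF b]] by blast
      have bound_lim: "(\<lambda>n. 1 / (real n + 1) + a n * B) \<longlonglongrightarrow> 0"
        using tendsto_add[OF inv_lim tendsto_mult_right[OF a_lim, of B]] by simp
      have "eventually (\<lambda>n. norm (quad (Q n) (y b) - sphere_integral (y b))
          \<le> 1 / (real n + 1) + a n * B) sequentially"
        using eventually_ge_at_top[of m]
      proof eventually_elim
        case (elim n)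
        have "b \<in> ix n" using b ix_mono[OF elim] by blast
        moreover have "\<bar>a n * y b (z n)\<bar> \<le> a n * B"
          using B[OF z(1)[of n]] a_nonneg[of n] by (simp add: abs_mult mult_left_mono)
        ultimately show ?case using Q(3)[of b n] unfolding real_norm_def by linarith
      qed
      then show ?thesis using bound_lim by (rule Lim_null_comparison)
    qed
    have eq: "quad (Q n) p - sphere_integral p
        = (\<Sum>b\<in>ix m. c b * (quad (Q n) (y b) - sphere_integral (y b)))" for n
    proof -
      have "quad (Q n) p = quad (Q n) (\<lambda>x. 1 * expansion m c x)"
        by (rule quad_cong[OF Q(1)]) (simp only: c mult_1_left)
      also have "\<dots> = (\<Sum>b\<in>ix m. c b * quad (Q n) (y b))"
        by (subst quad_mult_expansion) simp
      finally have 1: "quad (Q n) p = (\<Sum>b\<in>ix m. c b * quad (Q n) (y b))" .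
      have "sphere_integral p = sphere_integral (\<lambda>x. expansion m c x * 1)"
        by (rule sphere_integral_cong) (simp only: c mult_1_right)
      also have "\<dots> = (\<Sum>b\<in>ix m. c b * sphere_integral (y b))"
        by (subst integral_expansion_mult) simp_all
      finally show ?thesis using 1 by (simp add: right_diff_distrib sum_subtractf)
    qed
    have "(\<lambda>n. \<Sum>b\<in>ix m. c b * (quad (Q n) (y b) - sphere_integral (y b))) \<longlonglongrightarrow> (\<Sum>b\<in>ix m. c b * 0)"
      by (intro tendsto_intros lim)
    then show "(\<lambda>n. \<bar>quad (Q n) p - sphere_integral p\<bar>) \<longlonglongrightarrow> 0"
      unfolding eq by (intro tendsto_rabs_zero) simp
  qed
  ultimately have "QC Q" by (rule AP_PS_imp_QC[OF seq, rotated])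
  \<comment> \<open>The coefficients of \<open>L_n 1\<close> are the values
    \<open>Q_n (y b)\<close>. The exact integrals and the tolerance contribute bounded sums of
    squares, so the growing contribution of the atom dominates.\<close>
  have unbounded: "\<exists>n\<ge>1. K < L2_norm (hyperinterp Y n (Q n) (\<lambda>_. 1))" for K
  proof (rule ccontr)
    assume "\<not> ?thesis"
    then have le: "L2_norm (hyperinterp Y n (Q n) (\<lambda>_. 1)) \<le> K" if "n \<ge> 1" for n using that by force
    have bound: "real n + 1 \<le> 4 * pi * (3 * (K\<^sup>2 + 4 * pi + 1))" if "n \<ge> 1" for n
    proof -
      let ?q = "\<lambda>b. quad (Q n) (y b)" and ?s = "\<lambda>b. sphere_integral (y b)"
      have "(\<Sum>b\<in>ix n. (?q b)\<^sup>2) = (L2_norm (hyperinterp Y n (Q n) (\<lambda>_. 1)))\<^sup>2"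
        by (simp add: hyperinterp_eq_expansion L2_norm_expansion)
      also have "\<dots> \<le> K\<^sup>2" using le[OF that] by (intro power_mono) auto
      finally have q: "(\<Sum>b\<in>ix n. (?q b)\<^sup>2) \<le> K\<^sup>2" .
      have "(a n * y b (z n))\<^sup>2 \<le> 3 * ((?q b)\<^sup>2 + (?s b)\<^sup>2 + (1 / (real n + 1))\<^sup>2)" if b: "b \<in> ix n" for b
      proof -
        define t where "t = ?q b - (?s b + a n * y b (z n))"
        have "t\<^sup>2 \<le> (1 / (real n + 1))\<^sup>2"
          using Q(3)[OF b] by (intro power2_le_iff_abs_le[THEN iffD2]) (auto simp: t_def)
        \<comment> \<open>The right side exceeds the left by the sum of the squares of
          \<open>?q b + ?s b\<close>, \<open>?q b + t\<close> and \<open>?s b - t\<close>.\<close>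
        moreover have "(?q b - ?s b - t)\<^sup>2 \<le> 3 * ((?q b)\<^sup>2 + (?s b)\<^sup>2 + t\<^sup>2)"
          using sum_power2_ge_zero[of "?q b + ?s b" "?q b + t"] zero_le_power2[of "?s b - t"]
          by (simp add: power2_eq_square algebra_simps)
        moreover have "a n * y b (z n) = ?q b - ?s b - t" by (simp add: t_def)
        ultimately show ?thesis by simp
      qed
      then have "(\<Sum>b\<in>ix n. (a n * y b (z n))\<^sup>2)
          \<le> (\<Sum>b\<in>ix n. 3 * ((?q b)\<^sup>2 + (?s b)\<^sup>2 + (1 / (real n + 1))\<^sup>2))" by (rule sum_mono)
      also have "\<dots> = 3 * ((\<Sum>b\<in>ix n. (?q b)\<^sup>2) + 4 * pi + (\<Sum>b\<in>ix n. (1 / (real n + 1))\<^sup>2))"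
        by (simp only: sum_distrib_left[symmetric] sum.distrib sum_squares_integral_y)
      also have "(\<Sum>b\<in>ix n. (1 / (real n + 1))\<^sup>2) = 1"
        by (simp add: card_ix power_divide)
      also have "(\<Sum>b\<in>ix n. (a n * y b (z n))\<^sup>2) = kernel_diagonal n (z n) / (real n + 1)"
        by (simp add: power_mult_distrib a_sq kernel_diagonal_def sum_divide_distrib)
      also have "3 * ((\<Sum>b\<in>ix n. (?q b)\<^sup>2) + 4 * pi + 1) \<le> 3 * (K\<^sup>2 + 4 * pi + 1)"
        using q by simp
      finally have "kernel_diagonal n (z n) / (real n + 1) \<le> 3 * (K\<^sup>2 + 4 * pi + 1)" .
      then have "kernel_diagonal n (z n) \<le> 3 * (K\<^sup>2 + 4 * pi + 1) * (real n + 1)"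
        by (simp add: pos_divide_le_eq)
      then have "4 * pi * kernel_diagonal n (z n) \<le> 4 * pi * (3 * (K\<^sup>2 + 4 * pi + 1) * (real n + 1))"
        by (rule mult_left_mono) simp
      then have "4 * pi * kernel_diagonal n (z n) \<le> 4 * pi * (3 * (K\<^sup>2 + 4 * pi + 1)) * (real n + 1)"
        by (simp only: mult.assoc)
      with z(2)[of n] have "(real n + 1)\<^sup>2 \<le> 4 * pi * (3 * (K\<^sup>2 + 4 * pi + 1)) * (real n + 1)"
        by (rule order_trans)
      then have "(real n + 1) * (real n + 1) \<le> 4 * pi * (3 * (K\<^sup>2 + 4 * pi + 1)) * (real n + 1)"
        by (simp only: power2_eq_square)
      then show ?thesis by (rule mult_right_le_imp_le) simp
    qed
    obtain N where "4 * pi * (3 * (K\<^sup>2 + 4 * pi + 1)) \<le> real N" using real_arch_simple by blast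
    moreover have "real (Suc N) + 1 \<le> 4 * pi * (3 * (K\<^sup>2 + 4 * pi + 1))" by (rule bound) simp
    ultimately have "real (Suc N) + 1 \<le> real N" by (rule order_trans[rotated])
    then show False by simp
  qed
  have "\<not> MZ12 Q"
  proof
    assume "MZ12 Q"
    then have "LB Y Q" using MZ12_iff_LB[OF seq] by simp
    then obtain C where "\<And>n f. n \<ge> 1 \<Longrightarrow> continuous_on unit_sphere f \<Longrightarrow>
        (\<forall>x\<in>unit_sphere. \<bar>f x\<bar> \<le> 1) \<Longrightarrow> L2_norm (hyperinterp Y n (Q n) f) \<le> C"
      unfolding LB_iff by blast
    then have "\<forall>n\<ge>1. L2_norm (hyperinterp Y n (Q n) (\<lambda>_. 1)) \<le> C" by simp
    then show False using unbounded[of C] by force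
  qed
  \<comment> \<open>The constant 1 is the witness: convergence of \<open>L_n 1\<close> would bound
    its norms.\<close>
  moreover have "\<not> FAP Y Q"
  proof
    assume "FAP Y Q"
    moreover have "(\<lambda>_. 1) \<in> sphere_polys" using const_in_sphere_polys_upto by (auto simp: sphere_polys_def)
    ultimately have "(\<lambda>n. L2_norm (\<lambda>x. hyperinterp Y n (Q n) (\<lambda>_. 1) x - 1)) \<longlonglongrightarrow> 0"
      by (auto simp: FAP_def)
    then have "Bseq (\<lambda>n. L2_norm (\<lambda>x. hyperinterp Y n (Q n) (\<lambda>_. 1) x - 1))"
      by (intro convergent_imp_Bseq convergentI)
    then obtain K where K: "\<And>n. \<bar>L2_norm (\<lambda>x. hyperinterp Y n (Q n) (\<lambda>_. 1) x - 1)\<bar> \<le> K"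
      by (auto simp: Bseq_def)
    have "L2_norm (hyperinterp Y n (Q n) (\<lambda>_. 1)) \<le> K + sqrt (4 * pi)" for n
    proof -
      have "L2_norm (\<lambda>x. (hyperinterp Y n (Q n) (\<lambda>_. 1) x - 1) + 1)
          \<le> L2_norm (\<lambda>x. hyperinterp Y n (Q n) (\<lambda>_. 1) x - 1) + L2_norm (\<lambda>_. 1)"
        by (intro L2_norm_triangle continuous_intros continuous_on_hyperinterp)
      then show ?thesis using K[of n] by (simp add: L2_norm_one)
    qed
    then show False using unbounded[of "K + sqrt (4 * pi)"] by (meson not_le)
  qed
  ultimately show ?thesis using seq \<open>QC Q\<close> by blast
qed

text \<open>Averaging over the sphere: the integral of \<open>kernel_diagonal m\<close> is quadratic in \<open>m\<close>, while that
  of \<open>sqrt (kernel_diagonal n)\<close> is only linear in \<open>n\<close>.\<close>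

lemma exists_kernel_gap:
  "\<exists>x\<in>unit_sphere. (real (n div 2) + 1) / (4 * sqrt (4 * pi)) * sqrt (kernel_diagonal n x)
      < kernel_diagonal (n div 2) x"
proof -
  define m where "m = n div 2"
  \<comment> \<open>The constant leaves room: with it, \<open>A\<close> times the integral of
    \<open>sqrt (kernel_diagonal n x)\<close> is at most \<open>(m + 1) * (n + 1) / 4\<close>. Since
    \<open>n + 1\<close> is at most \<open>2 * (m + 1)\<close>, this is below
    \<open>(m + 1)^2\<close>, the integral of \<open>kernel_diagonal m\<close>.\<close>
  define A where "A = (real m + 1) / (4 * sqrt (4 * pi))"
  have cont: "continuous_on unit_sphere (\<lambda>x. sqrt (kernel_diagonal n x))"
    by (intro continuous_intros continuous_on_kernel_diagonal)
  have contF: "continuous_on unit_sphere (\<lambda>x. kernel_diagonal m x - A * sqrt (kernel_diagonal n x))"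
    by (intro continuous_intros cont continuous_on_kernel_diagonal)
  obtain x where x: "x \<in> unit_sphere"
    "sphere_integral (\<lambda>x. kernel_diagonal m x - A * sqrt (kernel_diagonal n x))
       \<le> 4 * pi * (kernel_diagonal m x - A * sqrt (kernel_diagonal n x))"
    using exists_average_le[OF contF] by blast
  have "sphere_integral (\<lambda>x. sqrt (kernel_diagonal n x) * 1)
      \<le> L2_norm (\<lambda>x. sqrt (kernel_diagonal n x)) * L2_norm (\<lambda>_. 1)"
    using sphere_integral_abs_le_L2_norm[OF cont continuous_on_const] abs_le_D1 by blast
  moreover have "L2_norm (\<lambda>x. sqrt (kernel_diagonal n x)) = real n + 1"
    by (simp add: L2_norm_def kernel_diagonal_nonneg integral_kernel_diagonal)
  ultimately have "A * sphere_integral (\<lambda>x. sqrt (kernel_diagonal n x)) \<le> A * ((real n + 1) * sqrt (4 * pi))"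
    by (intro mult_left_mono) (simp_all add: L2_norm_one A_def)
  also have "\<dots> = (real m + 1) * (real n + 1) / 4" by (simp add: A_def)
  also have "\<dots> \<le> (real m + 1) * (2 * (real m + 1)) / 4"
    by (intro divide_right_mono mult_left_mono) (auto simp: m_def)
  also have "\<dots> < (real m + 1)\<^sup>2" by (simp add: power2_eq_square)
  finally have "0 < sphere_integral (\<lambda>x. kernel_diagonal m x - A * sqrt (kernel_diagonal n x))"
    by (simp add: sphere_integral_diff continuous_on_kernel_diagonal continuous_intros cont
        sphere_integral_cmult integral_kernel_diagonal)
  with x(2) have "0 < 4 * pi * (kernel_diagonal m x - A * sqrt (kernel_diagonal n x))" by linarith
  then show ?thesis using x(1) by (auto simp: zero_less_mult_iff A_def m_def)
qed

lemma exists_MZ12_not_MZ1_MZ2: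
  "\<exists>Q. quadrature_seq Q \<and> MZ12 Q \<and> \<not> MZ1 Q \<and> \<not> MZ2 Q"
proof -
  define A where "A n = (real (n div 2) + 1) / (4 * sqrt (4 * pi))" for n
  have A_pos: "0 < A n" for n by (simp add: A_def)
  have A_unbounded: "\<exists>n\<ge>1. c \<le> A n" for c
  proof -
    obtain N where N: "c * (4 * sqrt (4 * pi)) \<le> real N" using real_arch_simple by blast
    then have "c \<le> A (2 * N + 1)" by (simp add: A_def pos_le_divide_eq)
    then show ?thesis by (intro exI[of _ "2 * N + 1"]) simp
  qed
  have "\<forall>n. \<exists>x. x \<in> unit_sphere \<and> A n * sqrt (kernel_diagonal n x) < kernel_diagonal (n div 2) x"
    using exists_kernel_gap unfolding A_def by blast
  from choice[OF this] obtain x where x: "\<And>n. x n \<in> unit_sphere"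
    "\<And>n. A n * sqrt (kernel_diagonal n (x n)) < kernel_diagonal (n div 2) (x n)" by blast
  define K where "K n = kernel_diagonal n (x n)" for n
  define Km where "Km n = kernel_diagonal (n div 2) (x n)" for n
  have gap: "A n * sqrt (K n) < Km n" for n using x(2) by (simp add: K_def Km_def)
  have "0 \<le> K n" for n by (simp add: K_def kernel_diagonal_nonneg)
  then have "0 \<le> A n * sqrt (K n)" for n using A_pos[of n] by simp
  then have Km_pos: "0 < Km n" for n using gap by (rule le_less_trans)
  have KmK: "Km n \<le> K n" for n unfolding K_def Km_def by (rule kernel_diagonal_mono) simp
  then have K_pos: "0 < K n" for n using Km_pos[of n] by (meson less_le_trans)
  \<comment> \<open>The mass is the reciprocal of the bound in \<open>point_evaluation_le\<close>
    for polynomials of norm 1.\<close>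
  have "\<forall>n. \<exists>q. is_quadrature q \<and> (\<forall>f. quad q f = (\<Sum>z\<in>{x n}. 1 / sqrt (K n) * f z)) \<and>
      (\<forall>f. abs_quad q f = (\<Sum>z\<in>{x n}. \<bar>1 / sqrt (K n)\<bar> * \<bar>f z\<bar>))"
    using x(1) by (intro allI quadrature_of_finite_set) auto
  from choice[OF this] obtain Q where Q: "\<And>n. is_quadrature (Q n)"
      "\<And>n f. abs_quad (Q n) f = (\<Sum>z\<in>{x n}. \<bar>1 / sqrt (K n)\<bar> * \<bar>f z\<bar>)" by blast
  have abs_quad_Q: "abs_quad (Q n) f = \<bar>f (x n)\<bar> / sqrt (K n)" for n f
    using K_pos[of n] by (simp add: Q(2))
  have seq: "quadrature_seq Q" by (simp add: quadrature_seq_def Q(1))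
  moreover have "MZ12 Q"
    unfolding MZ12_iff
  proof (intro exI[of _ 1] conjI allI impI ballI)
    fix n p assume "p \<in> sphere_polys_upto n"
    then have "\<bar>p (x n)\<bar> \<le> L2_norm p * sqrt (K n)"
      unfolding K_def using x(1) by (rule point_evaluation_le)
    then show "abs_quad (Q n) p \<le> 1 * L2_norm p"
      using K_pos[of n] by (simp add: abs_quad_Q pos_divide_le_eq)
  qed simp
  moreover have "\<not> MZ1 Q"
  proof
    assume "MZ1 Q"
    then obtain c where c: "\<And>n p. n \<ge> 1 \<Longrightarrow> p \<in> sphere_polys_upto n \<Longrightarrow> abs_quad (Q n) p \<le> c * L1_norm p"
      unfolding MZ1_def abs_quad_def by blast
    obtain n where n: "n \<ge> 1" "c \<le> A n" using A_unbounded by blast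
    \<comment> \<open>The square of this kernel has degree at most \<open>n\<close> and
      \<open>L1_norm\<close> equal to \<open>Km n\<close>, while its value at the atom is the square
      of \<open>Km n\<close>. So (MZ1) would bound \<open>Km n\<close> by
      \<open>c * sqrt (K n)\<close>, against the gap.\<close>
    define \<kappa> where "\<kappa> = expansion (n div 2) (\<lambda>b. y b (x n))"
    have "(\<lambda>z. \<kappa> z * \<kappa> z) \<in> sphere_polys_upto (n div 2 + n div 2)"
      unfolding \<kappa>_def by (intro sphere_polys_upto_mult expansion_in_sphere_polys_upto)
    then have "(\<lambda>z. \<kappa> z * \<kappa> z) \<in> sphere_polys_upto n"
      using sphere_polys_upto_mono[of "n div 2 + n div 2" n] by (auto simp flip: mult_2)
    from c[OF n(1) this] have "\<bar>\<kappa> (x n) * \<kappa> (x n)\<bar> / sqrt (K n) \<le> c * L1_norm (\<lambda>z. \<kappa> z * \<kappa> z)"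
      by (simp only: abs_quad_Q)
    moreover have "\<kappa> (x n) = Km n" by (simp add: \<kappa>_def Km_def expansion_at_kernel)
    moreover have "L1_norm (\<lambda>z. \<kappa> z * \<kappa> z) = Km n"
      using L2_norm_kernel[of "n div 2" "x n"] unfolding L2_norm_power2
      by (simp add: L1_norm_def \<kappa>_def Km_def power2_eq_square)
    ultimately have "Km n * Km n \<le> (c * sqrt (K n)) * Km n"
      using K_pos[of n] by (simp add: pos_divide_le_eq mult_ac)
    then have "Km n \<le> c * sqrt (K n)" using Km_pos[of n] by (rule mult_right_le_imp_le)
    also have "\<dots> \<le> A n * sqrt (K n)" using n(2) K_pos[of n] by (intro mult_right_mono) auto
    finally show False using gap[of n] by simp
  qed
  moreover have "\<not> MZ2 Q"
  proof
    assume "MZ2 Q"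
    then obtain c where c: "\<And>n p. n \<ge> 1 \<Longrightarrow> p \<in> sphere_polys_upto n \<Longrightarrow>
        (\<Sum>j=1..num_nodes (Q n). \<bar>weight (Q n) j\<bar> * \<bar>p (node (Q n) j)\<bar>\<^sup>2) \<le> c * (L2_norm p)\<^sup>2"
      unfolding MZ2_def by blast
    obtain n where n: "n \<ge> 1" "c \<le> A n" using A_unbounded by blast
    \<comment> \<open>(MZ2) squares the test polynomial itself, so the kernel of full degree
      \<open>n\<close> is admissible. It would give \<open>K n\<close> at most
      \<open>c * sqrt (K n)\<close>, although \<open>K n\<close> is at least
      \<open>Km n\<close>.\<close>
    define \<kappa> where "\<kappa> = expansion n (\<lambda>b. y b (x n))"
    have norm_\<kappa>: "(L2_norm \<kappa>)\<^sup>2 = K n" by (simp add: \<kappa>_def K_def L2_norm_kernel)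
    have "\<kappa> \<in> sphere_polys_upto n" unfolding \<kappa>_def by (rule expansion_in_sphere_polys_upto)
    from c[OF n(1) this] have "abs_quad (Q n) (\<lambda>z. (\<kappa> z)\<^sup>2) \<le> c * K n"
      by (simp add: norm_\<kappa> abs_quad_def)
    moreover have "\<kappa> (x n) = K n" by (simp add: \<kappa>_def K_def expansion_at_kernel)
    ultimately have "K n * K n \<le> (c * sqrt (K n)) * K n"
      using K_pos[of n] by (simp add: abs_quad_Q pos_divide_le_eq mult_ac power2_eq_square)
    then have "K n \<le> c * sqrt (K n)" using K_pos[of n] by (rule mult_right_le_imp_le)
    also have "\<dots> \<le> A n * sqrt (K n)" using n(2) K_pos[of n] by (intro mult_right_mono) auto
    also have "\<dots> < Km n" by (rule gap)
    also have "\<dots> \<le> K n" by (rule KmK)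
    finally show False by simp
  qed
  ultimately show ?thesis by blast
qed

end

theorem theorem6p1:
  fixes Y :: "nat \<Rightarrow> int \<Rightarrow> real^3 \<Rightarrow> real"
  assumes "\<And>l. orthonormal_basis_of_harmonics l (Y l)"
  shows
    "(\<forall>Q. quadrature_seq Q \<longrightarrow>
        (HC Y Q \<longleftrightarrow> FAP Y Q \<and> MZ12 Q) \<and>
        (QC Q \<longleftrightarrow> AP Q \<and> PS Q) \<and>
        (MZ12 Q \<longleftrightarrow> LB Y Q) \<and>
        (PS Q \<longleftrightarrow> QB Q) \<and>
        (HC Y Q \<longrightarrow> QC Q) \<and>
        (FAP Y Q \<longrightarrow> AP Q) \<and>
        (MZ12 Q \<longrightarrow> PS Q) \<and>
        (MZ1 Q \<longrightarrow> MZ12 Q) \<and>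
        (MZ2 Q \<longrightarrow> MZ12 Q)) \<and>
     (\<exists>Q. quadrature_seq Q \<and> QC Q \<and> \<not> HC Y Q) \<and>
     (\<exists>Q. quadrature_seq Q \<and> AP Q \<and> \<not> FAP Y Q) \<and>
     (\<exists>Q. quadrature_seq Q \<and> PS Q \<and> \<not> MZ12 Q) \<and>
     (\<exists>Q. quadrature_seq Q \<and> MZ12 Q \<and> \<not> MZ1 Q) \<and>
     (\<exists>Q. quadrature_seq Q \<and> MZ12 Q \<and> \<not> MZ2 Q)"
proof -
  interpret harmonic_basis Y by unfold_locales (rule assms)
  have relations: "(HC Y Q \<longleftrightarrow> FAP Y Q \<and> MZ12 Q) \<and> (QC Q \<longleftrightarrow> AP Q \<and> PS Q) \<and>
      (MZ12 Q \<longleftrightarrow> LB Y Q) \<and> (PS Q \<longleftrightarrow> QB Q) \<and> (HC Y Q \<longrightarrow> QC Q) \<and> (FAP Y Q \<longrightarrow> AP Q) \<and>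
      (MZ12 Q \<longrightarrow> PS Q) \<and> (MZ1 Q \<longrightarrow> MZ12 Q) \<and> (MZ2 Q \<longrightarrow> MZ12 Q)" if Q: "quadrature_seq Q" for Q
    using FAP_MZ12_imp_HC[OF Q] HC_imp_FAP[of Q] HC_imp_LB[OF Q] MZ12_iff_LB[OF Q] PS_iff_QB[OF Q]
      AP_PS_imp_QC[OF Q] QC_imp_AP[of Q] QC_imp_QB[OF Q] HC_imp_QC[OF Q] FAP_imp_AP[OF Q]
      MZ12_imp_PS[of Q] MZ1_imp_MZ12[of Q] MZ2_imp_MZ12[of Q]
    by blast
  \<comment> \<open>One sequence refutes the first three implications, since (QC) yields (AP) and
    (PS) and (HC) would yield (FAP); another refutes the last two.\<close>
  obtain Q where Q: "quadrature_seq Q" "QC Q" "\<not> FAP Y Q" "\<not> MZ12 Q"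
    using exists_QC_not_FAP_MZ12 by blast
  then have Q': "AP Q" "PS Q" "\<not> HC Y Q"
    using relations[OF Q(1)] by blast+
  obtain R where R: "quadrature_seq R" "MZ12 R" "\<not> MZ1 R" "\<not> MZ2 R"
    using exists_MZ12_not_MZ1_MZ2 by blast
  show ?thesis
    by (rule conjI, intro allI impI, erule relations) (use Q Q' R in blast)
qed

end
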